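(* Let $\mathcal{F}$ be a Borel set of reductions which satisfies the $\sigma$-boundness condition. Then $\mathcal{F}$ has the Strong Decomposition Property, i.e. for every $A\subseteq\mathbb{R}$ with $A\leq_\mathcal{F}\neg A$ and $A\notin\Delta_\mathcal{F}$ there is a $\Delta_\mathcal{F}$-bounded partition $\langle D_n\mid n\in\omega\rangle$ of $\mathbb{R}$ such that $A\cap D_n<_\mathcal{F}A$ for every $n$.
   Context: Work in $\mathsf{ZF}+\mathsf{DC}(\mathbb{R})+\mathsf{SLO}^{\mathsf{L}}+\neg\mathsf{FS}$ (consequences of $\mathsf{ZF}+\mathsf{AD}+\mathsf{DC}(\mathbb{R})$). $\mathbb{R}={}^\omega\omega$ (Baire space) with metric $d(x,y)=2^{-n}$, $n$ least with $x(n)\ne y(n)$; $\mathbf{N}_s=\{x:s\subseteq x\}$; $\neg A=\mathbb{R}\setminus A$. $\mathsf{L}$ = functions $f\colon\mathbb{R}\to\mathbb{R}$ with $d(f(x),f(y))\le d(x,y)$. $\mathsf{SLO}^{\mathsf{L}}$: for all $A,B$, $A\leq_{\mathsf L}B$ or $\neg B\leq_{\mathsf L}A$. $\neg\mathsf{FS}$: no $F\subseteq{}^\omega2$ is a flip-set (i.e. such that $z\in F\iff w\notin F$ whenever $z,w$ differ at exactly one coordinate). A set of reductions is $\mathcal{F}\subseteq{}^{\mathbb{R}}\mathbb{R}$ closed under composition, containing $\mathsf{L}$, with a surjection of $\mathbb{R}$ onto $\mathcal{F}$; $A\leq_\mathcal{F}B$ iff $A=f^{-1}(B)$ for some $f\in\mathcal{F}$,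 $<_\mathcal{F}$ its strict part. $\Delta_\mathcal{F}=\{A:A\leq_\mathcal{F}\mathbf{N}_{\langle0\rangle}\}$. $\mathcal{F}$ is Borel if all $\mathbf{N}_s\in\Delta_\mathcal{F}$ and $\Delta_\mathcal{F}\subseteq\mathbf{\Delta}^1_1$. A family $\Lambda$ is bounded in $\Gamma$ if some $A\in\Gamma$ satisfies $B\leq_{\mathsf L}A$ for all $B\in\Lambda$. A $\Delta_\mathcal{F}$-bounded partition is a countable partition of $\mathbb{R}$ into members of $\Delta_\mathcal{F}$ whose set of pieces is bounded in $\Delta_\mathcal{F}$. A function $f$ is $\sigma$-bounded in $\Delta$ if for every countable $\{D_n\}$ bounded in $\Delta$, $\{f^{-1}(D_n)\}$ is bounded in $\Delta$; the $\sigma$-boundness condition for $\mathcal{F}$ says every $f\in\mathcal{F}$ is $\sigma$-bounded in $\Delta_\mathcal{F}$. *)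

theory Defs
  imports Main
begin

text \<open>
  The background theory refutes the axiom of choice, whereas every HOL type satisfies it.  If sets
  of reals were HOL sets, the hypotheses would be contradictory.  So we work inside an arbitrary
  first-order model of ZF, that is, a type \<open>'m\<close> with a binary relation.  The axiom schemas range
  over first-order formulas with parameters only; ranging over all HOL predicates would bring the
  axiom of choice back into the model.  Apart from the syntax of formulas, all quantifiers below
  range over \<open>'m\<close>, so that natural numbers, reals, functions and families are elements of the
  model (whose \<open>\<omega>\<close> may be nonstandard).
\<close>

datatype fm = Mem nat nat | Eq nat nat | Neg fm | Conj fm fm | All nat fm

primrec sat :: "('m \<Rightarrow> 'm \<Rightarrow> bool) \<Rightarrow> (nat \<Rightarrow> 'm) \<Rightarrow> fm \<Rightarrow> bool" where
  "sat E e (Mem i j) = E (e i) (e j)"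
| "sat E e (Eq i j) = (e i = e j)"
| "sat E e (Neg p) = (\<not> sat E e p)"
| "sat E e (Conj p q) = (sat E e p \<and> sat E e q)"
| "sat E e (All i p) = (\<forall>x. sat E (e(i := x)) p)"

locale ZF_model =
  fixes mem :: "'m \<Rightarrow> 'm \<Rightarrow> bool"  (infix "\<epsilon>" 50)
  assumes extensionality: "(\<forall>z. z \<epsilon> a \<longleftrightarrow> z \<epsilon> b) \<Longrightarrow> a = b"
    and foundation: "(\<exists>x. x \<epsilon> a) \<Longrightarrow> \<exists>x. x \<epsilon> a \<and> \<not> (\<exists>y. y \<epsilon> x \<and> y \<epsilon> a)"
    and pairing: "\<exists>c. \<forall>z. z \<epsilon> c \<longleftrightarrow> z = a \<or> z = b"
    and union: "\<exists>u. \<forall>z. z \<epsilon> u \<longleftrightarrow> (\<exists>y. z \<epsilon> y \<and> y \<epsilon> a)"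
    and powerset: "\<exists>p. \<forall>z. z \<epsilon> p \<longleftrightarrow> (\<forall>w. w \<epsilon> z \<longrightarrow> w \<epsilon> a)"
    and infinity: "\<exists>w. (\<exists>z. z \<epsilon> w \<and> (\<forall>y. \<not> y \<epsilon> z)) \<and>
      (\<forall>x. x \<epsilon> w \<longrightarrow> (\<exists>s. s \<epsilon> w \<and> (\<forall>z. z \<epsilon> s \<longleftrightarrow> z \<epsilon> x \<or> z = x)))"
    and separation: "\<And>(\<phi> :: fm) (e :: nat \<Rightarrow> 'm) a.
      \<exists>b. \<forall>x. x \<epsilon> b \<longleftrightarrow> x \<epsilon> a \<and> sat mem (e(0 := x)) \<phi>"
    and replacement: "\<And>(\<phi> :: fm) (e :: nat \<Rightarrow> 'm) a.
      (\<forall>x. x \<epsilon> a \<longrightarrow> (\<exists>!y. sat mem (e(0 := x, 1 := y)) \<phi>)) \<Longrightarrow>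
      \<exists>b. \<forall>y. y \<epsilon> b \<longleftrightarrow> (\<exists>x. x \<epsilon> a \<and> sat mem (e(0 := x, 1 := y)) \<phi>)"
begin

text \<open>\<open>Coll P\<close> is the set \<open>{x | P x}\<close> of the model; it is only used below where ZF proves that
  this class is a set.\<close>

definition Coll :: "('m \<Rightarrow> bool) \<Rightarrow> 'm" where
  "Coll P = (THE a. \<forall>x. x \<epsilon> a \<longleftrightarrow> P x)"

definition subs :: "'m \<Rightarrow> 'm \<Rightarrow> bool"  (infix "\<sqsubseteq>" 50) where
  "a \<sqsubseteq> b \<longleftrightarrow> (\<forall>x. x \<epsilon> a \<longrightarrow> x \<epsilon> b)"

definition pow :: "'m \<Rightarrow> 'm" where
  "pow a = Coll (\<lambda>x. x \<sqsubseteq> a)"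

definition inter :: "'m \<Rightarrow> 'm \<Rightarrow> 'm" where
  "inter a b = Coll (\<lambda>x. x \<epsilon> a \<and> x \<epsilon> b)"

definition upair :: "'m \<Rightarrow> 'm \<Rightarrow> 'm" where
  "upair a b = Coll (\<lambda>x. x = a \<or> x = b)"

definition pair :: "'m \<Rightarrow> 'm \<Rightarrow> 'm" where
  "pair a b = upair (upair a a) (upair a b)"

definition maps :: "'m \<Rightarrow> 'm \<Rightarrow> 'm \<Rightarrow> bool" where
  "maps f a b \<longleftrightarrow>
     (\<forall>p. p \<epsilon> f \<longrightarrow> (\<exists>x y. x \<epsilon> a \<and> y \<epsilon> b \<and> p = pair x y)) \<and>
     (\<forall>x. x \<epsilon> a \<longrightarrow> (\<exists>!y. pair x y \<epsilon> f))"

definition funs :: "'m \<Rightarrow> 'm \<Rightarrow> 'm" where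
  "funs a b = Coll (\<lambda>f. maps f a b)"

definition app :: "'m \<Rightarrow> 'm \<Rightarrow> 'm"  (infixl "\<cdot>" 90) where
  "f \<cdot> x = (THE y. pair x y \<epsilon> f)"

definition zero :: 'm where
  "zero = Coll (\<lambda>x. False)"

definition succ :: "'m \<Rightarrow> 'm" where
  "succ n = Coll (\<lambda>x. x \<epsilon> n \<or> x = n)"

definition two :: 'm where
  "two = succ (succ zero)"

definition omega :: 'm where
  "omega = Coll (\<lambda>n. \<forall>w. zero \<epsilon> w \<and> (\<forall>x. x \<epsilon> w \<longrightarrow> succ x \<epsilon> w) \<longrightarrow> n \<epsilon> w)"

definition baire :: 'm where
  "baire = funs omega omega"

definition fin_seq :: "'m \<Rightarrow> bool" where
  "fin_seq s \<longleftrightarrow> (\<exists>n. n \<epsilon> omega \<and> maps s n omega)"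

definition cone :: "'m \<Rightarrow> 'm" where
  "cone s = Coll (\<lambda>x. x \<epsilon> baire \<and> s \<sqsubseteq> x)"

definition cone0 :: 'm where
  "cone0 = cone (upair (pair zero zero) (pair zero zero))"

definition compl :: "'m \<Rightarrow> 'm" where
  "compl A = Coll (\<lambda>x. x \<epsilon> baire \<and> \<not> x \<epsilon> A)"

definition preimage :: "'m \<Rightarrow> 'm \<Rightarrow> 'm" where
  "preimage f B = Coll (\<lambda>x. x \<epsilon> baire \<and> f \<cdot> x \<epsilon> B)"

definition first_diff :: "'m \<Rightarrow> 'm \<Rightarrow> 'm" where
  "first_diff x y =
     (THE n. n \<epsilon> omega \<and> x \<cdot> n \<noteq> y \<cdot> n \<and> (\<forall>m. m \<epsilon> n \<longrightarrow> x \<cdot> m = y \<cdot> m))"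

text \<open>\<open>dist_le a b x y\<close> expresses \<open>d(a, b) \<le> d(x, y)\<close>, where \<open>d(x, y) = 2\<^sup>-\<^sup>n\<close> with
  \<open>n = first_diff x y\<close> if \<open>x \<noteq> y\<close>, and \<open>d(x, x) = 0\<close>.  Note that \<open>2\<^sup>-\<^sup>n \<le> 2\<^sup>-\<^sup>m\<close> iff \<open>m \<le> n\<close>, and
  that the order of \<open>\<omega>\<close> is inclusion.\<close>

definition dist_le :: "'m \<Rightarrow> 'm \<Rightarrow> 'm \<Rightarrow> 'm \<Rightarrow> bool" where
  "dist_le a b x y \<longleftrightarrow> a = b \<or> (x \<noteq> y \<and> first_diff x y \<sqsubseteq> first_diff a b)"

definition Lip :: 'm where
  "Lip = Coll (\<lambda>f. f \<epsilon> funs baire baire \<and>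
     (\<forall>x y. x \<epsilon> baire \<and> y \<epsilon> baire \<longrightarrow> dist_le (f \<cdot> x) (f \<cdot> y) x y))"

definition reducible :: "'m \<Rightarrow> 'm \<Rightarrow> 'm \<Rightarrow> bool" where
  "reducible F A B \<longleftrightarrow> (\<exists>f. f \<epsilon> F \<and> A = preimage f B)"

definition strictly_reducible :: "'m \<Rightarrow> 'm \<Rightarrow> 'm \<Rightarrow> bool" where
  "strictly_reducible F A B \<longleftrightarrow> reducible F A B \<and> \<not> reducible F B A"

definition DC_reals :: bool where
  "DC_reals \<longleftrightarrow>
     (\<forall>S. (\<forall>x. x \<epsilon> baire \<longrightarrow> (\<exists>y. y \<epsilon> baire \<and> pair x y \<epsilon> S)) \<longrightarrow>
       (\<exists>h. h \<epsilon> funs omega baire \<and> (\<forall>n. n \<epsilon> omega \<longrightarrow> pair (h \<cdot> n) (h \<cdot> succ n) \<epsilon> S)))"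

definition SLO_Lip :: bool where
  "SLO_Lip \<longleftrightarrow>
     (\<forall>A B. A \<sqsubseteq> baire \<and> B \<sqsubseteq> baire \<longrightarrow> reducible Lip A B \<or> reducible Lip (compl B) A)"

definition flip_set :: "'m \<Rightarrow> bool" where
  "flip_set Z \<longleftrightarrow> Z \<sqsubseteq> funs omega two \<and>
     (\<forall>z w. z \<epsilon> funs omega two \<and> w \<epsilon> funs omega two \<and>
        (\<exists>!n. n \<epsilon> omega \<and> z \<cdot> n \<noteq> w \<cdot> n) \<longrightarrow> (z \<epsilon> Z \<longleftrightarrow> \<not> w \<epsilon> Z))"

definition comp :: "'m \<Rightarrow> 'm \<Rightarrow> 'm" where
  "comp f g = Coll (\<lambda>p. \<exists>x. x \<epsilon> baire \<and> p = pair x (f \<cdot> (g \<cdot> x)))"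

definition set_of_reductions :: "'m \<Rightarrow> bool" where
  "set_of_reductions F \<longleftrightarrow> F \<sqsubseteq> funs baire baire \<and>
     (\<forall>f g. f \<epsilon> F \<and> g \<epsilon> F \<longrightarrow> comp f g \<epsilon> F) \<and>
     Lip \<sqsubseteq> F \<and>
     (\<exists>s. s \<epsilon> funs baire F \<and> (\<forall>f. f \<epsilon> F \<longrightarrow> (\<exists>x. x \<epsilon> baire \<and> s \<cdot> x = f)))"

definition Delta :: "'m \<Rightarrow> 'm" where
  "Delta F = Coll (\<lambda>A. A \<sqsubseteq> baire \<and> reducible F A cone0)"

definition closed_rel :: "'m \<Rightarrow> bool" where
  "closed_rel C \<longleftrightarrow>
     (\<forall>p. p \<epsilon> C \<longrightarrow> (\<exists>x y. x \<epsilon> baire \<and> y \<epsilon> baire \<and> p = pair x y)) \<and>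
     (\<forall>x y. x \<epsilon> baire \<and> y \<epsilon> baire \<and> \<not> pair x y \<epsilon> C \<longrightarrow>
       (\<exists>s t. fin_seq s \<and> fin_seq t \<and> x \<epsilon> cone s \<and> y \<epsilon> cone t \<and>
         (\<forall>x' y'. x' \<epsilon> cone s \<and> y' \<epsilon> cone t \<longrightarrow> \<not> pair x' y' \<epsilon> C)))"

definition Sigma11 :: "'m \<Rightarrow> bool" where
  "Sigma11 A \<longleftrightarrow> A \<sqsubseteq> baire \<and> (\<exists>C. closed_rel C \<and> A = Coll (\<lambda>x. \<exists>y. pair x y \<epsilon> C))"

definition Delta11 :: "'m \<Rightarrow> bool" where
  "Delta11 A \<longleftrightarrow> Sigma11 A \<and> Sigma11 (compl A)"

definition Borel_reductions :: "'m \<Rightarrow> bool" where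
  "Borel_reductions F \<longleftrightarrow>
     (\<forall>s. fin_seq s \<longrightarrow> cone s \<epsilon> Delta F) \<and> (\<forall>A. A \<epsilon> Delta F \<longrightarrow> Delta11 A)"

definition bounded_in :: "'m \<Rightarrow> 'm \<Rightarrow> bool" where
  "bounded_in \<Lambda> \<Gamma> \<longleftrightarrow> (\<exists>A. A \<epsilon> \<Gamma> \<and> (\<forall>B. B \<epsilon> \<Lambda> \<longrightarrow> reducible Lip B A))"

definition range :: "'m \<Rightarrow> 'm" where
  "range D = Coll (\<lambda>A. \<exists>n. n \<epsilon> omega \<and> A = D \<cdot> n)"

text \<open>Pieces may be empty, so finite partitions are included.\<close>

definition bounded_partition :: "'m \<Rightarrow> 'm \<Rightarrow> bool" where
  "bounded_partition \<Delta> D \<longleftrightarrow> D \<epsilon> funs omega \<Delta> \<and>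
     (\<forall>n m. n \<epsilon> omega \<and> m \<epsilon> omega \<and> n \<noteq> m \<longrightarrow> inter (D \<cdot> n) (D \<cdot> m) = zero) \<and>
     (\<forall>x. x \<epsilon> baire \<longleftrightarrow> (\<exists>n. n \<epsilon> omega \<and> x \<epsilon> D \<cdot> n)) \<and>
     bounded_in (range D) \<Delta>"

definition sigma_bounded :: "'m \<Rightarrow> 'm \<Rightarrow> bool" where
  "sigma_bounded f \<Delta> \<longleftrightarrow>
     (\<forall>D. D \<epsilon> funs omega (pow baire) \<and> bounded_in (range D) \<Delta> \<longrightarrow>
       bounded_in (Coll (\<lambda>B. \<exists>n. n \<epsilon> omega \<and> B = preimage f (D \<cdot> n))) \<Delta>)"

definition sigma_boundedness_condition :: "'m \<Rightarrow> bool" where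
  "sigma_boundedness_condition F \<longleftrightarrow> (\<forall>f. f \<epsilon> F \<longrightarrow> sigma_bounded f (Delta F))"

definition strong_decomposition_property :: "'m \<Rightarrow> bool" where
  "strong_decomposition_property F \<longleftrightarrow>
     (\<forall>A. A \<sqsubseteq> baire \<and> reducible F A (compl A) \<and> \<not> A \<epsilon> Delta F \<longrightarrow>
       (\<exists>D. bounded_partition (Delta F) D \<and>
         (\<forall>n. n \<epsilon> omega \<longrightarrow> strictly_reducible F (inter A (D \<cdot> n)) A)))"

end

end

theory Submission
  imports Defs
begin

text \<open>
  Suppose \<open>A \<le>\<^sub>F \<not>A\<close>, \<open>A \<notin> \<Delta>\<^sub>F\<close> and that no
  \<open>\<Delta>\<^sub>F\<close>-bounded partition decomposes \<open>A\<close>. Call \<open>Y\<close> large if \<open>A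
  \<le>\<^sub>F Y\<close>. By SLO and the \<open>\<sigma>\<close>-boundedness condition, every
  \<open>\<Delta>\<^sub>F\<close>-bounded partition cuts a large set into pieces at least one of which is large. A set
  \<open>B\<close> is resolved by a map \<open>q\<close> all of whose digits are bounded partitions if refining the topology
  by \<open>q\<close> makes \<open>B\<close> clopen in a uniform way. Every set in \<open>\<Delta>\<^sub>F\<close> is
  resolved: otherwise the resolvable sets would be closed under countable unions, hence contain all Borel sets by Luzin
  separation, hence all of \<open>\<Delta>\<^sub>F\<close>. By a similar argument, \<open>A\<close> is outside the algebra
  generated by \<open>\<Delta>\<^sub>F\<close>. An equivalence relation with classes in this algebra is good if large sets
  pulled back along any reduction have a large part in a single class, as they do for bounded partitions. Good relations are
  closed under intersections and pullbacks, so the Martin--Monk construction can be run along them: at each stage the part of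
  \<open>A\<close> in the current class is large, which gives reductions preserving and flipping \<open>A\<close> that take
  values in the class up to a retraction, and resolving these reductions makes the limits converge. The outcome is a flip
  set.

  The argument takes place inside the model, so each set and function it forms has to come from a formula.
\<close>

section \<open>Definable classes\<close>

text \<open>The obstacle is that \<open>L\<close>, the family of sets reducible to
  \<open>cone0\<close>, is closed under preimages and complements but not visibly under
  intersections, as reductions can be composed but not paired. Common refinements of bounded
  partitions may therefore be unbounded, yet the Martin-Monk construction refines at every stage.
  Good equivalence relations avoid this: their condition speaks of largeness instead of bounds and
  survives refinement, and their classes may lie in the generated algebra. The price is that
  \<open>A\<close> must be kept out of that algebra: a class contained in \<open>A\<close> would
  leave no value outside \<open>A\<close> for the retraction onto the class. A second obstacle is
  that reductions are discontinuous. Along the approximations of a limit, the images under a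
  resolving map also converge, but not necessarily to the image of the limit; hence a resolution has
  to work for every pair of limits. Finally, dependent choice is available on the reals only. Every
  chosen object is thus taken from an image of the reals, while the relations, which have no evident
  real codes, are computed from the choices.\<close>

definition scons :: "'a \<Rightarrow> (nat \<Rightarrow> 'a) \<Rightarrow> nat \<Rightarrow> 'a" where
  "scons x e i = (case i of 0 \<Rightarrow> x | Suc j \<Rightarrow> e j)"

lemma scons_simps [simp]: "scons x e 0 = x" "scons x e (Suc i) = e i"
  by (simp_all add: scons_def)

text \<open>Even slots hold the variables and odd slots the parameters, so that a single environment
  of \<open>sat\<close> carries both and there is always room for more parameters.\<close>

definition mrg :: "(nat \<Rightarrow> 'a) \<Rightarrow> (nat \<Rightarrow> 'a) \<Rightarrow> nat \<Rightarrow> 'a" where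
  "mrg e p i = (if even i then e (i div 2) else p (i div 2))"

primrec ren :: "(nat \<Rightarrow> nat) \<Rightarrow> fm \<Rightarrow> fm" where
  "ren f (Mem i j) = Mem (f i) (f j)"
| "ren f (Eq i j) = Eq (f i) (f j)"
| "ren f (Neg p) = Neg (ren f p)"
| "ren f (Conj p q) = Conj (ren f p) (ren f q)"
| "ren f (All i p) = All (f i) (ren f p)"

text \<open>Bound variables are renamed as well, so injectivity takes the place of the usual
  conditions against capture: a renamed quantifier cannot overwrite the image of another
  variable.\<close>

lemma sat_ren: "inj f \<Longrightarrow> sat E e (ren f p) = sat E (e \<circ> f) p"
proof (induction p arbitrary: e)
  case (All i p)
  have "(e(f i := x)) \<circ> f = (e \<circ> f)(i := x)" for x
    using All.prems by (auto simp: fun_eq_iff inj_eq)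
  then show ?case using All by (simp del: o_apply)
qed (simp_all add: o_def)

named_theorems dfi

context ZF_model
begin

definition atom :: "((nat \<Rightarrow> 'm) \<Rightarrow> 'm) \<Rightarrow> bool" where
  "atom t \<longleftrightarrow> (\<exists>i. t = (\<lambda>e. e i)) \<or> (\<exists>c. t = (\<lambda>e. c))"

text \<open>Definability with parameters, the environment supplying the free variables.  Goals \<open>df P\<close> are solved by
  \<open>intro dfi\<close>, so a new notion becomes usable in Separation and Replacement once its own rule is in \<open>dfi\<close>.\<close>

inductive df :: "((nat \<Rightarrow> 'm) \<Rightarrow> bool) \<Rightarrow> bool" where
  df_mem_atom: "atom s \<Longrightarrow> atom t \<Longrightarrow> df (\<lambda>e. s e \<epsilon> t e)"
| df_eq_atom: "atom s \<Longrightarrow> atom t \<Longrightarrow> df (\<lambda>e. s e = t e)"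
| df_neg: "df Q \<Longrightarrow> df (\<lambda>e. \<not> Q e)"
| df_conj: "df Q \<Longrightarrow> df R \<Longrightarrow> df (\<lambda>e. Q e \<and> R e)"
| df_all_scons: "df Q \<Longrightarrow> df (\<lambda>e. \<forall>x. Q (scons x e))"

lemma df_subst:
  assumes "df Q" "\<And>i. atom (g i)"
  shows "df (\<lambda>e. Q (\<lambda>i. g i e))"
  using assms
proof (induction arbitrary: g)
  case (df_mem_atom s t)
  have *: "atom r \<Longrightarrow> atom (\<lambda>e. r (\<lambda>i. g i e))" for r
    using df_mem_atom(3) unfolding atom_def by auto
  show ?case using df.df_mem_atom[OF *[OF df_mem_atom(1)] *[OF df_mem_atom(2)]] .
next
  case (df_eq_atom s t)
  have *: "atom r \<Longrightarrow> atom (\<lambda>e. r (\<lambda>i. g i e))" for r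
    using df_eq_atom(3) unfolding atom_def by auto
  show ?case using df.df_eq_atom[OF *[OF df_eq_atom(1)] *[OF df_eq_atom(2)]] .
next
  case (df_neg Q)
  then show ?case using df.df_neg by blast
next
  case (df_conj Q R)
  show ?case using df.df_conj[OF df_conj.IH(1) df_conj.IH(2)] df_conj.prems by blast
next
  case (df_all_scons Q)
  define h where "h i = (case i of 0 \<Rightarrow> (\<lambda>e. e 0) | Suc j \<Rightarrow> (\<lambda>e. g j (\<lambda>i. e (Suc i))))" for i
  have "atom (h i)" for i
  proof (cases i)
    case 0 then show ?thesis by (auto simp: h_def atom_def)
  next
    case (Suc j) then show ?thesis using df_all_scons.prems[of j]
      by (auto simp: h_def atom_def)
  qed
  from df_all_scons.IH[OF this] have "df (\<lambda>e. Q (\<lambda>i. h i e))" .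
  from df.df_all_scons[OF this] have "df (\<lambda>e. \<forall>x. Q (\<lambda>i. h i (scons x e)))" .
  moreover have "(\<lambda>i. h i (scons x e)) = scons x (\<lambda>i. g i e)" for x e
    by (auto simp: h_def fun_eq_iff scons_def split: nat.split)
  ultimately show ?case by simp
qed

lemma df_shift:
  assumes "df (\<lambda>e. Q (e 0) (\<lambda>i. e (Suc i)))"
  shows "df (\<lambda>e. \<forall>x. Q x e)"
  using df_all_scons[OF assms] by simp

text \<open>A set term nested inside another depends on an environment, whereas Separation is
  applied to a predicate of one variable. Freezing the outer variables as parameters mediates
  between the two.\<close>

lemma df_const_env:
  assumes "df (\<lambda>e. Q (e 0) (\<lambda>i. e (Suc i)))"
  shows "df (\<lambda>e'. Q (e' 0) e)"
proof -
  have "df (\<lambda>e'. (\<lambda>e. Q (e 0) (\<lambda>i. e (Suc i)))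
      (\<lambda>i. (case i of 0 \<Rightarrow> (\<lambda>e. e 0) | Suc j \<Rightarrow> (\<lambda>_. e j)) e'))"
    by (rule df_subst[OF assms]) (auto simp: atom_def split: nat.split)
  then show ?thesis by simp
qed

lemma df_const_env2:
  assumes "df (\<lambda>e. Q (e 0) (e (Suc 0)) (\<lambda>i. e (Suc (Suc i))))"
  shows "df (\<lambda>e'. Q (e' 0) (e' (Suc 0)) e)"
proof -
  have "df (\<lambda>e'. (\<lambda>e. Q (e 0) (e (Suc 0)) (\<lambda>i. e (Suc (Suc i))))
      (\<lambda>i. (case i of 0 \<Rightarrow> (\<lambda>e. e 0) | Suc j \<Rightarrow> (case j of 0 \<Rightarrow> (\<lambda>e. e (Suc 0)) | Suc k \<Rightarrow> (\<lambda>_. e k))) e'))"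
    by (rule df_subst[OF assms]) (auto simp: atom_def split: nat.split)
  then show ?thesis by simp
qed

text \<open>The premise has the shape that higher-order unification produces when
  \<open>intro dfi\<close> crosses a quantifier: the bound variable becomes index 0 and all outer
  indices move up by one.\<close>

lemma df_all [dfi]: "df (\<lambda>e. Q (e 0) (\<lambda>i. e (Suc i))) \<Longrightarrow> df (\<lambda>e. \<forall>x. Q x e)"
  by (rule df_shift)

lemma df_not [dfi]: "df Q \<Longrightarrow> df (\<lambda>e. \<not> Q e)" by (rule df_neg)
lemma df_and [dfi]: "df Q \<Longrightarrow> df R \<Longrightarrow> df (\<lambda>e. Q e \<and> R e)" by (rule df_conj)

lemma df_or [dfi]: "df Q \<Longrightarrow> df R \<Longrightarrow> df (\<lambda>e. Q e \<or> R e)"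
  using df_neg[OF df_conj[OF df_neg df_neg]] by simp

lemma df_imp [dfi]: "df Q \<Longrightarrow> df R \<Longrightarrow> df (\<lambda>e. Q e \<longrightarrow> R e)"
  using df_neg[OF df_conj[OF _ df_neg]] by simp

lemma df_iff [dfi]: "df Q \<Longrightarrow> df R \<Longrightarrow> df (\<lambda>e. Q e = R e)"
proof -
  assume "df Q" "df R"
  from df_conj[OF df_imp[OF this] df_imp[OF this(2) this(1)]]
  have "df (\<lambda>e. (Q e \<longrightarrow> R e) \<and> (R e \<longrightarrow> Q e))" .
  moreover have "(\<lambda>e. (Q e \<longrightarrow> R e) \<and> (R e \<longrightarrow> Q e)) = (\<lambda>e. Q e = R e)" by auto
  ultimately show ?thesis by simp
qed

lemma df_ex [dfi]: "df (\<lambda>e. Q (e 0) (\<lambda>i. e (Suc i))) \<Longrightarrow> df (\<lambda>e. \<exists>x. Q x e)"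
  using df_neg[OF df_all[of "\<lambda>x e. \<not> Q x e"]] df_neg by simp

lemma df_True [dfi]: "df (\<lambda>e. True)"
  using df_eq_atom[of "\<lambda>e. e 0" "\<lambda>e. e 0"] by (auto simp: atom_def)
lemma df_False [dfi]: "df (\<lambda>e. False)"
  using df_neg[OF df_True] by simp
lemma df_const [dfi]: "df (\<lambda>e. c)"
  using df_True df_False by (cases c) simp_all

text \<open>\<open>dt t\<close>: the term \<open>t\<close> has a definable graph.\<close>

definition dt :: "((nat \<Rightarrow> 'm) \<Rightarrow> 'm) \<Rightarrow> bool" where
  "dt t \<longleftrightarrow> df (\<lambda>e. e 0 = t (\<lambda>i. e (Suc i)))"

lemma dt_var [dfi]: "dt (\<lambda>e. e i)"
  unfolding dt_def by (rule df_eq_atom) (auto simp: atom_def)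
lemma dt_const [dfi]: "dt (\<lambda>e. c)"
  unfolding dt_def by (rule df_eq_atom) (auto simp: atom_def)

text \<open>Formulas contain no terms, so a definable term is eliminated through its graph: some
  \<open>x\<close> equals \<open>t e\<close> and satisfies \<open>Q x e\<close>.\<close>

lemma df_sub: "dt t \<Longrightarrow> df (\<lambda>e. Q (e 0) (\<lambda>i. e (Suc i))) \<Longrightarrow> df (\<lambda>e. Q (t e) e)"
proof -
  assume "dt t" and Q: "df (\<lambda>e. Q (e 0) (\<lambda>i. e (Suc i)))"
  then have "df (\<lambda>e. e 0 = t (\<lambda>i. e (Suc i)) \<and> Q (e 0) (\<lambda>i. e (Suc i)))"
    unfolding dt_def by (rule df_conj)
  from df_ex[of "\<lambda>x e. x = t e \<and> Q x e", OF this] show ?thesis by simp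
qed

lemma df_ren: "df Q \<Longrightarrow> df (\<lambda>e. Q (\<lambda>i. e (f i)))"
  by (rule df_subst) (auto simp: atom_def)

lemma dt_ren: "dt t \<Longrightarrow> dt (\<lambda>e. t (\<lambda>i. e (f i)))"
proof -
  assume "dt t"
  then have "df (\<lambda>e. e 0 = t (\<lambda>i. e (Suc i)))" unfolding dt_def .
  from df_ren[OF this, of "\<lambda>i. case i of 0 \<Rightarrow> 0 | Suc j \<Rightarrow> Suc (f j)"]
  show ?thesis unfolding dt_def by simp
qed

lemma df1: "df (\<lambda>e. P (e 0)) \<Longrightarrow> dt s \<Longrightarrow> df (\<lambda>e. P (s e))"
  by (rule df_sub[of s "\<lambda>x e. P x"])

text \<open>\<open>df_sub\<close> replaces only the variable of index 0, so the arguments are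
  permuted into that place and replaced one at a time, the last one first.\<close>

lemma df2: "df (\<lambda>e. P (e 0) (e (Suc 0))) \<Longrightarrow> dt s \<Longrightarrow> dt t \<Longrightarrow> df (\<lambda>e. P (s e) (t e))"
proof -
  assume P: "df (\<lambda>e. P (e 0) (e (Suc 0)))" and s: "dt s" and t: "dt t"
  have "df (\<lambda>e. P (e (Suc 0)) (e 0))"
    using df_ren[OF P, of "\<lambda>i. if i = 0 then Suc 0 else 0"] by simp
  from df_sub[of "\<lambda>e. t (\<lambda>i. e (Suc i))" "\<lambda>x e. P (e 0) x", OF dt_ren[OF t]] this
  have "df (\<lambda>e. P (e 0) (t (\<lambda>i. e (Suc i))))" by simp
  from df_sub[of s "\<lambda>x e. P x (t e)", OF s this] show ?thesis .
qed

lemma df3: "df (\<lambda>e. P (e 0) (e (Suc 0)) (e (Suc (Suc 0)))) \<Longrightarrow> dt s \<Longrightarrow> dt t \<Longrightarrow> dt u \<Longrightarrow>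
  df (\<lambda>e. P (s e) (t e) (u e))"
proof -
  assume P: "df (\<lambda>e. P (e 0) (e (Suc 0)) (e (Suc (Suc 0))))" and s: "dt s" and t: "dt t" and u: "dt u"
  have "df (\<lambda>e. P (e (Suc 0)) (e (Suc (Suc 0))) (e 0))"
    using df_ren[OF P, of "\<lambda>i. if i = 0 then Suc 0 else if i = Suc 0 then Suc (Suc 0) else 0"] by simp
  from df_sub[of "\<lambda>e. u (\<lambda>i. e (Suc (Suc i)))" "\<lambda>x e. P (e 0) (e (Suc 0)) x", OF dt_ren[OF u]] this
  have "df (\<lambda>e. P (e 0) (e (Suc 0)) (u (\<lambda>i. e (Suc (Suc i)))))" by simp
  from df_ren[OF this, of "\<lambda>i. case i of 0 \<Rightarrow> Suc 0 | Suc j \<Rightarrow> (case j of 0 \<Rightarrow> 0 | Suc k \<Rightarrow> Suc (Suc k))"]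
  have "df (\<lambda>e. P (e (Suc 0)) (e 0) (u (\<lambda>i. e (Suc (Suc i)))))" by simp
  from df_sub[of "\<lambda>e. t (\<lambda>i. e (Suc i))" "\<lambda>x e. P (e 0) x (u (\<lambda>i. e (Suc i)))", OF dt_ren[OF t]] this
  have "df (\<lambda>e. P (e 0) (t (\<lambda>i. e (Suc i))) (u (\<lambda>i. e (Suc i))))" by simp
  from df_sub[of s "\<lambda>x e. P x (t e) (u e)", OF s this] show ?thesis .
qed

lemma df_mem [dfi]: "dt s \<Longrightarrow> dt t \<Longrightarrow> df (\<lambda>e. s e \<epsilon> t e)"
  by (rule df2[of "\<lambda>x y. x \<epsilon> y"], rule df_mem_atom) (auto simp: atom_def)
lemma df_eq [dfi]: "dt s \<Longrightarrow> dt t \<Longrightarrow> df (\<lambda>e. s e = t e)"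
  by (rule df2[of "\<lambda>x y. x = y"], rule df_eq_atom) (auto simp: atom_def)

lemma df_ex1 [dfi]: "df (\<lambda>e. Q (e 0) (\<lambda>i. e (Suc i))) \<Longrightarrow> df (\<lambda>e. \<exists>!x. Q x e)"
proof -
  assume Q: "df (\<lambda>e. Q (e 0) (\<lambda>i. e (Suc i)))"
  from df_ren[OF this, of "\<lambda>i. case i of 0 \<Rightarrow> 0 | Suc j \<Rightarrow> Suc (Suc j)"]
  have Q2: "df (\<lambda>e. Q (e 0) (\<lambda>i. e (Suc (Suc i))))" by simp
  have "df (\<lambda>e. \<exists>x. Q x e \<and> (\<forall>y. Q y e \<longrightarrow> y = x))"
    by (rule df_ex df_conj Q df_all df_imp Q2 df_eq dt_var)+
  then show ?thesis unfolding Ex1_def .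
qed

lemma dt1: "dt (\<lambda>e. c (e 0)) \<Longrightarrow> dt s \<Longrightarrow> dt (\<lambda>e. c (s e))"
  unfolding dt_def
  using df2[of "\<lambda>x y. x = c y" "\<lambda>e. e 0" "\<lambda>e. s (\<lambda>i. e (Suc i))"] dt_var dt_ren[of s Suc]
  by (simp add: dt_def)

lemma dt2: "dt (\<lambda>e. c (e 0) (e (Suc 0))) \<Longrightarrow> dt s \<Longrightarrow> dt t \<Longrightarrow> dt (\<lambda>e. c (s e) (t e))"
  unfolding dt_def
  using df3[of "\<lambda>x y z. x = c y z" "\<lambda>e. e 0" "\<lambda>e. s (\<lambda>i. e (Suc i))" "\<lambda>e. t (\<lambda>i. e (Suc i))"]
    dt_var dt_ren[of s Suc] dt_ren[of t Suc]
  by (simp add: dt_def)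

lemma dtI: "df (\<lambda>e. e 0 = t (\<lambda>i. e (Suc i))) \<Longrightarrow> dt t" by (simp add: dt_def)

lemma dt_if [dfi]: "df b \<Longrightarrow> dt s \<Longrightarrow> dt t \<Longrightarrow> dt (\<lambda>e. if b e then s e else t e)"
proof (rule dtI)
  assume b: "df b" and s: "dt s" and t: "dt t"
  have "df (\<lambda>e. (b (\<lambda>i. e (Suc i)) \<longrightarrow> e 0 = s (\<lambda>i. e (Suc i))) \<and>
      (\<not> b (\<lambda>i. e (Suc i)) \<longrightarrow> e 0 = t (\<lambda>i. e (Suc i))))"
    using s t unfolding dt_def by (intro df_and df_imp df_not df_ren[OF b]) auto
  moreover have "(\<lambda>e. (b (\<lambda>i. e (Suc i)) \<longrightarrow> e 0 = s (\<lambda>i. e (Suc i))) \<and>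
      (\<not> b (\<lambda>i. e (Suc i)) \<longrightarrow> e 0 = t (\<lambda>i. e (Suc i)))) =
    (\<lambda>e. e 0 = (if b (\<lambda>i. e (Suc i)) then s (\<lambda>i. e (Suc i)) else t (\<lambda>i. e (Suc i))))"
    by auto
  ultimately show "df (\<lambda>e. e 0 = (if b (\<lambda>i. e (Suc i)) then s (\<lambda>i. e (Suc i)) else t (\<lambda>i. e (Suc i))))"
    by simp
qed

text \<open>The bridge from closure rules to the axiom schemas. Each subformula comes with its own
  parameters, and the work lies in moving them to disjoint odd slots.\<close>

lemma df_sat: "df Q \<Longrightarrow> \<exists>\<phi> p. \<forall>e. Q e = sat mem (mrg e p) \<phi>"
proof (induction rule: df.induct)
  case (df_mem_atom s t)
  define i where "i = (if \<exists>k. s = (\<lambda>e. e k) then 2 * (SOME k. s = (\<lambda>e. e k)) else 1)"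
  define j where "j = (if \<exists>k. t = (\<lambda>e. e k) then 2 * (SOME k. t = (\<lambda>e. e k)) else 3)"
  define p where "p k = (if k = (0::nat) then s (\<lambda>_. undefined) else t (\<lambda>_. undefined))" for k
  have "s e = mrg e p i" for e
  proof (cases "\<exists>k. s = (\<lambda>e. e k)")
    case True from someI_ex[OF this] show ?thesis using True by (simp add: i_def mrg_def) metis
  next
    case False then show ?thesis using df_mem_atom(1) by (auto simp: atom_def i_def mrg_def p_def)
  qed
  moreover have "t e = mrg e p j" for e
  proof (cases "\<exists>k. t = (\<lambda>e. e k)")
    case True from someI_ex[OF this] show ?thesis using True by (simp add: j_def mrg_def) metis
  next
    case False then show ?thesis using df_mem_atom(2) by (auto simp: atom_def j_def mrg_def p_def)
  qed
  ultimately show ?case by (intro exI[of _ "Mem i j"] exI[of _ p]) simp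
next
  case (df_eq_atom s t)
  define i where "i = (if \<exists>k. s = (\<lambda>e. e k) then 2 * (SOME k. s = (\<lambda>e. e k)) else 1)"
  define j where "j = (if \<exists>k. t = (\<lambda>e. e k) then 2 * (SOME k. t = (\<lambda>e. e k)) else 3)"
  define p where "p k = (if k = (0::nat) then s (\<lambda>_. undefined) else t (\<lambda>_. undefined))" for k
  have "s e = mrg e p i" for e
  proof (cases "\<exists>k. s = (\<lambda>e. e k)")
    case True from someI_ex[OF this] show ?thesis using True by (simp add: i_def mrg_def) metis
  next
    case False then show ?thesis using df_eq_atom(1) by (auto simp: atom_def i_def mrg_def p_def)
  qed
  moreover have "t e = mrg e p j" for e
  proof (cases "\<exists>k. t = (\<lambda>e. e k)")
    case True from someI_ex[OF this] show ?thesis using True by (simp add: j_def mrg_def) metis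
  next
    case False then show ?thesis using df_eq_atom(2) by (auto simp: atom_def j_def mrg_def p_def)
  qed
  ultimately show ?case by (intro exI[of _ "Eq i j"] exI[of _ p]) simp
next
  case (df_neg Q)
  then obtain \<phi> p where "\<forall>e. Q e = sat mem (mrg e p) \<phi>" by blast
  then show ?case by (intro exI[of _ "Neg \<phi>"] exI[of _ p]) simp
next
  case (df_conj Q R)
  then obtain \<phi> p \<psi> q where 1: "\<forall>e. Q e = sat mem (mrg e p) \<phi>" "\<forall>e. R e = sat mem (mrg e q) \<psi>" by blast
  \<comment> \<open>The two parameter sequences are interleaved: number \<open>k\<close> of
    \<open>p\<close> moves from slot \<open>2 * k + 1\<close> to \<open>4 * k + 1\<close>, number
    \<open>k\<close> of \<open>q\<close> to \<open>4 * k + 3\<close>.\<close>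
  define r where "r i = (if even i then p (i div 2) else q (i div 2))" for i
  define f where "f i = (if even i then i else 2 * i - 1)" for i :: nat
  define g where "g i = (if even i then i else 2 * i + 1)" for i :: nat
  have "inj f" by (rule injI) (simp add: f_def split: if_splits, presburger+)
  moreover have "inj g" by (rule injI) (simp add: g_def split: if_splits, presburger+)
  moreover have "mrg e r \<circ> f = mrg e p" for e
  proof
    fix i show "(mrg e r \<circ> f) i = mrg e p i"
    proof (cases "even i")
      case False
      then obtain k where "i = 2 * k + 1" by (auto elim: oddE)
      then show ?thesis by (simp add: mrg_def r_def f_def)
    qed (simp add: mrg_def f_def)
  qed
  moreover have "mrg e r \<circ> g = mrg e q" for e
  proof
    fix i show "(mrg e r \<circ> g) i = mrg e q i"
    proof (cases "even i")
      case False
      then obtain k where "i = 2 * k + 1" by (auto elim: oddE)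
      then show ?thesis by (simp add: mrg_def r_def g_def)
    qed (simp add: mrg_def g_def)
  qed
  ultimately show ?case
    by (intro exI[of _ "Conj (ren f \<phi>) (ren g \<psi>)"] exI[of _ r]) (simp add: sat_ren 1)
next
  case (df_all_scons Q)
  then obtain \<phi> p where 1: "\<forall>e. Q e = sat mem (mrg e p) \<phi>" by blast
  define q where "q = scons undefined p"
  \<comment> \<open>The bound variable sits in slot 0 of \<open>scons x e\<close>. It moves to slot
    1, which \<open>q\<close> frees by delaying the parameters by one; the other variables move down
    to the even slots that they have in \<open>e\<close>.\<close>
  define f where "f i = (if i = 0 then 1 else if even i then i - 2 else i + 2)" for i :: nat
  have "inj f" by (rule injI) (simp add: f_def split: if_splits, presburger+)
  moreover have "(mrg e q)(1 := x) \<circ> f = mrg (scons x e) p" for e x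
  proof
    fix i :: nat
    have "i = 0 \<or> (\<exists>k. i = 2 * k + 2) \<or> (\<exists>k. i = 2 * k + 1)" by presburger
    then consider "i = 0" | k where "i = 2 * k + 2" | k where "i = 2 * k + 1" by blast
    then show "((mrg e q)(1 := x) \<circ> f) i = mrg (scons x e) p i"
      by cases (auto simp: mrg_def f_def q_def scons_def)
  qed
  ultimately show ?case
    by (intro exI[of _ "All 1 (ren f \<phi>)"] exI[of _ q]) (simp add: sat_ren 1)
qed

lemma sep_ex:
  assumes "df (\<lambda>e. P (e 0))"
  shows "\<exists>b. \<forall>x. x \<epsilon> b \<longleftrightarrow> x \<epsilon> a \<and> P x"
proof -
  obtain \<phi> p where 1: "\<forall>e. P (e 0) = sat mem (mrg e p) \<phi>" using df_sat[OF assms] by blast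
  have 2: "(mrg e p)(0 := x) = mrg (e(0 := x)) p" for e :: "nat \<Rightarrow> 'm" and x
  proof
    fix i :: nat
    have "even i \<Longrightarrow> i \<noteq> 0 \<Longrightarrow> i div 2 \<noteq> 0" by presburger
    then show "((mrg e p)(0 := x)) i = mrg (e(0 := x)) p i"
      by (cases "i = 0"; cases "even i") (auto simp: mrg_def)
  qed
  have "sat mem ((mrg (\<lambda>_. undefined) p)(0 := x)) \<phi> = P x" for x
    unfolding 2 by (simp add: 1[rule_format, symmetric])
  then show ?thesis
    using separation[where \<phi> = \<phi> and e = "mrg (\<lambda>_. undefined) p" and a = a] by simp
qed

lemma repl_ex:
  assumes "df (\<lambda>e. P (e 0) (e (Suc 0)))" and "\<And>x. x \<epsilon> a \<Longrightarrow> \<exists>!y. P x y"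
  shows "\<exists>b. \<forall>y. y \<epsilon> b \<longleftrightarrow> (\<exists>x. x \<epsilon> a \<and> P x y)"
proof -
  obtain \<phi> p where 1: "\<forall>e. P (e 0) (e (Suc 0)) = sat mem (mrg e p) \<phi>" using df_sat[OF assms(1)] by blast
  \<comment> \<open>Replacement expects the value in slot 1, which \<open>mrg\<close> reserves for a
    parameter, while the second variable of \<open>P\<close> is in slot 2; so the two slots are
    swapped.\<close>
  define f where "f i = (if i = 1 then 2 else if i = 2 then 1 else i)" for i :: nat
  define e0 where "e0 = mrg (\<lambda>_. undefined) p \<circ> f"
  have "f (f i) = i" for i by (simp add: f_def)
  then have inj: "inj f" by (metis injI)
  have e0f: "(e0(0 := x, 1 := y)) \<circ> f = mrg (scons x (scons y (\<lambda>_. undefined))) p" for x y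
  proof
    fix i :: nat
    have "even i \<Longrightarrow> i > 2 \<Longrightarrow> i = 2 * Suc (Suc (i div 2 - 2))" by (elim evenE) simp
    then consider "i = 0" | "i = 1" | "i = 2" | "i > 2" "odd i" | k where "i = 2 * Suc (Suc k)"
      by (cases "i > 2"; cases "even i") (blast, blast, linarith, linarith)
    then show "(e0(0 := x, 1 := y) \<circ> f) i = mrg (scons x (scons y (\<lambda>_. undefined))) p i"
    proof cases
      case 3 then show ?thesis by (simp add: f_def mrg_def scons_def)
    next
      case 4 then show ?thesis by (simp add: e0_def f_def mrg_def)
    next
      case 5
      then have "f i = i" "i \<noteq> 0" "i \<noteq> 1" by (simp_all add: f_def)
      then show ?thesis using 5 by (simp add: e0_def mrg_def)
    qed (simp_all add: e0_def f_def mrg_def)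
  qed
  have sat_e0: "sat mem (e0(0 := x, 1 := y)) (ren f \<phi>) \<longleftrightarrow> P x y" for x y
    unfolding sat_ren[OF inj] e0f 1[rule_format, symmetric] by (simp only: scons_simps)
  have "\<forall>x. x \<epsilon> a \<longrightarrow> (\<exists>!y. sat mem (e0(0 := x, 1 := y)) (ren f \<phi>))"
    unfolding sat_e0 using assms(2) by blast
  from replacement[OF this] show ?thesis unfolding sat_e0 .
qed

section \<open>Set theory in the model\<close>

lemma mem_Coll: "\<exists>a. \<forall>x. x \<epsilon> a \<longleftrightarrow> P x \<Longrightarrow> z \<epsilon> Coll P \<longleftrightarrow> P z"
proof -
  assume "\<exists>a. \<forall>x. x \<epsilon> a \<longleftrightarrow> P x"
  then obtain a where a: "\<forall>x. x \<epsilon> a \<longleftrightarrow> P x" ..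
  have "\<forall>x. x \<epsilon> Coll P \<longleftrightarrow> P x" unfolding Coll_def
    by (rule theI[of _ a]) (use a extensionality in auto)
  then show ?thesis ..
qed

lemma set_ext: "(\<And>z. z \<epsilon> a \<longleftrightarrow> z \<epsilon> b) \<Longrightarrow> a = b" using extensionality by blast

text \<open>By extensionality, being the collected set means having the right elements, which is a
  formula. Existence is required for every environment, because otherwise \<open>Coll\<close>
  denotes nothing definite.\<close>

lemma dt_Coll:
  assumes "\<And>e. \<exists>a. \<forall>x. x \<epsilon> a \<longleftrightarrow> P x e" and P: "df (\<lambda>e. P (e 0) (\<lambda>i. e (Suc i)))"
  shows "dt (\<lambda>e. Coll (\<lambda>x. P x e))"
proof (rule dtI)
  have *: "z = Coll (\<lambda>x. P x e) \<longleftrightarrow> (\<forall>x. x \<epsilon> z \<longleftrightarrow> P x e)" for z e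
    using mem_Coll[OF assms(1)] extensionality by blast
  have "df (\<lambda>e. P (e 0) (\<lambda>i. e (Suc (Suc i))))"
    using df_ren[OF P, of "\<lambda>i. case i of 0 \<Rightarrow> 0 | Suc j \<Rightarrow> Suc (Suc j)"] by simp
  then show "df (\<lambda>e. e 0 = Coll (\<lambda>x. P x (\<lambda>i. e (Suc i))))"
    unfolding * by (intro dfi)
qed

definition Sep :: "'m \<Rightarrow> ('m \<Rightarrow> bool) \<Rightarrow> 'm" where
  "Sep a P = Coll (\<lambda>x. x \<epsilon> a \<and> P x)"

lemma mem_Sep: "df (\<lambda>e. P (e 0)) \<Longrightarrow> x \<epsilon> Sep a P \<longleftrightarrow> x \<epsilon> a \<and> P x"
  unfolding Sep_def by (rule mem_Coll) (rule sep_ex)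

lemma dt_Sep [dfi]:
  assumes "dt a" and P: "df (\<lambda>e. P (e 0) (\<lambda>i. e (Suc i)))"
  shows "dt (\<lambda>e. Sep (a e) (\<lambda>x. P x e))"
  unfolding Sep_def
proof (rule dt_Coll)
  show "\<exists>b. \<forall>x. x \<epsilon> b \<longleftrightarrow> x \<epsilon> a e \<and> P x e" for e
    using sep_ex[OF df_const_env[OF P]] .
  show "df (\<lambda>e. e 0 \<epsilon> a (\<lambda>i. e (Suc i)) \<and> P (e 0) (\<lambda>i. e (Suc i)))"
    by (intro dfi dt_ren[OF assms(1)] P)
qed

lemma Coll_Sep: "(\<And>x. P x \<Longrightarrow> x \<epsilon> a) \<Longrightarrow> Coll P = Sep a P"
  unfolding Sep_def by (rule arg_cong[of _ _ Coll]) auto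

definition Repl :: "'m \<Rightarrow> ('m \<Rightarrow> 'm) \<Rightarrow> 'm" where
  "Repl a t = Coll (\<lambda>y. \<exists>x. x \<epsilon> a \<and> y = t x)"

lemma repl_fun: "dt (\<lambda>e. t (e 0)) \<Longrightarrow> \<exists>b. \<forall>y. y \<epsilon> b \<longleftrightarrow> (\<exists>x. x \<epsilon> a \<and> y = t x)"
proof (rule repl_ex)
  assume "dt (\<lambda>e. t (e 0))"
  from dt1[OF this dt_var[of 0]]
  show "df (\<lambda>e. e (Suc 0) = t (e 0))"
    by (intro dfi) 
qed simp

lemma mem_Repl: "dt (\<lambda>e. t (e 0)) \<Longrightarrow> y \<epsilon> Repl a t \<longleftrightarrow> (\<exists>x. x \<epsilon> a \<and> y = t x)"
  unfolding Repl_def by (rule mem_Coll) (rule repl_fun)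

lemma dt_const_env:
  assumes t: "dt (\<lambda>e. t (e 0) (\<lambda>i. e (Suc i)))" shows "dt (\<lambda>e'. t (e' 0) e)"
  unfolding dt_def
  by (rule df_const_env2[of "\<lambda>y x e. y = t x e"]) (use t[unfolded dt_def] in simp)

lemma dt_Repl [dfi]:
  assumes a: "dt a" and t: "dt (\<lambda>e. t (e 0) (\<lambda>i. e (Suc i)))"
  shows "dt (\<lambda>e. Repl (a e) (\<lambda>x. t x e))"
  unfolding Repl_def
proof (rule dt_Coll)
  show "\<exists>b. \<forall>y. y \<epsilon> b \<longleftrightarrow> (\<exists>x. x \<epsilon> a e \<and> y = t x e)" for e
    by (rule repl_fun[OF dt_const_env[OF t]])
  have t2: "dt (\<lambda>e. t (e 0) (\<lambda>i. e (Suc (Suc i))))"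
    using dt_ren[OF t, of "\<lambda>i. case i of 0 \<Rightarrow> 0 | Suc j \<Rightarrow> Suc (Suc j)"] by simp
  have a2: "dt (\<lambda>e. a (\<lambda>i. e (Suc (Suc i))))" by (rule dt_ren[OF a])
  show "df (\<lambda>e. \<exists>x. x \<epsilon> a (\<lambda>i. e (Suc i)) \<and> e 0 = t x (\<lambda>i. e (Suc i)))"
    by (intro dfi a2 t2)
qed

lemma mem_upair [simp]: "x \<epsilon> upair a b \<longleftrightarrow> x = a \<or> x = b"
  unfolding upair_def by (rule mem_Coll) (rule pairing)

lemma dt_upair [dfi]: "dt s \<Longrightarrow> dt t \<Longrightarrow> dt (\<lambda>e. upair (s e) (t e))"
  by (rule dt2[of upair], unfold upair_def, rule dt_Coll, rule pairing, intro dfi)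

lemma upair_eq: "upair a b = upair c d \<longleftrightarrow> (a = c \<and> b = d) \<or> (a = d \<and> b = c)"
proof
  assume "upair a b = upair c d"
  then have "\<forall>x. (x = a \<or> x = b) \<longleftrightarrow> (x = c \<or> x = d)" by (metis mem_upair)
  then show "(a = c \<and> b = d) \<or> (a = d \<and> b = c)" by metis
next
  assume "(a = c \<and> b = d) \<or> (a = d \<and> b = c)"
  then show "upair a b = upair c d" by (intro set_ext) auto
qed

lemma pair_eq [simp]: "pair a b = pair c d \<longleftrightarrow> a = c \<and> b = d"
  unfolding pair_def upair_eq by auto

lemma dt_pair [dfi]: "dt s \<Longrightarrow> dt t \<Longrightarrow> dt (\<lambda>e. pair (s e) (t e))"
  unfolding pair_def by (intro dfi)

definition Uni :: "'m \<Rightarrow> 'm" where "Uni a = Coll (\<lambda>z. \<exists>y. z \<epsilon> y \<and> y \<epsilon> a)"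

lemma mem_Uni [simp]: "z \<epsilon> Uni a \<longleftrightarrow> (\<exists>y. z \<epsilon> y \<and> y \<epsilon> a)"
  unfolding Uni_def by (rule mem_Coll) (rule union)

lemma dt_Uni [dfi]: "dt s \<Longrightarrow> dt (\<lambda>e. Uni (s e))"
  by (rule dt1[of Uni], unfold Uni_def, rule dt_Coll, rule union, intro dfi)

lemma df_subs [dfi]: "dt s \<Longrightarrow> dt t \<Longrightarrow> df (\<lambda>e. s e \<sqsubseteq> t e)"
  by (rule df2[of "(\<sqsubseteq>)"], unfold subs_def, intro dfi)

lemma mem_pow [simp]: "z \<epsilon> pow a \<longleftrightarrow> z \<sqsubseteq> a"
  unfolding pow_def by (rule mem_Coll) (use powerset in \<open>simp add: subs_def\<close>)

lemma subsI: "(\<And>x. x \<epsilon> a \<Longrightarrow> x \<epsilon> b) \<Longrightarrow> a \<sqsubseteq> b" by (simp add: subs_def)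
lemma subsD: "a \<sqsubseteq> b \<Longrightarrow> x \<epsilon> a \<Longrightarrow> x \<epsilon> b" by (simp add: subs_def)

section \<open>Products, functions and application\<close>

definition prd :: "'m \<Rightarrow> 'm \<Rightarrow> 'm" where
  "prd a b = Uni (Repl a (\<lambda>x. Repl b (\<lambda>y. pair x y)))"

lemma mem_prd: "p \<epsilon> prd a b \<longleftrightarrow> (\<exists>x y. x \<epsilon> a \<and> y \<epsilon> b \<and> p = pair x y)"
proof -
  have 1: "dt (\<lambda>e. pair x (e 0))" for x by (intro dfi)
  have 2: "dt (\<lambda>e. Repl b (\<lambda>y. pair (e 0) y))" by (intro dfi)
  show ?thesis unfolding prd_def mem_Uni mem_Repl[OF 2] using mem_Repl[OF 1] by metis
qed

lemma pair_prd [simp]: "pair x y \<epsilon> prd a b \<longleftrightarrow> x \<epsilon> a \<and> y \<epsilon> b"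
  by (auto simp: mem_prd)

lemma df_maps [dfi]: "dt s \<Longrightarrow> dt t \<Longrightarrow> dt u \<Longrightarrow> df (\<lambda>e. maps (s e) (t e) (u e))"
  by (rule df3[of maps], unfold maps_def, intro dfi)

lemma funs_Sep: "funs a b = Sep (pow (prd a b)) (\<lambda>f. maps f a b)"
  unfolding funs_def by (rule Coll_Sep) (auto simp: maps_def subs_def mem_prd)

lemma mem_funs [simp]: "f \<epsilon> funs a b \<longleftrightarrow> maps f a b"
proof -
  have "df (\<lambda>e. maps (e 0) a b)" by (intro dfi)
  then show ?thesis unfolding funs_Sep by (auto simp: mem_Sep maps_def subs_def mem_prd)
qed

lemma mem_zero [simp]: "\<not> x \<epsilon> zero"
proof -
  obtain a :: 'm where True by simp
  have "\<exists>b. \<forall>x. x \<epsilon> b \<longleftrightarrow> False" using sep_ex[of "\<lambda>_. False" a] by (simp add: dfi)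
  from mem_Coll[OF this] show ?thesis unfolding zero_def by simp
qed

lemma mem_succ [simp]: "x \<epsilon> succ n \<longleftrightarrow> x \<epsilon> n \<or> x = n"
  unfolding succ_def
proof (rule mem_Coll)
  have "x \<epsilon> Uni (upair n (upair n n)) \<longleftrightarrow> x \<epsilon> n \<or> x = n" for x by (metis mem_upair mem_Uni)
  then show "\<exists>a. \<forall>x. x \<epsilon> a \<longleftrightarrow> x \<epsilon> n \<or> x = n" by blast
qed

lemma succ_Uni: "succ n = Uni (upair n (upair n n))" by (rule set_ext) (metis mem_succ mem_upair mem_Uni)

lemma dt_succ [dfi]: "dt s \<Longrightarrow> dt (\<lambda>e. succ (s e))"
  by (rule dt1[of succ], unfold succ_Uni, intro dfi)

text \<open>Where no unique value exists, \<open>\<cdot>\<close> returns something that no formula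
  describes. The default \<open>zero\<close> makes the graph definable, and both operations agree on
  the domain of a function.\<close>

definition ap :: "'m \<Rightarrow> 'm \<Rightarrow> 'm" where
  "ap f x = (if \<exists>!y. pair x y \<epsilon> f then THE y. pair x y \<epsilon> f else zero)"

lemma dt_ap [dfi]: "dt s \<Longrightarrow> dt t \<Longrightarrow> dt (\<lambda>e. ap (s e) (t e))"
proof (rule dt2[of ap], rule dtI)
  have *: "z = ap f x \<longleftrightarrow> ((\<exists>!y. pair x y \<epsilon> f) \<and> pair x z \<epsilon> f) \<or> (\<not> (\<exists>!y. pair x y \<epsilon> f) \<and> z = zero)" for z f x
    unfolding ap_def by (auto intro: theI the1_equality[symmetric])
  show "df (\<lambda>e. e 0 = ap (e (Suc 0)) (e (Suc (Suc 0))))"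
    unfolding * by (intro dfi)
qed

lemma maps_ap: "maps f a b \<Longrightarrow> x \<epsilon> a \<Longrightarrow> pair x (ap f x) \<epsilon> f"
  unfolding ap_def maps_def using theI'[of "\<lambda>y. pair x y \<epsilon> f"] by simp

lemma maps_pair: "maps f a b \<Longrightarrow> pair x y \<epsilon> f \<longleftrightarrow> x \<epsilon> a \<and> y = ap f x"
proof
  assume f: "maps f a b" and p: "pair x y \<epsilon> f"
  then have x: "x \<epsilon> a" unfolding maps_def by fastforce
  then have "\<exists>!y. pair x y \<epsilon> f" using f unfolding maps_def by simp
  then show "x \<epsilon> a \<and> y = ap f x" using maps_ap[OF f x] p x by blast
qed (use maps_ap in simp)

lemma ap_in: "maps f a b \<Longrightarrow> x \<epsilon> a \<Longrightarrow> ap f x \<epsilon> b"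
  using maps_ap[of f a b x] unfolding maps_def by fastforce

lemma app_ap: "maps f a b \<Longrightarrow> x \<epsilon> a \<Longrightarrow> f \<cdot> x = ap f x"
  unfolding app_def ap_def maps_def by auto

lemma maps_ext: "maps f a b \<Longrightarrow> maps g a c \<Longrightarrow> (\<And>x. x \<epsilon> a \<Longrightarrow> ap f x = ap g x) \<Longrightarrow> f = g"
proof (rule set_ext)
  fix p assume f: "maps f a b" and g: "maps g a c" and e: "\<And>x. x \<epsilon> a \<Longrightarrow> ap f x = ap g x"
  have *: "p \<epsilon> h \<longleftrightarrow> (\<exists>x. x \<epsilon> a \<and> p = pair x (ap h x))" if h: "maps h a d" for h d
  proof
    assume p: "p \<epsilon> h"
    then obtain x y where "p = pair x y" using h unfolding maps_def by blast
    then show "\<exists>x. x \<epsilon> a \<and> p = pair x (ap h x)" using maps_pair[OF h] p by auto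
  qed (use maps_ap[OF h] in auto)
  show "p \<epsilon> f \<longleftrightarrow> p \<epsilon> g" unfolding *[OF f] *[OF g] using e by auto
qed

definition Lam :: "'m \<Rightarrow> ('m \<Rightarrow> 'm) \<Rightarrow> 'm" where
  "Lam a t = Repl a (\<lambda>x. pair x (t x))"

lemma dt_Lam [dfi]: "dt a \<Longrightarrow> dt (\<lambda>e. t (e 0) (\<lambda>i. e (Suc i))) \<Longrightarrow> dt (\<lambda>e. Lam (a e) (\<lambda>x. t x e))"
  unfolding Lam_def by (intro dfi)

lemma pair_Lam: "dt (\<lambda>e. t (e 0)) \<Longrightarrow> p \<epsilon> Lam a t \<longleftrightarrow> (\<exists>x. x \<epsilon> a \<and> p = pair x (t x))"
proof -
  assume "dt (\<lambda>e. t (e 0))"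
  then have "dt (\<lambda>e. pair (e 0) (t (e 0)))" by (intro dfi)
  then show ?thesis unfolding Lam_def by (rule mem_Repl)
qed

lemma Lam_maps: "dt (\<lambda>e. t (e 0)) \<Longrightarrow> (\<And>x. x \<epsilon> a \<Longrightarrow> t x \<epsilon> b) \<Longrightarrow> maps (Lam a t) a b"
  unfolding maps_def by (auto simp: pair_Lam)

lemma ap_Lam: "dt (\<lambda>e. t (e 0)) \<Longrightarrow> x \<epsilon> a \<Longrightarrow> ap (Lam a t) x = t x"
  unfolding ap_def by (auto simp: pair_Lam)

section \<open>Natural numbers of the model\<close>

text \<open>Infinity supplies some inductive set, and separating from it the elements of all
  inductive sets shows that the class defining \<open>omega\<close> is a set.\<close>

lemma zero_omega [simp]: "zero \<epsilon> omega" and succ_omega: "n \<epsilon> omega \<Longrightarrow> succ n \<epsilon> omega"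
  and omega_least: "n \<epsilon> omega \<Longrightarrow> zero \<epsilon> w \<Longrightarrow> (\<And>x. x \<epsilon> w \<Longrightarrow> succ x \<epsilon> w) \<Longrightarrow> n \<epsilon> w"
proof -
  let ?P = "\<lambda>n. \<forall>w. zero \<epsilon> w \<and> (\<forall>x. x \<epsilon> w \<longrightarrow> succ x \<epsilon> w) \<longrightarrow> n \<epsilon> w"
  obtain w z where w: "z \<epsilon> w" "\<forall>y. \<not> y \<epsilon> z"
    "\<forall>x. x \<epsilon> w \<longrightarrow> (\<exists>s. s \<epsilon> w \<and> (\<forall>z. z \<epsilon> s \<longleftrightarrow> z \<epsilon> x \<or> z = x))"
    using infinity by blast
  have z: "z = zero" by (rule set_ext) (simp add: w)
  have s: "succ x \<epsilon> w" if xw: "x \<epsilon> w" for x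
  proof -
    obtain s where "s \<epsilon> w" "\<forall>z. z \<epsilon> s \<longleftrightarrow> z \<epsilon> x \<or> z = x"
      using w(3)[rule_format, OF xw] by auto
    then have "s = succ x" by (intro set_ext) simp
    then show ?thesis using \<open>s \<epsilon> w\<close> by simp
  qed
  have "df (\<lambda>e. ?P (e 0))" by (intro dfi)
  then have "\<exists>a. \<forall>x. x \<epsilon> a \<longleftrightarrow> x \<epsilon> w \<and> ?P x" by (rule sep_ex)
  moreover have "?P x \<Longrightarrow> x \<epsilon> w" for x using w(1) z s by blast
  ultimately have "\<exists>a. \<forall>x. x \<epsilon> a \<longleftrightarrow> ?P x" by (elim ex_forward) (auto simp only:)
  then have *: "n \<epsilon> omega \<longleftrightarrow> ?P n" for n unfolding omega_def by (rule mem_Coll)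
  show "zero \<epsilon> omega" "n \<epsilon> omega \<Longrightarrow> succ n \<epsilon> omega"
    "n \<epsilon> omega \<Longrightarrow> zero \<epsilon> w \<Longrightarrow> (\<And>x. x \<epsilon> w \<Longrightarrow> succ x \<epsilon> w) \<Longrightarrow> n \<epsilon> w" for n w
    unfolding * by blast+
qed

text \<open>Since \<open>omega\<close> may be nonstandard, only properties that Separation can turn
  into a set admit induction; this accounts for the case \<open>df\<close> in every induction
  below.\<close>

lemma omega_induct [consumes 1, case_names df zero succ]:
  assumes n: "n \<epsilon> omega" and P: "df (\<lambda>e. P (e 0))" and "P zero"
    and "\<And>n. n \<epsilon> omega \<Longrightarrow> P n \<Longrightarrow> P (succ n)"
  shows "P n"
proof -
  have "n \<epsilon> Sep omega P"
    by (rule omega_least[OF n]) (use assms succ_omega in \<open>auto simp: mem_Sep[OF P]\<close>)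
  then show ?thesis by (simp add: mem_Sep[OF P])
qed

lemma omega_cases: "n \<epsilon> omega \<Longrightarrow> n = zero \<or> (\<exists>m. m \<epsilon> omega \<and> n = succ m)"
proof (induction n rule: omega_induct)
  case df show ?case by (intro dfi)
qed auto

lemma mem_omega: "n \<epsilon> omega \<Longrightarrow> \<forall>m. m \<epsilon> n \<longrightarrow> m \<epsilon> omega"
proof (induction n rule: omega_induct)
  case df show ?case by (intro dfi)
qed auto

lemma mem_omegaD: "m \<epsilon> n \<Longrightarrow> n \<epsilon> omega \<Longrightarrow> m \<epsilon> omega" using mem_omega by blast

lemma omega_trans': "n \<epsilon> omega \<Longrightarrow> \<forall>m. m \<epsilon> n \<longrightarrow> (\<forall>k. k \<epsilon> m \<longrightarrow> k \<epsilon> n)"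
proof (induction n rule: omega_induct)
  case df show ?case by (intro dfi)
qed auto

lemma omega_trans: "k \<epsilon> m \<Longrightarrow> m \<epsilon> n \<Longrightarrow> n \<epsilon> omega \<Longrightarrow> k \<epsilon> n" using omega_trans' by blast

lemma not_mem_self: "\<not> x \<epsilon> x"
  using foundation[of "upair x x"] by auto

lemma succ_mono': "n \<epsilon> omega \<Longrightarrow> \<forall>m. m \<epsilon> n \<longrightarrow> succ m \<epsilon> succ n"
proof (induction n rule: omega_induct)
  case df show ?case by (intro dfi)
qed auto

lemma omega_linear': "n \<epsilon> omega \<Longrightarrow> \<forall>m. m \<epsilon> omega \<longrightarrow> m \<epsilon> n \<or> m = n \<or> n \<epsilon> m"
proof (induction n rule: omega_induct)
  case df show ?case by (intro dfi)
next
  case zero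
  have "m = zero \<or> zero \<epsilon> m" if "m \<epsilon> omega" for m using that
  proof (induction m rule: omega_induct)
    case df show ?case by (intro dfi)
  qed auto
  then show ?case by blast
next
  case (succ n)
  show ?case
  proof (intro allI impI)
    fix m assume m: "m \<epsilon> omega"
    with succ.IH consider "m \<epsilon> n" | "m = n" | "n \<epsilon> m" by blast
    then show "m \<epsilon> succ n \<or> m = succ n \<or> succ n \<epsilon> m"
    proof cases
      case 3
      then have "succ n \<epsilon> succ m" using succ_mono' m by blast
      then show ?thesis by auto
    qed auto
  qed
qed

lemma omega_linear: "m \<epsilon> omega \<Longrightarrow> n \<epsilon> omega \<Longrightarrow> m \<epsilon> n \<or> m = n \<or> n \<epsilon> m"
  using omega_linear' by blast

lemma succ_inj: "succ m = succ n \<Longrightarrow> m = n"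
proof (rule ccontr)
  assume s: "succ m = succ n" "m \<noteq> n"
  have "m \<epsilon> succ n" "n \<epsilon> succ m" using mem_succ[of m m] mem_succ[of n n] s(1) by simp_all
  then have "m \<epsilon> n" "n \<epsilon> m" using s(2) by auto
  then show False using foundation[of "upair m n"] by auto
qed

lemma succ_not_zero [simp]: "succ n \<noteq> zero" using mem_succ[of n n] by (metis mem_zero)

lemma zero_mem: "n \<epsilon> omega \<Longrightarrow> zero = n \<or> zero \<epsilon> n"
  using omega_linear[of zero n] by auto

lemma succ_mem_succ: "n \<epsilon> omega \<Longrightarrow> m \<epsilon> n \<Longrightarrow> succ m \<epsilon> succ n" using succ_mono' by blast

lemma omega_max: "m \<epsilon> omega \<Longrightarrow> n \<epsilon> omega \<Longrightarrow> \<exists>k. k \<epsilon> omega \<and> m \<epsilon> k \<and> n \<epsilon> k"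
proof -
  assume m: "m \<epsilon> omega" and n: "n \<epsilon> omega"
  then consider "m \<epsilon> n" | "m = n" | "n \<epsilon> m" using omega_linear by blast
  then show ?thesis
  proof cases
    case 1 then show ?thesis using succ_omega[OF n] by (intro exI[of _ "succ n"]) simp
  next
    case 2 then show ?thesis using succ_omega[OF n] by (intro exI[of _ "succ n"]) simp
  next
    case 3 then show ?thesis using succ_omega[OF m] by (intro exI[of _ "succ m"]) simp
  qed
qed

lemma omega_max3: "m \<epsilon> omega \<Longrightarrow> n \<epsilon> omega \<Longrightarrow> p \<epsilon> omega \<Longrightarrow> \<exists>k. k \<epsilon> omega \<and> m \<epsilon> k \<and> n \<epsilon> k \<and> p \<epsilon> k"
  using omega_max omega_trans by meson

lemma omega_subset: "m \<epsilon> omega \<Longrightarrow> n \<epsilon> omega \<Longrightarrow> m \<sqsubseteq> n \<longleftrightarrow> m \<epsilon> n \<or> m = n"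
  unfolding subs_def using omega_linear omega_trans not_mem_self by metis

lemma omega_least_ex:
  assumes P: "df (\<lambda>e. P (e 0))" and n: "n \<epsilon> omega" "P n"
  shows "\<exists>n. n \<epsilon> omega \<and> P n \<and> (\<forall>m. m \<epsilon> n \<longrightarrow> \<not> P m)"
proof -
  have "\<exists>x. x \<epsilon> Sep omega P" using n by (auto simp: mem_Sep[OF P])
  from foundation[OF this] obtain x where "x \<epsilon> omega" "P x" "\<not> (\<exists>y. y \<epsilon> x \<and> y \<epsilon> Sep omega P)"
    by (auto simp: mem_Sep[OF P])
  then show ?thesis using mem_omegaD by (auto simp: mem_Sep[OF P])
qed

text \<open>Carries a property from the top of a backward recursion to its earlier entries. It is an
  upward induction on the top.\<close>

lemma down_induct:
  assumes P: "df (\<lambda>e. P (e 0))" and n: "n \<epsilon> omega" "P n"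
    and step: "\<And>m. m \<epsilon> n \<Longrightarrow> P (succ m) \<Longrightarrow> P m" and m: "m \<epsilon> n"
  shows "P m"
proof -
  have P2: "df (\<lambda>e. P (succ (e 0)))" by (intro dfi df1[OF P])
  have "\<forall>m. m \<epsilon> k \<longrightarrow> P m" if "k \<epsilon> omega" "P k" "\<forall>m. m \<epsilon> k \<longrightarrow> P (succ m) \<longrightarrow> P m" for k
    using that
  proof (induction k rule: omega_induct)
    case df show ?case by (intro dfi df1[OF P])
  next
    case (succ k) then show ?case by (metis mem_succ)
  qed auto
  then show ?thesis using assms by blast
qed

section \<open>Recursion on the natural numbers of the model and enumeration of pairs\<close>

lemma prdE: "p \<epsilon> prd a b \<Longrightarrow> (\<And>x y. x \<epsilon> a \<Longrightarrow> y \<epsilon> b \<Longrightarrow> p = pair x y \<Longrightarrow> thesis) \<Longrightarrow> thesis"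
  unfolding mem_prd by blast

text \<open>The graph is the least relation that contains the initial pair and is closed under the
  step. It is single-valued because deleting the pairs with a wrong value at one argument leaves it
  closed, so there are none.\<close>

lemma omega_rec:
  assumes t: "dt (\<lambda>e. t (e 0))" and x0: "x0 \<epsilon> X" and tX: "\<And>x. x \<epsilon> X \<Longrightarrow> t x \<epsilon> X"
  shows "\<exists>h. maps h omega X \<and> ap h zero = x0 \<and> (\<forall>n. n \<epsilon> omega \<longrightarrow> ap h (succ n) = t (ap h n))"
proof -
  note t' = dt1[OF t]
  let ?cl = "\<lambda>s. pair zero x0 \<epsilon> s \<and>
    (\<forall>n x. n \<epsilon> omega \<and> x \<epsilon> X \<and> pair n x \<epsilon> s \<longrightarrow> pair (succ n) (t x) \<epsilon> s)"
  define r where "r = Sep (prd omega X) (\<lambda>p. \<forall>s. ?cl s \<longrightarrow> p \<epsilon> s)"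
  have r_mem: "p \<epsilon> r \<longleftrightarrow> p \<epsilon> prd omega X \<and> (\<forall>s. ?cl s \<longrightarrow> p \<epsilon> s)" for p
    unfolding r_def by (rule mem_Sep) (intro dfi t')
  have cl: "?cl r" unfolding r_mem using x0 tX succ_omega by simp
  have least: "p \<epsilon> r \<Longrightarrow> ?cl s \<Longrightarrow> p \<epsilon> s" for p s unfolding r_mem by blast
  have uniq: "\<exists>!x. pair n x \<epsilon> r" if "n \<epsilon> omega" for n using that
  proof (induction n rule: omega_induct)
    case df show ?case by (intro dfi)
  next
    case zero
    define s where "s = Sep r (\<lambda>p. \<forall>y. p = pair zero y \<longrightarrow> y = x0)"
    have s: "p \<epsilon> s \<longleftrightarrow> p \<epsilon> r \<and> (\<forall>y. p = pair zero y \<longrightarrow> y = x0)" for p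
      unfolding s_def by (rule mem_Sep) (intro dfi)
    have c: "?cl s" unfolding s using cl succ_not_zero by simp
    show ?case
    proof (rule ex1I)
      show "pair zero x0 \<epsilon> r" using cl by simp
      show "y = x0" if "pair zero y \<epsilon> r" for y using least[OF that c] unfolding s by simp
    qed
  next
    case (succ n)
    then obtain x where x: "pair n x \<epsilon> r" "\<And>y. pair n y \<epsilon> r \<Longrightarrow> y = x" by blast
    then have xX: "x \<epsilon> X" unfolding r_mem by simp
    define s where "s = Sep r (\<lambda>p. \<forall>y. p = pair (succ n) y \<longrightarrow> y = t x)"
    have s: "p \<epsilon> s \<longleftrightarrow> p \<epsilon> r \<and> (\<forall>y. p = pair (succ n) y \<longrightarrow> y = t x)" for p
      unfolding s_def by (rule mem_Sep) (intro dfi)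
    have "?cl s"
    proof (intro conjI allI impI)
      show "pair zero x0 \<epsilon> s" unfolding s using cl succ_not_zero[symmetric] by simp
      fix n' x' assume a: "n' \<epsilon> omega \<and> x' \<epsilon> X \<and> pair n' x' \<epsilon> s"
      then have r': "pair n' x' \<epsilon> r" unfolding s by simp
      then have "pair (succ n') (t x') \<epsilon> r" using a cl by simp
      moreover have "y = t x" if "pair (succ n') (t x') = pair (succ n) y" for y
      proof -
        have "n' = n" "y = t x'" using that succ_inj by auto
        then show ?thesis using x(2) r' by simp
      qed
      ultimately show "pair (succ n') (t x') \<epsilon> s" unfolding s by simp
    qed
    note c = this
    show ?case
    proof (rule ex1I)
      show "pair (succ n) (t x) \<epsilon> r" using cl x(1) xX succ(1) by simp
      show "y = t x" if "pair (succ n) y \<epsilon> r" for y using least[OF that c] unfolding s by simp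
    qed
  qed
  have m: "maps r omega X"
    unfolding maps_def
  proof (intro conjI allI impI)
    fix p assume "p \<epsilon> r"
    then have "p \<epsilon> prd omega X" using r_mem by simp
    then show "\<exists>x y. x \<epsilon> omega \<and> y \<epsilon> X \<and> p = pair x y" by (simp add: mem_prd)
  qed (rule uniq)
  have "ap r zero = x0" using cl maps_pair[OF m, of zero x0] by simp
  moreover have "ap r (succ n) = t (ap r n)" if n: "n \<epsilon> omega" for n
  proof -
    have "pair (succ n) (t (ap r n)) \<epsilon> r" using cl maps_ap[OF m n] ap_in[OF m n] n by simp
    then show ?thesis using maps_pair[OF m, of "succ n"] by simp
  qed
  ultimately show ?thesis using m by (intro exI[of _ r]) simp
qed

definition pfst :: "'m \<Rightarrow> 'm" where
  "pfst p = (if \<exists>x y. p = pair x y then THE x. \<exists>y. p = pair x y else zero)"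
definition psnd :: "'m \<Rightarrow> 'm" where
  "psnd p = (if \<exists>x y. p = pair x y then THE y. \<exists>x. p = pair x y else zero)"

lemma pfst_pair [simp]: "pfst (pair x y) = x" and psnd_pair [simp]: "psnd (pair x y) = y"
  unfolding pfst_def psnd_def by auto

lemma dt_pfst [dfi]: "dt s \<Longrightarrow> dt (\<lambda>e. pfst (s e))"
proof (rule dt1[of pfst], rule dtI)
  have *: "z = pfst p \<longleftrightarrow> (\<exists>y. p = pair z y) \<or> (\<not> (\<exists>x y. p = pair x y) \<and> z = zero)" for z p
    by (cases "\<exists>x y. p = pair x y") (auto simp: pfst_def[of p])
  show "df (\<lambda>e. e 0 = pfst (e (Suc 0)))" unfolding * by (intro dfi)
qed

lemma dt_psnd [dfi]: "dt s \<Longrightarrow> dt (\<lambda>e. psnd (s e))"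
proof (rule dt1[of psnd], rule dtI)
  have *: "z = psnd p \<longleftrightarrow> (\<exists>y. p = pair y z) \<or> (\<not> (\<exists>x y. p = pair x y) \<and> z = zero)" for z p
    by (cases "\<exists>x y. p = pair x y") (auto simp: psnd_def[of p])
  show "df (\<lambda>e. e 0 = psnd (e (Suc 0)))" unfolding * by (intro dfi)
qed

text \<open>The walk through \<open>(m, n, k)\<close> with \<open>n, k \<le> m\<close> in lexicographic order enumerates \<open>\<omega> \<times> \<omega>\<close>
  without arithmetic.\<close>

lemma omega_prd_enum:
  "\<exists>p. maps p omega (prd omega omega) \<and>
    (\<forall>m n. m \<epsilon> omega \<and> n \<epsilon> omega \<longrightarrow> (\<exists>i. i \<epsilon> omega \<and> ap p i = pair m n))"
proof -
  define X where "X = prd omega (prd omega omega)"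
  define t where "t s = (if psnd (psnd s) \<noteq> pfst s then pair (pfst s) (pair (pfst (psnd s)) (succ (psnd (psnd s))))
    else if pfst (psnd s) \<noteq> pfst s then pair (pfst s) (pair (succ (pfst (psnd s))) zero)
    else pair (succ (pfst s)) (pair zero zero))" for s
  have "dt (\<lambda>e. t (e 0))" unfolding t_def by (intro dfi)
  moreover have "pair zero (pair zero zero) \<epsilon> X" by (simp add: X_def)
  moreover have "t s \<epsilon> X" if sX: "s \<epsilon> X" for s
  proof -
    obtain m q where "m \<epsilon> omega" "q \<epsilon> prd omega omega" "s = pair m q"
      using sX[unfolded X_def] by (rule prdE)
    moreover from this(2) obtain n k where "n \<epsilon> omega" "k \<epsilon> omega" "q = pair n k"
      by (rule prdE)
    ultimately show ?thesis by (simp add: t_def X_def succ_omega)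
  qed
  ultimately have "\<exists>h. maps h omega X \<and> ap h zero = pair zero (pair zero zero) \<and>
      (\<forall>n. n \<epsilon> omega \<longrightarrow> ap h (succ n) = t (ap h n))" by (rule omega_rec)
  then obtain h where h: "maps h omega X" "ap h zero = pair zero (pair zero zero)"
    "\<And>n. n \<epsilon> omega \<Longrightarrow> ap h (succ n) = t (ap h n)" by blast
  define R where "R m n k \<longleftrightarrow> (\<exists>i. i \<epsilon> omega \<and> ap h i = pair m (pair n k))" for m n k
  have Rs: "R m' n' k'" if R: "R m n k" and R': "t (pair m (pair n k)) = pair m' (pair n' k')" for m n k m' n' k'
  proof -
    obtain i where i: "i \<epsilon> omega" "ap h i = pair m (pair n k)" using R unfolding R_def by blast
    then have "ap h (succ i) = pair m' (pair n' k')" using h(3) R' by simp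
    then show ?thesis unfolding R_def using succ_omega[OF i(1)] by blast
  qed
  have R3: "df (\<lambda>e. R (a e) (b e) (c e))" if "dt a" "dt b" "dt c" for a b c
    by (rule df3[of R, OF _ that]) (unfold R_def, intro dfi)
  have row: "k \<epsilon> omega \<Longrightarrow> R m n zero \<Longrightarrow> k \<epsilon> succ m \<longrightarrow> R m n k" if m: "m \<epsilon> omega" for m n k
  proof (induction k rule: omega_induct)
    case df show ?case by (intro dfi R3)
  next
    case (succ k)
    show ?case
    proof
      assume s: "succ k \<epsilon> succ m"
      have "k \<epsilon> succ k" by simp
      then have k: "k \<epsilon> m"
        using s omega_trans[of k "succ k" m] m by auto
      then have "R m n k" using succ by simp
      moreover have "k \<noteq> m" using k not_mem_self by blast
      ultimately show "R m n (succ k)" using Rs[of m n k m n "succ k"] by (simp add: t_def)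
    qed
  qed simp
  have col: "n \<epsilon> omega \<Longrightarrow> R m zero zero \<Longrightarrow> n \<epsilon> succ m \<longrightarrow> R m n zero" if m: "m \<epsilon> omega" for m n
  proof (induction n rule: omega_induct)
    case df show ?case by (intro dfi R3)
  next
    case (succ n)
    show ?case
    proof
      assume s: "succ n \<epsilon> succ m"
      have "n \<epsilon> succ n" by simp
      then have k: "n \<epsilon> m"
        using s omega_trans[of n "succ n" m] m by auto
      then have "R m n m" using succ row[OF m m] by simp
      moreover have "n \<noteq> m" using k not_mem_self by blast
      ultimately show "R m (succ n) zero" using Rs[of m n m m "succ n" zero] by (simp add: t_def)
    qed
  qed simp
  have R0: "R m zero zero" if "m \<epsilon> omega" for m using that
  proof (induction m rule: omega_induct)
    case df show ?case by (intro dfi R3)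
  next
    case zero show ?case using h(2) unfolding R_def by (intro exI[of _ zero]) simp
  next
    case (succ m)
    have "R m m m" using row[OF succ(1) succ(1)] col[OF succ(1) succ(1) succ(2)] by simp
    then show ?case by (rule Rs) (simp add: t_def)
  qed
  have all: "R m n k" if "m \<epsilon> omega" "n \<epsilon> succ m" "k \<epsilon> succ m" for m n k
  proof -
    have nk: "n \<epsilon> omega" "k \<epsilon> omega" using that mem_omegaD succ_omega by blast+
    have "R m n zero" using col[OF that(1) nk(1) R0[OF that(1)]] that(2) by auto
    then show ?thesis using row[OF that(1) nk(2)] that(3) by auto
  qed
  define p where "p = Lam omega (\<lambda>i. psnd (ap h i))"
  have d: "dt (\<lambda>e. psnd (ap h (e 0)))" by (intro dfi)
  have "psnd (ap h i) \<epsilon> prd omega omega" if i: "i \<epsilon> omega" for i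
  proof -
    obtain m q where "q \<epsilon> prd omega omega" "ap h i = pair m q"
      using ap_in[OF h(1) i, unfolded X_def] by (rule prdE)
    then show ?thesis by simp
  qed
  then have "maps p omega (prd omega omega)" unfolding p_def by (intro Lam_maps d)
  moreover have "\<exists>i. i \<epsilon> omega \<and> ap p i = pair m n" if mn: "m \<epsilon> omega" "n \<epsilon> omega" for m n
  proof -
    obtain k where k: "k \<epsilon> omega" "m \<epsilon> k" "n \<epsilon> k" using omega_max mn by blast
    then have "R k m n" using all by simp
    then obtain i where "i \<epsilon> omega" "ap h i = pair k (pair m n)" unfolding R_def by blast
    then show ?thesis unfolding p_def by (auto simp: ap_Lam[OF d])
  qed
  ultimately show ?thesis by blast
qed

section \<open>Baire space and Lipschitz reductions\<close>

lemma mem_baire: "x \<epsilon> baire \<longleftrightarrow> maps x omega omega" by (simp add: baire_def)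

lemma baire_ap: "x \<epsilon> baire \<Longrightarrow> n \<epsilon> omega \<Longrightarrow> ap x n \<epsilon> omega"
  unfolding mem_baire by (rule ap_in)

lemma baire_ext: "x \<epsilon> baire \<Longrightarrow> y \<epsilon> baire \<Longrightarrow> (\<And>n. n \<epsilon> omega \<Longrightarrow> ap x n = ap y n) \<Longrightarrow> x = y"
  unfolding mem_baire by (rule maps_ext)

text \<open>For reals this says that the distance is at most \<open>2^-n\<close>. All metric and
  topological notions are expressed through it until the final translation.\<close>

definition agree :: "'m \<Rightarrow> 'm \<Rightarrow> 'm \<Rightarrow> bool" where
  "agree n x y \<longleftrightarrow> (\<forall>m. m \<epsilon> n \<longrightarrow> ap x m = ap y m)"

lemma df_agree [dfi]: "dt s \<Longrightarrow> dt t \<Longrightarrow> dt u \<Longrightarrow> df (\<lambda>e. agree (s e) (t e) (u e))"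
  by (rule df3[of agree], unfold agree_def, intro dfi)

lemma agree_refl [simp]: "agree n x x" by (simp add: agree_def)
lemma agree_sym: "agree n x y \<Longrightarrow> agree n y x" by (simp add: agree_def)
lemma agree_trans: "agree n x y \<Longrightarrow> agree n y z \<Longrightarrow> agree n x z" by (simp add: agree_def)
lemma agree_mono: "agree n x y \<Longrightarrow> m \<epsilon> n \<Longrightarrow> n \<epsilon> omega \<Longrightarrow> agree m x y"
  unfolding agree_def using omega_trans by blast
lemma agree_zero [simp]: "agree zero x y" by (simp add: agree_def)

lemma agree_all: "x \<epsilon> baire \<Longrightarrow> y \<epsilon> baire \<Longrightarrow> (\<And>n. n \<epsilon> omega \<Longrightarrow> agree n x y) \<Longrightarrow> x = y"
proof (rule baire_ext)
  fix n assume a: "\<And>n. n \<epsilon> omega \<Longrightarrow> agree n x y" and n: "n \<epsilon> omega"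
  show "ap x n = ap y n" using a[OF succ_omega[OF n]] by (simp add: agree_def)
qed

section \<open>Boolean operations, preimages and composition as definable terms\<close>

definition cpl :: "'m \<Rightarrow> 'm" where "cpl A = Sep baire (\<lambda>x. \<not> x \<epsilon> A)"
definition cap :: "'m \<Rightarrow> 'm \<Rightarrow> 'm" where "cap A B = Sep baire (\<lambda>x. x \<epsilon> A \<and> x \<epsilon> B)"
definition pre :: "'m \<Rightarrow> 'm \<Rightarrow> 'm" where "pre f B = Sep baire (\<lambda>x. ap f x \<epsilon> B)"
definition cmps :: "'m \<Rightarrow> 'm \<Rightarrow> 'm" where "cmps f g = Lam baire (\<lambda>x. ap f (ap g x))"
definition emp :: 'm where "emp = Sep baire (\<lambda>x. False)"

lemma mem_cpl [simp]: "x \<epsilon> cpl A \<longleftrightarrow> x \<epsilon> baire \<and> \<not> x \<epsilon> A"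
  unfolding cpl_def by (rule mem_Sep) (intro dfi)
lemma mem_cap [simp]: "x \<epsilon> cap A B \<longleftrightarrow> x \<epsilon> baire \<and> x \<epsilon> A \<and> x \<epsilon> B"
  unfolding cap_def by (rule mem_Sep) (intro dfi)
lemma mem_pre [simp]: "x \<epsilon> pre f B \<longleftrightarrow> x \<epsilon> baire \<and> ap f x \<epsilon> B"
  unfolding pre_def by (rule mem_Sep) (intro dfi)
lemma mem_emp [simp]: "\<not> x \<epsilon> emp" unfolding emp_def by (simp add: mem_Sep dfi)

lemma dt_cpl [dfi]: "dt s \<Longrightarrow> dt (\<lambda>e. cpl (s e))"
  by (rule dt1[of cpl], unfold cpl_def, intro dfi)
lemma dt_cap [dfi]: "dt s \<Longrightarrow> dt t \<Longrightarrow> dt (\<lambda>e. cap (s e) (t e))"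
  by (rule dt2[of cap], unfold cap_def, intro dfi)
lemma dt_pre [dfi]: "dt s \<Longrightarrow> dt t \<Longrightarrow> dt (\<lambda>e. pre (s e) (t e))"
  by (rule dt2[of pre], unfold pre_def, intro dfi)
lemma dt_cmps [dfi]: "dt s \<Longrightarrow> dt t \<Longrightarrow> dt (\<lambda>e. cmps (s e) (t e))"
  by (rule dt2[of cmps], unfold cmps_def, intro dfi)

lemma cpl_subs [simp]: "cpl A \<sqsubseteq> baire" and cap_subs [simp]: "cap A B \<sqsubseteq> baire"
  and pre_subs [simp]: "pre f A \<sqsubseteq> baire" and emp_subs [simp]: "emp \<sqsubseteq> baire" and baire_subs [simp]: "baire \<sqsubseteq> baire"
  by (simp_all add: subs_def)

lemma cpl_cpl: "A \<sqsubseteq> baire \<Longrightarrow> cpl (cpl A) = A"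
  by (rule set_ext) (auto simp: subs_def)

lemma ap_cmps: "x \<epsilon> baire \<Longrightarrow> ap (cmps f g) x = ap f (ap g x)"
  unfolding cmps_def by (rule ap_Lam) (intro dfi)

lemma cmps_maps: "maps f baire baire \<Longrightarrow> maps g baire baire \<Longrightarrow> maps (cmps f g) baire baire"
  unfolding cmps_def by (rule Lam_maps) (intro dfi, blast intro: ap_in)

lemma pre_cmps: "maps g baire baire \<Longrightarrow> pre (cmps f g) B = pre g (pre f B)"
  by (rule set_ext) (auto simp: ap_cmps ap_in)

lemma pre_cpl: "maps u baire baire \<Longrightarrow> pre u (cpl B) = cpl (pre u B)"
  by (rule set_ext) (auto simp: ap_in)

lemma pre_cap: "maps u baire baire \<Longrightarrow> pre u (cap B C) = cap (pre u B) (pre u C)"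
  by (rule set_ext) (auto simp: ap_in)

section \<open>Lipschitz maps and Lipschitz reducibility\<close>

definition lips :: "'m \<Rightarrow> bool" where
  "lips u \<longleftrightarrow> maps u baire baire \<and> (\<forall>x y n. x \<epsilon> baire \<and> y \<epsilon> baire \<and> n \<epsilon> omega \<and> agree n x y \<longrightarrow>
     agree n (ap u x) (ap u y))"

lemma df_lips [dfi]: "dt s \<Longrightarrow> df (\<lambda>e. lips (s e))"
  by (rule df1[of lips], unfold lips_def, intro dfi)

lemma lips_maps: "lips u \<Longrightarrow> maps u baire baire" by (simp add: lips_def)
lemma lips_agree: "lips u \<Longrightarrow> x \<epsilon> baire \<Longrightarrow> y \<epsilon> baire \<Longrightarrow> n \<epsilon> omega \<Longrightarrow> agree n x y \<Longrightarrow> agree n (ap u x) (ap u y)"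
  by (simp add: lips_def)

lemma lips_cmps: "lips u \<Longrightarrow> lips v \<Longrightarrow> lips (cmps u v)"
  unfolding lips_def by (auto simp: cmps_maps ap_cmps ap_in)

definition idb :: 'm where "idb = Lam baire (\<lambda>x. x)"
lemma ap_idb [simp]: "x \<epsilon> baire \<Longrightarrow> ap idb x = x" unfolding idb_def by (rule ap_Lam) (intro dfi)
lemma maps_idb: "maps idb baire baire" unfolding idb_def by (rule Lam_maps) (intro dfi)
lemma lips_idb: "lips idb" by (simp add: lips_def maps_idb)
lemma pre_idb: "A \<sqsubseteq> baire \<Longrightarrow> pre idb A = A" by (rule set_ext) (auto simp: subs_def)

definition lle :: "'m \<Rightarrow> 'm \<Rightarrow> bool" where "lle A B \<longleftrightarrow> (\<exists>u. lips u \<and> A = pre u B)"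

lemma df_lle [dfi]: "dt s \<Longrightarrow> dt t \<Longrightarrow> df (\<lambda>e. lle (s e) (t e))"
  by (rule df2[of lle], unfold lle_def, intro dfi)

lemma lle_cpl: "lle A B \<Longrightarrow> lle (cpl A) (cpl B)"
  unfolding lle_def by (elim exE conjE) (simp add: pre_cpl[OF lips_maps, symmetric], blast)
lemma lle_cpl_iff: "A \<sqsubseteq> baire \<Longrightarrow> B \<sqsubseteq> baire \<Longrightarrow> lle (cpl A) (cpl B) \<longleftrightarrow> lle A B"
  using lle_cpl[of A B] lle_cpl[of "cpl A" "cpl B"] by (auto simp: cpl_cpl)

definition cst :: "'m \<Rightarrow> 'm" where "cst n = Lam omega (\<lambda>_. n)"
lemma ap_cst [simp]: "m \<epsilon> omega \<Longrightarrow> ap (cst n) m = n" unfolding cst_def by (rule ap_Lam) (intro dfi)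
lemma cst_maps: "n \<epsilon> X \<Longrightarrow> maps (cst n) omega X" unfolding cst_def by (rule Lam_maps) (intro dfi)
lemma cst_baire [simp]: "n \<epsilon> omega \<Longrightarrow> cst n \<epsilon> baire" unfolding mem_baire by (rule cst_maps)
lemma dt_cst [dfi]: "dt s \<Longrightarrow> dt (\<lambda>e. cst (s e))"
  by (rule dt1[of cst], unfold cst_def, intro dfi)

text \<open>A sequence \<open>y\<close> of reals is coded by the Lipschitz map \<open>x \<mapsto> y (x 0)\<close>.\<close>

definition code :: "'m \<Rightarrow> 'm" where "code y = Lam baire (\<lambda>x. ap y (ap x zero))"

lemma code_ap: "x \<epsilon> baire \<Longrightarrow> ap (code y) x = ap y (ap x zero)"
  unfolding code_def by (rule ap_Lam) (intro dfi)

lemma code_lips: "maps y omega baire \<Longrightarrow> lips (code y)"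
proof -
  assume y: "maps y omega baire"
  have "maps (code y) baire baire"
    unfolding code_def by (rule Lam_maps) (intro dfi, rule ap_in[OF y], rule baire_ap, assumption, rule zero_omega)
  moreover have "agree n (ap (code y) x) (ap (code y) z)"
    if "x \<epsilon> baire" "z \<epsilon> baire" "n \<epsilon> omega" "agree n x z" for x z n
    using that zero_mem[OF that(3)] by (auto simp: code_ap agree_def)
  ultimately show ?thesis by (simp add: lips_def)
qed

section \<open>Sets of reductions and dependent choice\<close>

text \<open>Analytic sets in the form that the separation theorem consumes: a single depth
  \<open>k\<close> witnesses closedness in both coordinates, and only pairs of reals in
  \<open>C\<close> count.\<close>

definition sig :: "'m \<Rightarrow> bool" where
  "sig X \<longleftrightarrow> (\<exists>C. (\<forall>x y. x \<epsilon> baire \<and> y \<epsilon> baire \<and> \<not> pair x y \<epsilon> C \<longrightarrow>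
      (\<exists>k. k \<epsilon> omega \<and> (\<forall>x' y'. x' \<epsilon> baire \<and> y' \<epsilon> baire \<and> agree k x x' \<and> agree k y y' \<longrightarrow>
        \<not> pair x' y' \<epsilon> C))) \<and>
    (\<forall>x. x \<epsilon> X \<longleftrightarrow> x \<epsilon> baire \<and> (\<exists>y. y \<epsilon> baire \<and> pair x y \<epsilon> C)))"

definition zcone :: "'m \<Rightarrow> 'm" where
  "zcone n = Sep baire (\<lambda>x. agree n x (cst zero))"

lemma mem_zcone [simp]: "x \<epsilon> zcone n \<longleftrightarrow> x \<epsilon> baire \<and> agree n x (cst zero)"
  unfolding zcone_def by (rule mem_Sep) (intro dfi)

definition cone_at :: "'m \<Rightarrow> 'm \<Rightarrow> 'm" where
  "cone_at n x = Sep baire (\<lambda>y. agree n x y)"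

lemma mem_cone_at [simp]: "y \<epsilon> cone_at n x \<longleftrightarrow> y \<epsilon> baire \<and> agree n x y"
  unfolding cone_at_def by (rule mem_Sep) (intro dfi)

lemma dt_cone_at [dfi]: "dt s \<Longrightarrow> dt t \<Longrightarrow> dt (\<lambda>e. cone_at (s e) (t e))"
  by (rule dt2[of cone_at], unfold cone_at_def, intro dfi)

definition union_seq :: "'m \<Rightarrow> 'm" where
  "union_seq K = Sep baire (\<lambda>x. \<exists>n. n \<epsilon> omega \<and> x \<epsilon> ap K n)"

lemma mem_union_seq [simp]: "x \<epsilon> union_seq K \<longleftrightarrow> x \<epsilon> baire \<and> (\<exists>n. n \<epsilon> omega \<and> x \<epsilon> ap K n)"
  unfolding union_seq_def by (rule mem_Sep) (intro dfi)

lemma dt_union_seq [dfi]: "dt s \<Longrightarrow> dt (\<lambda>e. union_seq (s e))"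
  by (rule dt1[of union_seq], unfold union_seq_def, intro dfi)

definition upd :: "'m \<Rightarrow> 'm \<Rightarrow> 'm \<Rightarrow> 'm" where
  "upd x k n = Lam omega (\<lambda>i. if i = k then n else ap x i)"

lemma ap_upd: "i \<epsilon> omega \<Longrightarrow> ap (upd x k n) i = (if i = k then n else ap x i)"
  unfolding upd_def by (rule ap_Lam) (intro dfi)

lemma upd_maps: "maps x omega Z \<Longrightarrow> n \<epsilon> Z \<Longrightarrow> maps (upd x k n) omega Z"
  unfolding upd_def by (rule Lam_maps) (intro dfi, auto intro: ap_in)

lemma upd_baire: "x \<epsilon> baire \<Longrightarrow> n \<epsilon> omega \<Longrightarrow> upd x k n \<epsilon> baire"
  unfolding mem_baire by (rule upd_maps)

lemma dt_upd [dfi]: "dt s \<Longrightarrow> dt t \<Longrightarrow> dt u \<Longrightarrow> dt (\<lambda>e. upd (s e) (t e) (u e))"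
proof -
  assume a: "dt s" "dt t" "dt u"
  have "dt (\<lambda>e. Lam omega (\<lambda>i. if i = t e then u e else ap (s e) i))"
    by (intro dfi dt_ren[OF a(1)] dt_ren[OF a(2)] dt_ren[OF a(3)])
  then show ?thesis unfolding upd_def .
qed

lemma agree_upd: "k \<epsilon> omega \<Longrightarrow> agree k x (upd x k n)"
  unfolding agree_def using mem_omegaD not_mem_self ap_upd by metis

lemma agree_succ_upd: "k \<epsilon> omega \<Longrightarrow> agree k x x' \<Longrightarrow> agree (succ k) (upd x k (ap x' k)) x'"
  unfolding agree_def using mem_omegaD ap_upd by auto

definition two_seq :: "'m \<Rightarrow> 'm \<Rightarrow> 'm" where
  "two_seq a b = Lam omega (\<lambda>i. if i = zero then a else b)"

lemma ap_two_seq: "i \<epsilon> omega \<Longrightarrow> ap (two_seq a b) i = (if i = zero then a else b)"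
  unfolding two_seq_def by (rule ap_Lam) (intro dfi)

lemma two_seq_maps: "a \<epsilon> Z \<Longrightarrow> b \<epsilon> Z \<Longrightarrow> maps (two_seq a b) omega Z"
  unfolding two_seq_def by (rule Lam_maps) (intro dfi, simp)

lemma Uni_succ: "n \<epsilon> omega \<Longrightarrow> Uni (succ n) = n"
  by (rule set_ext) (auto dest: omega_trans)

text \<open>A substitute for choosing codes: elements of a coded set have names among the reals, so
  dependent choice on the reals can select from it.\<close>

definition coded :: "'m \<Rightarrow> bool" where
  "coded Z \<longleftrightarrow> (\<exists>g. \<forall>z. z \<epsilon> Z \<longrightarrow> (\<exists>x. x \<epsilon> baire \<and> ap g x = z))"

lemma coded_subs: "coded Z \<Longrightarrow> Y \<sqsubseteq> Z \<Longrightarrow> coded Y"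
  unfolding coded_def subs_def by blast

lemma codedI:
  assumes "dt (\<lambda>e. g (e 0))" "\<And>z. z \<epsilon> Z \<Longrightarrow> \<exists>x. x \<epsilon> baire \<and> g x = z" shows "coded Z"
  unfolding coded_def by (rule exI[of _ "Lam baire g"]) (use assms(2) ap_Lam[OF assms(1)] in fastforce)

lemma coded_baire: "coded baire"
  by (rule codedI[of "\<lambda>x. x"]) (intro dfi, simp)

lemma coded_omega: "coded omega"
proof (rule codedI[of "\<lambda>x. ap x zero"])
  fix z assume "z \<epsilon> omega"
  then show "\<exists>x. x \<epsilon> baire \<and> ap x zero = z" by (intro exI[of _ "cst z"]) simp
qed (intro dfi)

end

text \<open>The hypotheses on the reductions in terms of total application and agreement;
  \<open>reds_locale\<close> derives them from the given definitions.\<close>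

locale reds = ZF_model mem for mem :: "'m \<Rightarrow> 'm \<Rightarrow> bool" (infix "\<epsilon>" 50) +
  fixes F :: 'm
  assumes F_maps: "f \<epsilon> F \<Longrightarrow> maps f baire baire"
    and F_comp: "f \<epsilon> F \<Longrightarrow> g \<epsilon> F \<Longrightarrow> cmps f g \<epsilon> F"
    and lips_F: "lips u \<Longrightarrow> u \<epsilon> F"
    and F_surj: "\<exists>s. maps s baire F \<and> (\<forall>f. f \<epsilon> F \<longrightarrow> (\<exists>x. x \<epsilon> baire \<and> ap s x = f))"
    and DC: "(\<And>x. x \<epsilon> baire \<Longrightarrow> \<exists>y. y \<epsilon> baire \<and> pair x y \<epsilon> S) \<Longrightarrow>
      \<exists>h. maps h omega baire \<and> (\<forall>n. n \<epsilon> omega \<longrightarrow> pair (ap h n) (ap h (succ n)) \<epsilon> S)"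
    and SLO: "A \<sqsubseteq> baire \<Longrightarrow> B \<sqsubseteq> baire \<Longrightarrow> lle A B \<or> lle (cpl B) A"
begin

definition L :: 'm where "L = Sep (pow baire) (\<lambda>X. \<exists>f. f \<epsilon> F \<and> X = pre f cone0)"

lemma mem_L: "X \<epsilon> L \<longleftrightarrow> (\<exists>f. f \<epsilon> F \<and> X = pre f cone0)"
proof -
  have "df (\<lambda>e. \<exists>f. f \<epsilon> F \<and> e 0 = pre f cone0)" by (intro dfi)
  from mem_Sep[OF this] show ?thesis unfolding L_def by auto
qed

lemma L_subs: "X \<epsilon> L \<Longrightarrow> X \<sqsubseteq> baire" unfolding mem_L by auto

definition srj :: 'm where
  "srj = (SOME s. maps s baire F \<and> (\<forall>f. f \<epsilon> F \<longrightarrow> (\<exists>x. x \<epsilon> baire \<and> ap s x = f)))"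

lemma srj: "maps srj baire F" "f \<epsilon> F \<Longrightarrow> \<exists>x. x \<epsilon> baire \<and> ap srj x = f"
  using someI_ex[OF F_surj] unfolding srj_def by blast+

text \<open>A sequence of reals is a Lipschitz map via \<open>code\<close>, Lipschitz maps are in
  \<open>F\<close>, and \<open>srj\<close> enumerates \<open>F\<close> by reals. So every real codes
  a sequence of reals, and every sequence has a code, without arithmetic on digits.\<close>

definition dec :: "'m \<Rightarrow> 'm \<Rightarrow> 'm" where "dec x i = ap (ap srj x) (cst i)"

lemma dt_dec [dfi]: "dt s \<Longrightarrow> dt t \<Longrightarrow> dt (\<lambda>e. dec (s e) (t e))"
  by (rule dt2[of dec], unfold dec_def, intro dfi)

lemma dec_baire: "x \<epsilon> baire \<Longrightarrow> i \<epsilon> omega \<Longrightarrow> dec x i \<epsilon> baire"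
  unfolding dec_def by (rule ap_in[OF F_maps[OF ap_in[OF srj(1)]]]) simp_all

lemma dec_ex:
  assumes y: "maps y omega baire"
  obtains x where "x \<epsilon> baire" "\<And>i. i \<epsilon> omega \<Longrightarrow> dec x i = ap y i"
proof -
  obtain x where x: "x \<epsilon> baire" "ap srj x = code y"
    using srj(2)[OF lips_F[OF code_lips[OF y]]] by blast
  show thesis by (rule that[OF x(1)]) (simp add: dec_def x(2) code_ap)
qed

definition one :: 'm where "one = succ zero"
lemma one_omega [simp]: "one \<epsilon> omega" by (simp add: one_def succ_omega)
lemma one_not_zero [simp]: "one \<noteq> zero" "zero \<noteq> one" unfolding one_def using succ_not_zero by metis+

lemma dec_pair_ex:
  assumes "a \<epsilon> baire" "b \<epsilon> baire"
  obtains x where "x \<epsilon> baire" "dec x zero = a" "dec x one = b"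
proof -
  obtain x where "x \<epsilon> baire" "\<And>i. i \<epsilon> omega \<Longrightarrow> dec x i = ap (two_seq a b) i"
    using dec_ex[OF two_seq_maps[OF assms]] by blast
  then show thesis by (intro that[of x]) (simp_all add: ap_two_seq)
qed

lemma coded_F: "coded F" unfolding coded_def using srj(2) by blast

lemma coded_prd: "coded Z \<Longrightarrow> coded W \<Longrightarrow> coded (prd Z W)"
proof -
  assume "coded Z" "coded W"
  then obtain g h where g: "\<forall>z. z \<epsilon> Z \<longrightarrow> (\<exists>x. x \<epsilon> baire \<and> ap g x = z)"
    and h: "\<forall>z. z \<epsilon> W \<longrightarrow> (\<exists>x. x \<epsilon> baire \<and> ap h x = z)" unfolding coded_def by blast
  show ?thesis
  proof (rule codedI[of "\<lambda>x. pair (ap g (dec x zero)) (ap h (dec x one))"])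
    fix p assume "p \<epsilon> prd Z W"
    then obtain z w where p: "z \<epsilon> Z" "w \<epsilon> W" "p = pair z w" by (rule prdE)
    obtain a where a: "a \<epsilon> baire" "ap g a = z" using g p by blast
    obtain b where b: "b \<epsilon> baire" "ap h b = w" using h p by blast
    obtain x where "x \<epsilon> baire" "dec x zero = a" "dec x one = b" using dec_pair_ex[OF a(1) b(1)] .
    then show "\<exists>x. x \<epsilon> baire \<and> pair (ap g (dec x zero)) (ap h (dec x one)) = p"
      using a b p by auto
  qed (intro dfi)
qed

lemma coded_L: "coded L"
proof (rule codedI[of "\<lambda>x. pre (ap srj x) cone0"])
  fix z assume "z \<epsilon> L"
  then obtain f where f: "f \<epsilon> F" "z = pre f cone0" unfolding mem_L by blast
  obtain x where "x \<epsilon> baire" "ap srj x = f" using srj(2)[OF f(1)] by blast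
  then show "\<exists>x. x \<epsilon> baire \<and> pre (ap srj x) cone0 = z" using f by auto
qed (intro dfi)

text \<open>Only countably many stages are reached from the initial state, each of which is an image of
  the reals without any choice.  A start that begins no chain would pass this defect on to all of its
  successors, so dependent choice on the reals excludes it.\<close>

lemma dep_choice:
  assumes t: "dt (\<lambda>e. t (e 0) (e (Suc 0)))" and R: "df (\<lambda>e. R (e 0) (e (Suc 0)))"
    and x0: "x0 \<epsilon> X" and K: "coded K"
    and tot: "\<And>x. x \<epsilon> X \<Longrightarrow> \<exists>c. c \<epsilon> K \<and> t x c \<epsilon> X \<and> R x (t x c)"
  shows "\<exists>h. maps h omega X \<and> ap h zero = x0 \<and> (\<forall>n. n \<epsilon> omega \<longrightarrow> R (ap h n) (ap h (succ n)))"
proof (rule ccontr)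
  note t' = dt2[OF t] and R' = df2[OF R]
  define bad where "bad x \<longleftrightarrow> \<not> (\<exists>h. maps h omega X \<and> ap h zero = x \<and>
    (\<forall>n. n \<epsilon> omega \<longrightarrow> R (ap h n) (ap h (succ n))))" for x
  have bad_df: "df (\<lambda>e. bad (s e))" if "dt s" for s
    by (rule df1[of bad, OF _ that]) (unfold bad_def, intro dfi R')
  assume "\<not> ?thesis"
  then have bad0: "bad x0" unfolding bad_def .
  obtain g where g: "\<forall>z. z \<epsilon> K \<longrightarrow> (\<exists>x. x \<epsilon> baire \<and> ap g x = z)" using K unfolding coded_def by blast
  \<comment> \<open>The real \<open>a\<close> names a state of the previous stage and a choice.
    Illegal transitions fall back to \<open>x0\<close>, which keeps each stage a total function from
    the reals to \<open>X\<close>.\<close>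
  define nx where "nx s a = (if ap g (dec a one) \<epsilon> K \<and> t (ap s (dec a zero)) (ap g (dec a one)) \<epsilon> X
    then t (ap s (dec a zero)) (ap g (dec a one)) else x0)" for s a
  have nx_dt: "dt (\<lambda>e. nx (u e) (v e))" if "dt u" "dt v" for u v
    by (rule dt2[of nx, OF _ that]) (unfold nx_def, intro dfi t')
  define step where "step s = Lam baire (\<lambda>a. nx s a)" for s
  have step_dt: "dt (\<lambda>e. step (e 0))" unfolding step_def by (intro dfi nx_dt)
  have nx_dt1: "dt (\<lambda>e. nx s (e 0))" for s by (intro nx_dt dfi)
  have ap_step: "ap (step s) a = nx s a" if "a \<epsilon> baire" for s a
    unfolding step_def by (rule ap_Lam[OF nx_dt1 that])
  have step_X: "step s \<epsilon> funs baire X" for s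
    unfolding step_def mem_funs by (rule Lam_maps[OF nx_dt1]) (simp add: nx_def x0)
  define s0 where "s0 = Lam baire (\<lambda>_. x0)"
  have "s0 \<epsilon> funs baire X" unfolding s0_def mem_funs by (rule Lam_maps) (intro dfi, rule x0)
  from omega_rec[OF step_dt this step_X] obtain S where S: "maps S omega (funs baire X)"
    "ap S zero = s0" "\<forall>n. n \<epsilon> omega \<longrightarrow> ap S (succ n) = step (ap S n)" by blast
  have s0: "ap s0 a = x0" if "a \<epsilon> baire" for a
    unfolding s0_def by (rule ap_Lam[OF _ that]) (intro dfi)
  \<comment> \<open>A reachable state is named by the number of its stage, kept as the first digit
    of \<open>dec a zero\<close>, and by an argument of the enumeration of that stage.\<close>
  define sg where "sg a = ap (ap S (ap (dec a zero) zero)) (dec a one)" for a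
  have sg_dt: "dt (\<lambda>e. sg (u e))" if "dt u" for u
    unfolding sg_def by (intro dfi that)
  have sgX: "sg a \<epsilon> X" if a: "a \<epsilon> baire" for a
  proof -
    have "ap (dec a zero) zero \<epsilon> omega" using a dec_baire baire_ap by simp
    then have "ap S (ap (dec a zero) zero) \<epsilon> funs baire X" using ap_in[OF S(1)] by blast
    then show ?thesis unfolding sg_def using ap_in dec_baire[OF a] by simp
  qed
  obtain a0 where a0: "a0 \<epsilon> baire" "sg a0 = x0"
  proof -
    obtain a where a: "a \<epsilon> baire" "dec a zero = cst zero" "dec a one = cst zero"
      using dec_pair_ex[of "cst zero" "cst zero"] by auto
    show thesis by (rule that[OF a(1)]) (simp add: sg_def a S s0)
  qed
  have reach: "\<exists>b. b \<epsilon> baire \<and> sg b = t (sg a) c" if ac: "a \<epsilon> baire" "c \<epsilon> K" "t (sg a) c \<epsilon> X" for a c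
  proof -
    obtain d where d: "d \<epsilon> baire" "ap g d = c" using g ac by blast
    let ?n = "ap (dec a zero) zero"
    have n: "?n \<epsilon> omega" using ac dec_baire baire_ap by simp
    obtain a' where a': "a' \<epsilon> baire" "dec a' zero = dec a one" "dec a' one = d"
      using dec_pair_ex[OF dec_baire[OF ac(1) one_omega] d(1)] by blast
    obtain b where b: "b \<epsilon> baire" "dec b zero = cst (succ ?n)" "dec b one = a'"
      using dec_pair_ex[OF cst_baire[OF succ_omega[OF n]] a'(1)] by blast
    have "sg b = nx (ap S ?n) a'"
      unfolding sg_def b(2,3) using S(3) n ap_step[OF a'(1)] by simp
    also have "\<dots> = t (sg a) c" unfolding nx_def a'(2,3) d(2) using ac(2,3) by (simp add: sg_def)
    finally show ?thesis using b(1) by blast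
  qed
  \<comment> \<open>Replacing the states that do begin a chain by the bad state \<open>x0\<close>
    makes every real name a bad state, so that the relation \<open>T\<close> is total on all reals,
    as dependent choice demands.\<close>
  define sb where "sb a = (if bad (sg a) then sg a else x0)" for a
  have sb_dt: "dt (\<lambda>e. sb (u e))" if "dt u" for u
    unfolding sb_def by (intro dfi bad_df sg_dt that)
  have sb_bad: "bad (sb a)" for a using bad0 by (simp add: sb_def)
  have sbX: "sb a \<epsilon> X" if "a \<epsilon> baire" for a using sgX[OF that] x0 by (simp add: sb_def)
  have prep: "bad y" if x: "bad x" "x \<epsilon> X" and xy: "R x y" for x y
  proof (rule ccontr)
    assume "\<not> bad y"
    then obtain h where h: "maps h omega X" "ap h zero = y"
      "\<forall>n. n \<epsilon> omega \<longrightarrow> R (ap h n) (ap h (succ n))" unfolding bad_def by blast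
    define k where "k = Lam omega (\<lambda>n. if n = zero then x else ap h (Uni n))"
    have k: "ap k n = (if n = zero then x else ap h (Uni n))" if "n \<epsilon> omega" for n
      unfolding k_def by (rule ap_Lam[OF _ that]) (intro dfi)
    have "maps k omega X" unfolding k_def
    proof (rule Lam_maps)
      show "dt (\<lambda>e. if e 0 = zero then x else ap h (Uni (e 0)))" by (intro dfi)
      fix n assume "n \<epsilon> omega"
      from omega_cases[OF this] show "(if n = zero then x else ap h (Uni n)) \<epsilon> X"
        using x(2) ap_in[OF h(1)] Uni_succ by auto
    qed
    moreover have "ap k zero = x" using k by simp
    moreover have "R (ap k n) (ap k (succ n))" if n: "n \<epsilon> omega" for n
    proof -
      have "ap k (succ n) = ap h n" using k[OF succ_omega[OF n]] Uni_succ[OF n] by simp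
      moreover from omega_cases[OF n] have "R (ap k n) (ap h n)"
      proof (elim disjE exE conjE)
        assume "n = zero" then show ?thesis using k[of zero] h(2) xy by simp
      next
        fix m assume "m \<epsilon> omega" "n = succ m"
        then show ?thesis using k[OF n] Uni_succ h(3) by simp
      qed
      ultimately show ?thesis by simp
    qed
    ultimately show False using x(1) unfolding bad_def by blast
  qed
  define T where "T = Sep (prd baire baire) (\<lambda>p. R (sb (pfst p)) (sb (psnd p)))"
  have T: "pair a b \<epsilon> T \<longleftrightarrow> a \<epsilon> baire \<and> b \<epsilon> baire \<and> R (sb a) (sb b)" for a b
  proof -
    have "df (\<lambda>e. R (sb (pfst (e 0))) (sb (psnd (e 0))))" by (intro R' sb_dt dfi)
    from mem_Sep[OF this] show ?thesis unfolding T_def by simp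
  qed
  have "\<exists>b. b \<epsilon> baire \<and> pair a b \<epsilon> T" if a: "a \<epsilon> baire" for a
  proof -
    obtain c where c: "c \<epsilon> K" "t (sb a) c \<epsilon> X" "R (sb a) (t (sb a) c)" using tot[OF sbX[OF a]] by blast
    obtain a' where a': "a' \<epsilon> baire" "sg a' = sb a" using a a0 unfolding sb_def by (cases "bad (sg a)") auto
    obtain b where b: "b \<epsilon> baire" "sg b = t (sb a) c" using reach[OF a'(1) c(1)] c(2) a' by auto
    have "bad (sg b)" unfolding b(2) by (rule prep[OF sb_bad sbX[OF a] c(3)])
    then have "sb b = t (sb a) c" using b by (simp add: sb_def)
    then show ?thesis unfolding T using a b(1) c(3) by auto
  qed
  from DC[OF this] obtain h where h: "maps h omega baire"
    "\<forall>n. n \<epsilon> omega \<longrightarrow> pair (ap h n) (ap h (succ n)) \<epsilon> T" by blast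
  define k where "k = Lam omega (\<lambda>n. sb (ap h n))"
  have kd: "dt (\<lambda>e. sb (ap h (e 0)))" by (intro sb_dt dfi)
  have k: "ap k n = sb (ap h n)" if "n \<epsilon> omega" for n
    unfolding k_def by (rule ap_Lam[OF kd that])
  have "maps k omega X" unfolding k_def by (rule Lam_maps[OF kd]) (rule sbX, rule ap_in[OF h(1)])
  moreover have "R (ap k n) (ap k (succ n))" if "n \<epsilon> omega" for n
    using h(2) that k succ_omega T by simp
  \<comment> \<open>Dependent choice gives no control over the start of the chain, but a chain of
    bad states is contradictory wherever it starts.\<close>
  ultimately have "\<not> bad (ap k zero)" unfolding bad_def by blast
  then show False using k[of zero] sb_bad by simp
qed

text \<open>The states are pairs of an index and an admissible choice for it, and the index is
  forced to grow by one, so the chain passes through every index.\<close>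

lemma countable_choice:
  assumes P: "df (\<lambda>e. P (e 0) (e (Suc 0)))" and K: "coded K"
    and ex: "\<And>n. n \<epsilon> omega \<Longrightarrow> \<exists>c. c \<epsilon> K \<and> P n c"
  shows "\<exists>h. maps h omega K \<and> (\<forall>n. n \<epsilon> omega \<longrightarrow> P n (ap h n))"
proof -
  note P' = df2[OF P]
  define X where "X = Sep (prd omega K) (\<lambda>p. P (pfst p) (psnd p))"
  have X: "p \<epsilon> X \<longleftrightarrow> p \<epsilon> prd omega K \<and> P (pfst p) (psnd p)" for p
    unfolding X_def by (rule mem_Sep) (intro P' dfi)
  obtain c0 where c0: "c0 \<epsilon> K" "P zero c0" using ex[of zero] by auto
  have "\<exists>h. maps h omega X \<and> ap h zero = pair zero c0 \<and>
      (\<forall>n. n \<epsilon> omega \<longrightarrow> (\<lambda>p q. pfst q = succ (pfst p)) (ap h n) (ap h (succ n)))"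
  proof (rule dep_choice[of "\<lambda>p c. pair (succ (pfst p)) c", OF _ _ _ K])
    fix p assume "p \<epsilon> X"
    then have "p \<epsilon> prd omega K" unfolding X by simp
    then obtain n d where n: "n \<epsilon> omega" "p = pair n d" by (rule prdE)
    obtain c where "c \<epsilon> K" "P (succ n) c" using ex[OF succ_omega[OF n(1)]] by blast
    then show "\<exists>c. c \<epsilon> K \<and> pair (succ (pfst p)) c \<epsilon> X \<and> pfst (pair (succ (pfst p)) c) = succ (pfst p)"
      using n succ_omega by (intro exI[of _ c]) (simp add: X)
  qed (intro dfi, intro dfi, simp add: X c0)
  then obtain h where h: "maps h omega X" "ap h zero = pair zero c0"
    "\<forall>n. n \<epsilon> omega \<longrightarrow> pfst (ap h (succ n)) = succ (pfst (ap h n))" by blast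
  have n: "pfst (ap h n) = n" if "n \<epsilon> omega" for n using that
  proof (induction n rule: omega_induct)
    case df show ?case by (intro dfi)
  qed (simp_all add: h)
  define k where "k = Lam omega (\<lambda>n. psnd (ap h n))"
  have kd: "dt (\<lambda>e. psnd (ap h (e 0)))" by (intro dfi)
  have k: "ap k n = psnd (ap h n)" if "n \<epsilon> omega" for n
    unfolding k_def by (rule ap_Lam[OF kd that])
  have hX: "psnd (ap h n) \<epsilon> K \<and> P n (psnd (ap h n))" if m: "n \<epsilon> omega" for n
  proof -
    have x: "ap h n \<epsilon> prd omega K" "P (pfst (ap h n)) (psnd (ap h n))" using ap_in[OF h(1) m] unfolding X by auto
    from x(1) show ?thesis by (rule prdE) (use x(2) n[OF m] in simp)
  qed
  have "maps k omega K" unfolding k_def by (rule Lam_maps[OF kd]) (use hX in simp)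
  then show ?thesis using k hX by (intro exI[of _ k]) simp
qed

text \<open>Countable choice picks a code for each value, and \<open>dec_ex\<close> packs these
  codes into one real.\<close>

lemma coded_funs: "coded Z \<Longrightarrow> coded (funs omega Z)"
proof -
  assume "coded Z"
  then obtain g where g: "\<forall>z. z \<epsilon> Z \<longrightarrow> (\<exists>x. x \<epsilon> baire \<and> ap g x = z)" unfolding coded_def by blast
  have d: "dt (\<lambda>e. ap g (dec x (e 0)))" for x by (intro dfi)
  show ?thesis
  proof (rule codedI[of "\<lambda>x. Lam omega (\<lambda>i. ap g (dec x i))"])
    fix z assume "z \<epsilon> funs omega Z"
    then have z: "maps z omega Z" by simp
    have "\<exists>c. maps c omega baire \<and> (\<forall>n. n \<epsilon> omega \<longrightarrow> (\<lambda>n c. ap g c = ap z n) n (ap c n))"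
    proof (rule countable_choice[OF _ coded_baire])
      show "\<exists>c. c \<epsilon> baire \<and> ap g c = ap z n" if "n \<epsilon> omega" for n using g ap_in[OF z that] by blast
    qed (intro dfi)
    then obtain c where c: "maps c omega baire" "\<forall>n. n \<epsilon> omega \<longrightarrow> ap g (ap c n) = ap z n" by blast
    obtain x where x: "x \<epsilon> baire" "\<And>i. i \<epsilon> omega \<Longrightarrow> dec x i = ap c i" using dec_ex[OF c(1)] by blast
    have "Lam omega (\<lambda>i. ap g (dec x i)) = z"
    proof (rule maps_ext[OF _ z])
      show "maps (Lam omega (\<lambda>i. ap g (dec x i))) omega Z"
        by (rule Lam_maps[OF d]) (use x c z ap_in in simp)
    qed (simp add: ap_Lam[OF d] x c)
    then show "\<exists>x. x \<epsilon> baire \<and> Lam omega (\<lambda>i. ap g (dec x i)) = z" using x by blast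
  qed (intro dfi)
qed

end

section \<open>Separation of analytic sets\<close>

context ZF_model
begin

lemma lim_seq:
  assumes s: "maps s omega baire" and a: "\<And>n. n \<epsilon> omega \<Longrightarrow> agree n (ap s n) (ap s (succ n))"
  shows "\<exists>l. l \<epsilon> baire \<and> (\<forall>n. n \<epsilon> omega \<longrightarrow> agree n (ap s n) l)"
proof -
  define l where "l = Lam omega (\<lambda>i. ap (ap s (succ i)) i)"
  have d: "dt (\<lambda>e. ap (ap s (succ (e 0))) (e 0))" by (intro dfi)
  have l: "ap l i = ap (ap s (succ i)) i" if "i \<epsilon> omega" for i
    unfolding l_def by (rule ap_Lam[OF d that])
  have "l \<epsilon> baire" unfolding mem_baire l_def
    by (rule Lam_maps[OF d]) (intro baire_ap ap_in[OF s] succ_omega)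
  moreover have "agree n (ap s n) l" if "n \<epsilon> omega" for n using that
  proof (induction n rule: omega_induct)
    case df show ?case by (intro dfi)
  next
    case (succ n)
    show ?case unfolding agree_def
    proof (intro allI impI)
      fix m assume m: "m \<epsilon> succ n"
      show "ap (ap s (succ n)) m = ap l m"
      proof (cases "m = n")
        case True then show ?thesis using l succ(1) by simp
      next
        case False
        then have "m \<epsilon> n" using m by simp
        then show ?thesis using succ(2) a[OF succ(1)] unfolding agree_def by simp
      qed
    qed
  qed simp
  ultimately show ?thesis by blast
qed

end

context reds
begin

text \<open>If no set in \<open>C\<close> separates, then inseparability persists along some
  extension by one digit, and dependent choice follows it to a branch. By closedness the branch lies
  in both closed sets. Their first coordinate is shared throughout, so one real ends up in
  \<open>B\<close> and in its complement. \<open>C \<sqsubseteq> L\<close> makes the separators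
  coded, so that countably many can be chosen at once.\<close>

lemma luzin:
  assumes CL: "C \<sqsubseteq> L" and cone: "\<And>x n. x \<epsilon> baire \<Longrightarrow> n \<epsilon> omega \<Longrightarrow> cone_at n x \<epsilon> C"
    and Ccpl: "\<And>X. X \<epsilon> C \<Longrightarrow> cpl X \<epsilon> C" and Ccap: "\<And>X Y. X \<epsilon> C \<Longrightarrow> Y \<epsilon> C \<Longrightarrow> cap X Y \<epsilon> C"
    and Cun: "\<And>K. maps K omega C \<Longrightarrow> union_seq K \<epsilon> C"
    and B: "B \<sqsubseteq> baire" "sig B" "sig (cpl B)"
  shows "B \<epsilon> C"
proof -
  obtain C0 where C0: "\<And>x y. x \<epsilon> baire \<Longrightarrow> y \<epsilon> baire \<Longrightarrow> \<not> pair x y \<epsilon> C0 \<Longrightarrow>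
      \<exists>k. k \<epsilon> omega \<and> (\<forall>x' y'. x' \<epsilon> baire \<and> y' \<epsilon> baire \<and> agree k x x' \<and> agree k y y' \<longrightarrow> \<not> pair x' y' \<epsilon> C0)"
    "\<And>x. x \<epsilon> B \<longleftrightarrow> x \<epsilon> baire \<and> (\<exists>y. y \<epsilon> baire \<and> pair x y \<epsilon> C0)"
    using B(2) unfolding sig_def by blast
  obtain C1 where C1: "\<And>x y. x \<epsilon> baire \<Longrightarrow> y \<epsilon> baire \<Longrightarrow> \<not> pair x y \<epsilon> C1 \<Longrightarrow>
      \<exists>k. k \<epsilon> omega \<and> (\<forall>x' y'. x' \<epsilon> baire \<and> y' \<epsilon> baire \<and> agree k x x' \<and> agree k y y' \<longrightarrow> \<not> pair x' y' \<epsilon> C1)"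
    "\<And>x. x \<epsilon> cpl B \<longleftrightarrow> x \<epsilon> baire \<and> (\<exists>y. y \<epsilon> baire \<and> pair x y \<epsilon> C1)"
    using B(3) unfolding sig_def by blast
  have codC: "coded C" using coded_subs[OF coded_L CL] .
  have CB: "baire \<epsilon> C"
  proof -
    have "cone_at zero (cst zero) = baire" by (rule set_ext) auto
    then show ?thesis using cone[of "cst zero" zero] by simp
  qed
  have Cemp: "emp \<epsilon> C"
  proof -
    have "cpl baire = emp" by (rule set_ext) auto
    then show ?thesis using Ccpl[OF CB] by simp
  qed
  \<comment> \<open>The three depths are independent so that one coordinate can be lengthened at a
    time.\<close>
  define Sb where "Sb k x i y j z S \<longleftrightarrow> (\<forall>x'. x' \<epsilon> baire \<and> agree k x x' \<longrightarrow>
      (\<forall>w. w \<epsilon> baire \<and> agree i y w \<and> pair x' w \<epsilon> C0 \<longrightarrow> x' \<epsilon> S) \<and>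
      (\<forall>w. w \<epsilon> baire \<and> agree j z w \<and> pair x' w \<epsilon> C1 \<longrightarrow> \<not> x' \<epsilon> S))" for k x i y j z S
  define Sp where "Sp k x i y j z \<longleftrightarrow> (\<exists>S. S \<epsilon> C \<and> Sb k x i y j z S)" for k x i y j z
  have extx: "Sp k x i y j z" if k: "k \<epsilon> omega" and all: "\<And>n. n \<epsilon> omega \<Longrightarrow> Sp (succ k) (upd x k n) i y j z"
    for k x i y j z
  proof -
    have "\<exists>h. maps h omega C \<and> (\<forall>n. n \<epsilon> omega \<longrightarrow> (\<lambda>n S. Sb (succ k) (upd x k n) i y j z S) n (ap h n))"
      by (rule countable_choice[OF _ codC]) (unfold Sb_def, intro dfi, use all in \<open>simp add: Sp_def Sb_def\<close>)
    then obtain h where h: "maps h omega C" "\<And>n. n \<epsilon> omega \<Longrightarrow> Sb (succ k) (upd x k n) i y j z (ap h n)" by blast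
    \<comment> \<open>The separator for the digit \<open>n\<close> is reliable only where the next
      digit is \<open>n\<close>, so it is cut down to that cone before the union is taken.\<close>
    define K where "K = Lam omega (\<lambda>n. cap (cone_at (succ k) (upd x k n)) (ap h n))"
    have d: "dt (\<lambda>e. cap (cone_at (succ k) (upd x k (e 0))) (ap h (e 0)))" by (intro dfi)
    have apK: "ap K n = cap (cone_at (succ k) (upd x k n)) (ap h n)" if "n \<epsilon> omega" for n
      unfolding K_def by (rule ap_Lam[OF d that])
    have KC: "maps K omega C"
      unfolding K_def
    proof (rule Lam_maps[OF d])
      fix n assume n: "n \<epsilon> omega"
      \<comment> \<open>Here \<open>x\<close> is not assumed to be a real. Either some real lies in
        the cone and can be taken as its centre, or the piece is empty.\<close>
      show "cap (cone_at (succ k) (upd x k n)) (ap h n) \<epsilon> C"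
      proof (cases "\<exists>y. y \<epsilon> baire \<and> agree (succ k) (upd x k n) y")
        case True
        then obtain y where "y \<epsilon> baire" "agree (succ k) (upd x k n) y" by blast
        then have "cone_at (succ k) (upd x k n) = cone_at (succ k) y"
          by (intro set_ext) (auto intro: agree_trans agree_sym)
        then show ?thesis using Ccap cone[OF \<open>y \<epsilon> baire\<close> succ_omega[OF k]] ap_in[OF h(1) n] by simp
      next
        case False
        then have "cap (cone_at (succ k) (upd x k n)) (ap h n) = emp" by (intro set_ext) auto
        then show ?thesis using Cemp by simp
      qed
    qed
    have "Sb k x i y j z (union_seq K)" unfolding Sb_def
    proof (intro allI impI conjI)
      fix x' w assume x': "x' \<epsilon> baire \<and> agree k x x'" and w: "w \<epsilon> baire \<and> agree i y w \<and> pair x' w \<epsilon> C0"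
      let ?n = "ap x' k"
      have n: "?n \<epsilon> omega" using x' k baire_ap by blast
      have ag: "agree (succ k) (upd x k ?n) x'" using agree_succ_upd[OF k] x' by blast
      then have "x' \<epsilon> ap h ?n" using h(2)[OF n] x' w unfolding Sb_def by blast
      then show "x' \<epsilon> union_seq K" using x' n ag apK[OF n] by auto
    next
      fix x' w assume x': "x' \<epsilon> baire \<and> agree k x x'" and w: "w \<epsilon> baire \<and> agree j z w \<and> pair x' w \<epsilon> C1"
      show "\<not> x' \<epsilon> union_seq K"
      proof
        assume "x' \<epsilon> union_seq K"
        then obtain n where n: "n \<epsilon> omega" "x' \<epsilon> ap K n" by auto
        then have "agree (succ k) (upd x k n) x'" "x' \<epsilon> ap h n" using apK[OF n(1)] by auto
        then show False using h(2)[OF n(1)] x' w unfolding Sb_def by blast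
      qed
    qed
    then show ?thesis unfolding Sp_def using Cun[OF KC] by blast
  qed
  have exty: "Sp k x i y j z" if i: "i \<epsilon> omega" and all: "\<And>n. n \<epsilon> omega \<Longrightarrow> Sp k x (succ i) (upd y i n) j z"
    for k x i y j z
  proof -
    have "\<exists>h. maps h omega C \<and> (\<forall>n. n \<epsilon> omega \<longrightarrow> (\<lambda>n S. Sb k x (succ i) (upd y i n) j z S) n (ap h n))"
      by (rule countable_choice[OF _ codC]) (unfold Sb_def, intro dfi, use all in \<open>simp add: Sp_def Sb_def\<close>)
    then obtain h where h: "maps h omega C" "\<And>n. n \<epsilon> omega \<Longrightarrow> Sb k x (succ i) (upd y i n) j z (ap h n)" by blast
    have "Sb k x i y j z (union_seq h)" unfolding Sb_def
    proof (intro allI impI conjI)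
      fix x' w assume x': "x' \<epsilon> baire \<and> agree k x x'" and w: "w \<epsilon> baire \<and> agree i y w \<and> pair x' w \<epsilon> C0"
      let ?n = "ap w i"
      have n: "?n \<epsilon> omega" using w i baire_ap by blast
      have ag: "agree (succ i) (upd y i ?n) w" using agree_succ_upd[OF i] w by blast
      then have "x' \<epsilon> ap h ?n" using h(2)[OF n] x' w unfolding Sb_def by blast
      then show "x' \<epsilon> union_seq h" using x' n by auto
    next
      fix x' w assume x': "x' \<epsilon> baire \<and> agree k x x'" and w: "w \<epsilon> baire \<and> agree j z w \<and> pair x' w \<epsilon> C1"
      show "\<not> x' \<epsilon> union_seq h"
        using h(2) x' w unfolding Sb_def mem_union_seq by blast
    qed
    then show ?thesis unfolding Sp_def using Cun[OF h(1)] by blast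
  qed
  have extz: "Sp k x i y j z" if i: "j \<epsilon> omega" and all: "\<And>n. n \<epsilon> omega \<Longrightarrow> Sp k x i y (succ j) (upd z j n)"
    for k x i y j z
  proof -
    have "\<exists>h. maps h omega C \<and> (\<forall>n. n \<epsilon> omega \<longrightarrow> (\<lambda>n S. Sb k x i y (succ j) (upd z j n) S) n (ap h n))"
      by (rule countable_choice[OF _ codC]) (unfold Sb_def, intro dfi, use all in \<open>simp add: Sp_def Sb_def\<close>)
    then obtain h where h: "maps h omega C" "\<And>n. n \<epsilon> omega \<Longrightarrow> Sb k x i y (succ j) (upd z j n) (ap h n)" by blast
    \<comment> \<open>Lengthening on the \<open>C1\<close> side calls for the intersection of the
      separators: it is the complement of the union of their complements.\<close>
    define K where "K = Lam omega (\<lambda>n. cpl (ap h n))"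
    have d: "dt (\<lambda>e. cpl (ap h (e 0)))" by (intro dfi)
    have apK: "ap K n = cpl (ap h n)" if "n \<epsilon> omega" for n unfolding K_def by (rule ap_Lam[OF d that])
    have KC: "maps K omega C" unfolding K_def by (rule Lam_maps[OF d]) (intro Ccpl ap_in[OF h(1)])
    have mem: "x' \<epsilon> cpl (union_seq K) \<longleftrightarrow> x' \<epsilon> baire \<and> (\<forall>n. n \<epsilon> omega \<longrightarrow> x' \<epsilon> ap h n)" for x'
      using apK by auto
    have "Sb k x i y j z (cpl (union_seq K))" unfolding Sb_def
    proof (intro allI impI conjI)
      fix x' w assume x': "x' \<epsilon> baire \<and> agree k x x'" and w: "w \<epsilon> baire \<and> agree j z w \<and> pair x' w \<epsilon> C1"
      let ?n = "ap w j"
      have n: "?n \<epsilon> omega" using w i baire_ap by blast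
      have ag: "agree (succ j) (upd z j ?n) w" using agree_succ_upd[OF i] w by blast
      then have "\<not> x' \<epsilon> ap h ?n" using h(2)[OF n] x' w unfolding Sb_def by blast
      then show "\<not> x' \<epsilon> cpl (union_seq K)" unfolding mem using n by blast
    next
      fix x' w assume x': "x' \<epsilon> baire \<and> agree k x x'" and w: "w \<epsilon> baire \<and> agree i y w \<and> pair x' w \<epsilon> C0"
      show "x' \<epsilon> cpl (union_seq K)"
        using h(2) x' w unfolding Sb_def mem by blast
    qed
    then show ?thesis unfolding Sp_def using Ccpl[OF Cun[OF KC]] by blast
  qed
  show ?thesis
  proof (cases "Sp zero (cst zero) zero (cst zero) zero (cst zero)")
    case True
    then obtain S where S: "S \<epsilon> C" "Sb zero (cst zero) zero (cst zero) zero (cst zero) S"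
      unfolding Sp_def by blast
    have "S = B"
    proof (rule set_ext)
      fix x show "x \<epsilon> S \<longleftrightarrow> x \<epsilon> B"
      proof
        assume x: "x \<epsilon> S"
        then have xb: "x \<epsilon> baire" using S(1) CL L_subs unfolding subs_def by blast
        have "\<not> x \<epsilon> cpl B" using S(2) x unfolding C1(2) Sb_def by auto
        then show "x \<epsilon> B" using xb by simp
      next
        assume "x \<epsilon> B" then show "x \<epsilon> S" using S(2) unfolding C0(2) Sb_def by auto
      qed
    qed
    then show ?thesis using S(1) by simp
  next
    case False
    define T where "T = prd omega (prd baire (prd baire baire))"
    define kk where "kk p = pfst p" for p
    define xx where "xx p = pfst (psnd p)" for p
    define yy where "yy p = pfst (psnd (psnd p))" for p
    define zz where "zz p = psnd (psnd (psnd p))" for p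
    have [dfi]: "dt s \<Longrightarrow> dt (\<lambda>e. kk (s e))" "dt s \<Longrightarrow> dt (\<lambda>e. xx (s e))"
      "dt s \<Longrightarrow> dt (\<lambda>e. yy (s e))" "dt s \<Longrightarrow> dt (\<lambda>e. zz (s e))" for s
      unfolding kk_def xx_def yy_def zz_def by (intro dfi; assumption)+
    have Tmem: "pair k (pair x (pair y z)) \<epsilon> T \<longleftrightarrow> k \<epsilon> omega \<and> x \<epsilon> baire \<and> y \<epsilon> baire \<and> z \<epsilon> baire" for k x y z
      unfolding T_def by simp
    have T: "p = pair (kk p) (pair (xx p) (pair (yy p) (zz p)))" "kk p \<epsilon> omega" "xx p \<epsilon> baire" "yy p \<epsilon> baire" "zz p \<epsilon> baire"
      if p: "p \<epsilon> T" for p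
    proof -
      obtain k q where q: "k \<epsilon> omega" "q \<epsilon> prd baire (prd baire baire)" "p = pair k q" using p unfolding T_def by (rule prdE)
      obtain x r where r: "x \<epsilon> baire" "r \<epsilon> prd baire baire" "q = pair x r" using q(2) by (rule prdE)
      obtain y z where y: "y \<epsilon> baire" "z \<epsilon> baire" "r = pair y z" using r(2) by (rule prdE)
      show "p = pair (kk p) (pair (xx p) (pair (yy p) (zz p)))" "kk p \<epsilon> omega" "xx p \<epsilon> baire" "yy p \<epsilon> baire" "zz p \<epsilon> baire"
        unfolding kk_def xx_def yy_def zz_def using q r y by simp_all
    qed
    define NS where "NS p \<longleftrightarrow> \<not> Sp (kk p) (xx p) (kk p) (yy p) (kk p) (zz p)" for p
    define X where "X = Sep T NS"
    have X: "p \<epsilon> X \<longleftrightarrow> p \<epsilon> T \<and> NS p" for p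
      unfolding X_def by (rule mem_Sep) (unfold NS_def Sp_def Sb_def, intro dfi)
    define K where "K = prd omega (prd omega omega)"
    define t where "t p c = pair (succ (kk p)) (pair (upd (xx p) (kk p) (pfst c))
       (pair (upd (yy p) (kk p) (pfst (psnd c))) (upd (zz p) (kk p) (psnd (psnd c)))))" for p c
    have t_sel: "kk (t p c) = succ (kk p)" "xx (t p c) = upd (xx p) (kk p) (pfst c)"
      "yy (t p c) = upd (yy p) (kk p) (pfst (psnd c))" "zz (t p c) = upd (zz p) (kk p) (psnd (psnd c))" for p c
      unfolding t_def kk_def xx_def yy_def zz_def by simp_all
    have "\<exists>h. maps h omega X \<and> ap h zero = pair zero (pair (cst zero) (pair (cst zero) (cst zero))) \<and>
      (\<forall>n. n \<epsilon> omega \<longrightarrow> (\<lambda>p q. \<exists>c. q = t p c) (ap h n) (ap h (succ n)))"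
    proof (rule dep_choice[of t])
      show "dt (\<lambda>e. t (e 0) (e (Suc 0)))" unfolding t_def by (intro dfi)
      show "df (\<lambda>e. \<exists>c. e (Suc 0) = t (e 0) c)" unfolding t_def by (intro dfi)
      show "pair zero (pair (cst zero) (pair (cst zero) (cst zero))) \<epsilon> X"
        unfolding X Tmem NS_def using False by (simp add: kk_def xx_def yy_def zz_def)
      show "coded K" unfolding K_def by (intro coded_prd coded_omega)
      fix p assume p: "p \<epsilon> X"
      then have pT: "p \<epsilon> T" and ns: "\<not> Sp (kk p) (xx p) (kk p) (yy p) (kk p) (zz p)" unfolding X NS_def by auto
      note k = T(2)[OF pT]
      obtain n where n: "n \<epsilon> omega" "\<not> Sp (succ (kk p)) (upd (xx p) (kk p) n) (kk p) (yy p) (kk p) (zz p)"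
        using extx[OF k] ns by blast
      obtain m where m: "m \<epsilon> omega" "\<not> Sp (succ (kk p)) (upd (xx p) (kk p) n) (succ (kk p)) (upd (yy p) (kk p) m) (kk p) (zz p)"
        using exty[OF k] n(2) by blast
      obtain l where l: "l \<epsilon> omega" "\<not> Sp (succ (kk p)) (upd (xx p) (kk p) n) (succ (kk p)) (upd (yy p) (kk p) m) (succ (kk p)) (upd (zz p) (kk p) l)"
        using extz[OF k] m(2) by blast
      let ?c = "pair n (pair m l)"
      have "t p ?c \<epsilon> T" unfolding t_def Tmem using T[OF pT] n m l by (simp add: succ_omega upd_baire)
      moreover have "NS (t p ?c)" unfolding NS_def t_sel using l(2) by simp
      ultimately show "\<exists>c. c \<epsilon> K \<and> t p c \<epsilon> X \<and> (\<exists>c'. t p c = t p c')"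
        using n m l by (intro exI[of _ ?c]) (auto simp: K_def X)
    qed
    then obtain h where h: "maps h omega X" "ap h zero = pair zero (pair (cst zero) (pair (cst zero) (cst zero)))"
      "\<And>n. n \<epsilon> omega \<Longrightarrow> \<exists>c. ap h (succ n) = t (ap h n) c" by blast
    have hX: "ap h n \<epsilon> T" "NS (ap h n)" if "n \<epsilon> omega" for n
      using ap_in[OF h(1) that] unfolding X by auto
    have kn: "kk (ap h n) = n" if "n \<epsilon> omega" for n using that
    proof (induction n rule: omega_induct)
      case df show ?case by (intro dfi)
    next
      case zero show ?case by (simp add: h(2) kk_def)
    next
      case (succ n)
      then show ?case using h(3)[OF succ(1)] t_sel(1) by auto
    qed
    have lim: "\<exists>l. l \<epsilon> baire \<and> (\<forall>n. n \<epsilon> omega \<longrightarrow> agree n (v (ap h n)) l)"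
      if v: "dt (\<lambda>e. v (e 0))" "\<And>p. p \<epsilon> T \<Longrightarrow> v p \<epsilon> baire" "\<And>p c. \<exists>m. v (t p c) = upd (v p) (kk p) m" for v
    proof -
      have d: "dt (\<lambda>e. v (ap h (e 0)))" by (intro dt1[OF v(1)] dfi)
      have s: "ap (Lam omega (\<lambda>n. v (ap h n))) n = v (ap h n)" if "n \<epsilon> omega" for n by (rule ap_Lam[OF d that])
      have "\<exists>l. l \<epsilon> baire \<and> (\<forall>n. n \<epsilon> omega \<longrightarrow> agree n (ap (Lam omega (\<lambda>n. v (ap h n))) n) l)"
      proof (rule lim_seq)
        show "maps (Lam omega (\<lambda>n. v (ap h n))) omega baire" by (rule Lam_maps[OF d]) (intro v(2) hX(1))
        fix n assume n: "n \<epsilon> omega"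
        obtain c where c: "ap h (succ n) = t (ap h n) c" using h(3)[OF n] by blast
        obtain m where "v (t (ap h n) c) = upd (v (ap h n)) n m" using v(3)[of "ap h n" c] kn[OF n] by auto
        then show "agree n (ap (Lam omega (\<lambda>n. v (ap h n))) n) (ap (Lam omega (\<lambda>n. v (ap h n))) (succ n))"
          unfolding s[OF n] s[OF succ_omega[OF n]] c using agree_upd[OF n] by simp
      qed
      then show ?thesis using s by simp
    qed
    obtain x where x: "x \<epsilon> baire" "\<And>n. n \<epsilon> omega \<Longrightarrow> agree n (xx (ap h n)) x"
      using lim[of xx] T(3) t_sel by (auto simp: dfi)
    obtain y where y: "y \<epsilon> baire" "\<And>n. n \<epsilon> omega \<Longrightarrow> agree n (yy (ap h n)) y"
      using lim[of yy] T(4) t_sel by (auto simp: dfi)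
    obtain z where z: "z \<epsilon> baire" "\<And>n. n \<epsilon> omega \<Longrightarrow> agree n (zz (ap h n)) z"
      using lim[of zz] T(5) t_sel by (auto simp: dfi)
    have nsp: "\<not> Sb n x n y n z S" if n: "n \<epsilon> omega" and S: "S \<epsilon> C" for n S
    proof
      assume "Sb n x n y n z S"
      then have "Sb n (xx (ap h n)) n (yy (ap h n)) n (zz (ap h n)) S"
        unfolding Sb_def using x(2)[OF n] y(2)[OF n] z(2)[OF n] agree_sym agree_trans by blast
      then show False using hX(2)[OF n] S unfolding NS_def Sp_def kn[OF n] by blast
    qed
    have "pair x y \<epsilon> C0"
    proof (rule ccontr)
      assume "\<not> pair x y \<epsilon> C0"
      from C0(1)[OF x(1) y(1) this] obtain k where k: "k \<epsilon> omega"
        "\<forall>x' y'. x' \<epsilon> baire \<and> y' \<epsilon> baire \<and> agree k x x' \<and> agree k y y' \<longrightarrow> \<not> pair x' y' \<epsilon> C0" by blast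
      \<comment> \<open>Near a pair outside \<open>C0\<close> there are no points to be included, so
        the empty set separates. Dually the whole space separates near a pair outside
        \<open>C1\<close>.\<close>
      then have "Sb k x k y k z emp" unfolding Sb_def by auto
      then show False using nsp[OF k(1) Cemp] by blast
    qed
    moreover have "pair x z \<epsilon> C1"
    proof (rule ccontr)
      assume "\<not> pair x z \<epsilon> C1"
      from C1(1)[OF x(1) z(1) this] obtain k where k: "k \<epsilon> omega"
        "\<forall>x' y'. x' \<epsilon> baire \<and> y' \<epsilon> baire \<and> agree k x x' \<and> agree k z y' \<longrightarrow> \<not> pair x' y' \<epsilon> C1" by blast
      then have "Sb k x k y k z baire" unfolding Sb_def by auto
      then show False using nsp[OF k(1) CB] by blast
    qed
    ultimately have "x \<epsilon> B" "x \<epsilon> cpl B" using C0(2) C1(2) x y z by blast+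
    then show ?thesis by simp
  qed
qed

end

section \<open>Bounded partitions\<close>

context ZF_model
begin

lemma mem_cone0: "x \<epsilon> cone0 \<longleftrightarrow> x \<epsilon> baire \<and> ap x zero = zero"
proof -
  have "x \<epsilon> cone s \<longleftrightarrow> x \<epsilon> baire \<and> s \<sqsubseteq> x" for s
    unfolding cone_def by (subst Coll_Sep[of _ baire]) (simp_all add: mem_Sep dfi)
  moreover have "upair (pair zero zero) (pair zero zero) \<sqsubseteq> x \<longleftrightarrow> ap x zero = zero" if "x \<epsilon> baire"
    using maps_pair[of x omega omega zero zero] that unfolding mem_baire subs_def by auto
  ultimately show ?thesis unfolding cone0_def by auto
qed

definition fib :: "'m \<Rightarrow> 'm \<Rightarrow> 'm" where "fib q n = Sep baire (\<lambda>x. ap q x = n)"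

lemma mem_fib [simp]: "x \<epsilon> fib q n \<longleftrightarrow> x \<epsilon> baire \<and> ap q x = n"
  unfolding fib_def by (rule mem_Sep) (intro dfi)
lemma dt_fib [dfi]: "dt s \<Longrightarrow> dt t \<Longrightarrow> dt (\<lambda>e. fib (s e) (t e))"
  by (rule dt2[of fib], unfold fib_def, intro dfi)
lemma fib_subs [simp]: "fib q n \<sqsubseteq> baire" by (simp add: subs_def)

lemma fib_cmps: "maps f baire baire \<Longrightarrow> fib (cmps q f) n = pre f (fib q n)"
  by (rule set_ext) (auto simp: ap_cmps ap_in)

definition dig :: "'m \<Rightarrow> 'm \<Rightarrow> 'm" where "dig q i = Lam baire (\<lambda>x. ap (ap q x) i)"

lemma ap_dig: "x \<epsilon> baire \<Longrightarrow> ap (dig q i) x = ap (ap q x) i"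
  unfolding dig_def by (rule ap_Lam) (intro dfi)
lemma dig_maps: "maps q baire baire \<Longrightarrow> i \<epsilon> omega \<Longrightarrow> maps (dig q i) baire omega"
  unfolding dig_def by (rule Lam_maps) (intro dfi, rule baire_ap, rule ap_in)
lemma dt_dig [dfi]: "dt s \<Longrightarrow> dt t \<Longrightarrow> dt (\<lambda>e. dig (s e) (t e))"
  by (rule dt2[of dig], unfold dig_def, intro dfi)

lemma dig_cmps: "maps q baire baire \<Longrightarrow> maps f baire baire \<Longrightarrow> i \<epsilon> omega \<Longrightarrow> dig (cmps q f) i = cmps (dig q i) f"
  by (rule maps_ext[where a = baire and b = omega and c = omega])
    (auto intro!: dig_maps cmps_maps simp: ap_cmps ap_dig ap_in,
     unfold cmps_def, rule Lam_maps, intro dfi, rule ap_in[OF dig_maps], auto intro: ap_in)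

text \<open>\<open>part K\<close> maps \<open>x\<close> to \<open>n + 1\<close> for the least \<open>n\<close> with \<open>x \<in> K n\<close>, and to \<open>0\<close> off the union.\<close>

definition part :: "'m \<Rightarrow> 'm" where
  "part K = Lam baire (\<lambda>x. if \<exists>n. n \<epsilon> omega \<and> x \<epsilon> ap K n
    then succ (Uni (Sep omega (\<lambda>n. x \<epsilon> ap K n \<and> (\<forall>m. m \<epsilon> n \<longrightarrow> \<not> x \<epsilon> ap K m)))) else zero)"

lemma part:
  shows "maps (part K) baire omega"
    and "fib (part K) zero = cpl (union_seq K)"
    and "n \<epsilon> omega \<Longrightarrow> x \<epsilon> fib (part K) (succ n) \<longleftrightarrow> x \<epsilon> baire \<and> x \<epsilon> ap K n \<and> (\<forall>m. m \<epsilon> n \<longrightarrow> \<not> x \<epsilon> ap K m)"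
proof -
  let ?P = "\<lambda>x n. x \<epsilon> ap K n \<and> (\<forall>m. m \<epsilon> n \<longrightarrow> \<not> x \<epsilon> ap K m)"
  let ?t = "\<lambda>x. if \<exists>n. n \<epsilon> omega \<and> x \<epsilon> ap K n then succ (Uni (Sep omega (?P x))) else zero"
  have Sepm: "n \<epsilon> Sep omega (?P x) \<longleftrightarrow> n \<epsilon> omega \<and> ?P x n" for x n
    by (rule mem_Sep) (intro dfi)
  \<comment> \<open>The least index is the only element of this set, and the union of a singleton is
    its element. This is a definite description in the form of a definable term.\<close>
  have val: "Uni (Sep omega (?P x)) = n" if n: "n \<epsilon> omega" "?P x n" for x n
  proof (rule set_ext)
    have u: "m = n" if "m \<epsilon> omega" "?P x m" for m using omega_linear[OF n(1) that(1)] n that by blast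
    show "z \<epsilon> Uni (Sep omega (?P x)) \<longleftrightarrow> z \<epsilon> n" for z
      unfolding mem_Uni Sepm using n u by blast
  qed
  have ex: "\<exists>n. n \<epsilon> omega \<and> ?P x n" if "\<exists>n. n \<epsilon> omega \<and> x \<epsilon> ap K n" for x
    using that omega_least_ex[of "\<lambda>n. x \<epsilon> ap K n"] by (auto simp: dfi)
  have d: "dt (\<lambda>e. ?t (e 0))" by (intro dfi)
  have m: "maps (Lam baire ?t) baire omega"
  proof (rule Lam_maps[OF d])
    fix x show "?t x \<epsilon> omega"
    proof (cases "\<exists>n. n \<epsilon> omega \<and> x \<epsilon> ap K n")
      case True
      with ex[OF this] obtain n where "n \<epsilon> omega" "?P x n" by blast
      then show ?thesis using True val succ_omega by simp
    next
      case False
      show ?thesis unfolding if_not_P[OF False] by simp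
    qed
  qed
  then show "maps (part K) baire omega" unfolding part_def .
  have ap: "ap (part K) x = ?t x" if "x \<epsilon> baire" for x
    unfolding part_def by (rule ap_Lam[OF d that])
  show "fib (part K) zero = cpl (union_seq K)"
    by (rule set_ext) (auto simp: ap split: if_splits)
  show "x \<epsilon> fib (part K) (succ n) \<longleftrightarrow> x \<epsilon> baire \<and> ?P x n" if n: "n \<epsilon> omega" for x n
  proof (cases "x \<epsilon> baire")
    case True
    show ?thesis
    proof (cases "\<exists>n. n \<epsilon> omega \<and> x \<epsilon> ap K n")
      case ex1: True
      with ex[OF this] obtain m where m: "m \<epsilon> omega" "?P x m" by blast
      have "ap (part K) x = succ m" unfolding ap[OF True] using ex1 val[OF m] by simp
      moreover have "m = n" if "?P x n" using omega_linear[OF n m(1)] that m by blast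
      ultimately show ?thesis unfolding mem_fib using True m(2) succ_inj[of m n] by metis
    next
      case False
      then have "ap (part K) x = zero" using ap[OF True] by simp
      moreover have "\<not> x \<epsilon> ap K n" using False n by blast
      ultimately show ?thesis unfolding mem_fib using succ_not_zero[of n] by metis
    qed
  qed simp
qed

section \<open>Refined topologies and resolution\<close>

definition finer :: "'m \<Rightarrow> 'm \<Rightarrow> bool" where
  "finer q q' \<longleftrightarrow> (\<exists>s. maps s omega omega \<and> (\<forall>x i. x \<epsilon> baire \<and> i \<epsilon> omega \<longrightarrow> ap (ap q' x) i = ap (ap q x) (ap s i)))"

lemma omega_bound:
  assumes s: "maps s omega omega" and k: "k \<epsilon> omega"
  shows "\<exists>k'. k' \<epsilon> omega \<and> (\<forall>i. i \<epsilon> k \<longrightarrow> ap s i \<epsilon> k')"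
  using k
proof (induction k rule: omega_induct)
  case df show ?case by (intro dfi)
next
  case zero show ?case by (intro exI[of _ zero]) simp
next
  case (succ k)
  then obtain k' where k': "k' \<epsilon> omega" "\<forall>i. i \<epsilon> k \<longrightarrow> ap s i \<epsilon> k'" by blast
  obtain m where m: "m \<epsilon> omega" "k' \<epsilon> m" "ap s k \<epsilon> m" using omega_max[OF k'(1) ap_in[OF s succ(1)]] by blast
  then show ?case using k' omega_trans by (intro exI[of _ m]) auto
qed

text \<open>\<open>res B q\<close>: in the topology refined by the digits of \<open>q\<close>, a convergent family is eventually on the same side of
  \<open>B\<close> as its limit \<open>x\<close> in the original topology, even when \<open>y\<close> is not \<open>q x\<close>.\<close>

definition res :: "'m \<Rightarrow> 'm \<Rightarrow> bool" where
  "res B q \<longleftrightarrow> (\<forall>x y. x \<epsilon> baire \<and> y \<epsilon> baire \<longrightarrow> (\<exists>k. k \<epsilon> omega \<and>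
     (\<forall>x'. x' \<epsilon> baire \<and> agree k x' x \<and> agree k (ap q x') y \<longrightarrow> (x' \<epsilon> B \<longleftrightarrow> x \<epsilon> B))))"

lemma df_res [dfi]: "dt s \<Longrightarrow> dt t \<Longrightarrow> df (\<lambda>e. res (s e) (t e))"
  by (rule df2[of res], unfold res_def, intro dfi)

lemma resD:
  assumes "res B q" "x \<epsilon> baire" "y \<epsilon> baire"
  obtains k where "k \<epsilon> omega" "\<And>x'. x' \<epsilon> baire \<Longrightarrow> agree k x' x \<Longrightarrow> agree k (ap q x') y \<Longrightarrow> (x' \<epsilon> B \<longleftrightarrow> x \<epsilon> B)"
  using assms unfolding res_def by blast

text \<open>A limit of \<open>q\<close> yields one of \<open>q'\<close> by reading the digits at the
  places given by \<open>s\<close>. A condition on the first \<open>k\<close> digits of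
  \<open>q'\<close> concerns places of \<open>q\<close> below some bound, by
  \<open>omega_bound\<close>.\<close>

lemma res_finer:
  assumes f: "finer q q'" and q: "maps q baire baire" and r: "res B q'" shows "res B q"
  unfolding res_def
proof (intro allI impI)
  fix x y assume xy: "x \<epsilon> baire \<and> y \<epsilon> baire"
  obtain s where s: "maps s omega omega" "\<And>x i. x \<epsilon> baire \<Longrightarrow> i \<epsilon> omega \<Longrightarrow> ap (ap q' x) i = ap (ap q x) (ap s i)"
    using f unfolding finer_def by blast
  define y' where "y' = Lam omega (\<lambda>i. ap y (ap s i))"
  have d: "dt (\<lambda>e. ap y (ap s (e 0)))" by (intro dfi)
  have y': "ap y' i = ap y (ap s i)" if "i \<epsilon> omega" for i unfolding y'_def by (rule ap_Lam[OF d that])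
  have yb: "y' \<epsilon> baire" unfolding mem_baire y'_def
    by (rule Lam_maps[OF d]) (use xy baire_ap ap_in[OF s(1)] in blast)
  obtain k where k: "k \<epsilon> omega" "\<And>x'. x' \<epsilon> baire \<Longrightarrow> agree k x' x \<Longrightarrow> agree k (ap q' x') y' \<Longrightarrow> (x' \<epsilon> B \<longleftrightarrow> x \<epsilon> B)"
    using resD[OF r _ yb] xy by blast
  obtain k1 where k1: "k1 \<epsilon> omega" "\<forall>i. i \<epsilon> k \<longrightarrow> ap s i \<epsilon> k1" using omega_bound[OF s(1) k(1)] by blast
  obtain k2 where k2: "k2 \<epsilon> omega" "k \<epsilon> k2" "k1 \<epsilon> k2" using omega_max[OF k(1) k1(1)] by blast
  show "\<exists>k. k \<epsilon> omega \<and> (\<forall>x'. x' \<epsilon> baire \<and> agree k x' x \<and> agree k (ap q x') y \<longrightarrow> (x' \<epsilon> B \<longleftrightarrow> x \<epsilon> B))"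
  proof (intro exI[of _ k2] conjI allI impI k2(1))
    fix x' assume x': "x' \<epsilon> baire \<and> agree k2 x' x \<and> agree k2 (ap q x') y"
    have "agree k (ap q' x') y'"
      unfolding agree_def
    proof (intro allI impI)
      fix m assume m: "m \<epsilon> k"
      have mo: "m \<epsilon> omega" using m k(1) mem_omegaD by blast
      have "ap s m \<epsilon> k2" using k1(2) m k2 omega_trans by blast
      then show "ap (ap q' x') m = ap y' m" using s(2)[of x' m] y'[OF mo] x' mo unfolding agree_def by simp
    qed
    then show "x' \<epsilon> B \<longleftrightarrow> x \<epsilon> B" using k(2) x' agree_mono[OF _ k2(2,1)] by blast
  qed
qed

lemma res_cpl: "res B q \<Longrightarrow> res (cpl B) q" unfolding res_def by (simp del: all_simps)

lemma res_cap:
  assumes "res B q" "res B' q" shows "res (cap B B') q"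
  unfolding res_def
proof (intro allI impI)
  fix x y assume xy: "x \<epsilon> baire \<and> y \<epsilon> baire"
  obtain k where k: "k \<epsilon> omega" "\<And>x'. x' \<epsilon> baire \<Longrightarrow> agree k x' x \<Longrightarrow> agree k (ap q x') y \<Longrightarrow> (x' \<epsilon> B \<longleftrightarrow> x \<epsilon> B)"
    using resD[OF assms(1)] xy by blast
  obtain l where l: "l \<epsilon> omega" "\<And>x'. x' \<epsilon> baire \<Longrightarrow> agree l x' x \<Longrightarrow> agree l (ap q x') y \<Longrightarrow> (x' \<epsilon> B' \<longleftrightarrow> x \<epsilon> B')"
    using resD[OF assms(2)] xy by blast
  obtain m where m: "m \<epsilon> omega" "k \<epsilon> m" "l \<epsilon> m" using omega_max[OF k(1) l(1)] by blast
  show "\<exists>k. k \<epsilon> omega \<and> (\<forall>x'. x' \<epsilon> baire \<and> agree k x' x \<and> agree k (ap q x') y \<longrightarrow> (x' \<epsilon> cap B B' \<longleftrightarrow> x \<epsilon> cap B B'))"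
  proof (intro exI[of _ m] conjI allI impI m(1))
    fix x' assume x': "x' \<epsilon> baire \<and> agree m x' x \<and> agree m (ap q x') y"
    then show "x' \<epsilon> cap B B' \<longleftrightarrow> x \<epsilon> cap B B'"
      using k(2)[of x'] l(2)[of x'] agree_mono[OF _ m(2,1)] agree_mono[OF _ m(3,1)] xy by auto
  qed
qed

section \<open>Lipschitz-closed algebras\<close>

definition alg :: "'m \<Rightarrow> bool" where
  "alg C \<longleftrightarrow> (\<forall>X. X \<epsilon> C \<longrightarrow> X \<sqsubseteq> baire \<and> cpl X \<epsilon> C) \<and> (\<forall>X Y. X \<epsilon> C \<and> Y \<epsilon> C \<longrightarrow> cap X Y \<epsilon> C) \<and>
    (\<forall>u X. lips u \<and> X \<epsilon> C \<longrightarrow> pre u X \<epsilon> C) \<and> (\<forall>x n. x \<epsilon> baire \<and> n \<epsilon> omega \<longrightarrow> cone_at n x \<epsilon> C)"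

lemma df_alg [dfi]: "dt s \<Longrightarrow> df (\<lambda>e. alg (s e))"
  by (rule df1[of alg], unfold alg_def, intro dfi)

lemma algD:
  assumes "alg C"
  shows "X \<epsilon> C \<Longrightarrow> X \<sqsubseteq> baire" "X \<epsilon> C \<Longrightarrow> cpl X \<epsilon> C" "X \<epsilon> C \<Longrightarrow> Y \<epsilon> C \<Longrightarrow> cap X Y \<epsilon> C"
    "lips u \<Longrightarrow> X \<epsilon> C \<Longrightarrow> pre u X \<epsilon> C" "x \<epsilon> baire \<Longrightarrow> n \<epsilon> omega \<Longrightarrow> cone_at n x \<epsilon> C"
  using assms unfolding alg_def by blast+

lemma alg_baire: "alg C \<Longrightarrow> baire \<epsilon> C"
proof -
  assume "alg C"
  moreover have "cone_at zero (cst zero) = baire" by (rule set_ext) auto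
  ultimately show ?thesis using algD(5)[of C "cst zero" zero] by simp
qed

lemma alg_emp: "alg C \<Longrightarrow> emp \<epsilon> C"
proof -
  assume a: "alg C"
  have "cpl baire = emp" by (rule set_ext) auto
  then show ?thesis using algD(2)[OF a alg_baire[OF a]] by simp
qed

definition cup :: "'m \<Rightarrow> 'm \<Rightarrow> 'm" where "cup A B = cpl (cap (cpl A) (cpl B))"
lemma mem_cup: "x \<epsilon> cup A B \<longleftrightarrow> x \<epsilon> baire \<and> (x \<epsilon> A \<or> x \<epsilon> B)" unfolding cup_def by auto
lemma dt_cup [dfi]: "dt s \<Longrightarrow> dt t \<Longrightarrow> dt (\<lambda>e. cup (s e) (t e))"
  by (rule dt2[of cup], unfold cup_def, intro dfi)
lemma alg_cup: "alg C \<Longrightarrow> A \<epsilon> C \<Longrightarrow> B \<epsilon> C \<Longrightarrow> cup A B \<epsilon> C" unfolding cup_def by (intro algD)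

text \<open>Being caught first at index \<open>n\<close> is a finite Boolean condition:
  \<open>T n\<close> consists of the points that no earlier set contains.\<close>

lemma alg_part:
  assumes C: "alg C" and K: "maps K omega C" and n: "n \<epsilon> omega"
  shows "fib (part K) (succ n) \<epsilon> C"
proof -
  define T where "T n = Sep baire (\<lambda>x. \<forall>m. m \<epsilon> n \<longrightarrow> \<not> x \<epsilon> ap K m)" for n
  have T: "x \<epsilon> T n \<longleftrightarrow> x \<epsilon> baire \<and> (\<forall>m. m \<epsilon> n \<longrightarrow> \<not> x \<epsilon> ap K m)" for x n
    unfolding T_def by (rule mem_Sep) (intro dfi)
  have "T n \<epsilon> C" using n
  proof (induction n rule: omega_induct)
    case df show ?case unfolding T_def by (intro dfi)
  next
    case zero
    have "T zero = baire" by (rule set_ext) (simp add: T)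
    then show ?case using alg_baire[OF C] by simp
  next
    case (succ n)
    have "T (succ n) = cap (T n) (cpl (ap K n))" by (rule set_ext) (auto simp: T)
    then show ?case using succ algD[OF C] ap_in[OF K] by simp
  qed
  moreover have "fib (part K) (succ n) = cap (T n) (ap K n)"
    by (rule set_ext) (auto simp: T part(3)[OF n] simp del: mem_fib)
  ultimately show ?thesis using algD(3)[OF C] ap_in[OF K n] by simp
qed

end

text \<open>Cones of zero sequences represent all cones here: \<open>fd_lle\<close> reduces every
  set determined by finitely many digits to one of them.\<close>

locale breds = reds mem F for mem :: "'m \<Rightarrow> 'm \<Rightarrow> bool" (infix "\<epsilon>" 50) and F +
  assumes zcone_L: "n \<epsilon> omega \<Longrightarrow> zcone n \<epsilon> L"
    and sig_L: "X \<epsilon> L \<Longrightarrow> sig X"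
    and sbound: "f \<epsilon> F \<Longrightarrow> maps D omega (pow baire) \<Longrightarrow> B \<epsilon> L \<Longrightarrow>
      (\<And>n. n \<epsilon> omega \<Longrightarrow> lle (ap D n) B) \<Longrightarrow>
      \<exists>B'. B' \<epsilon> L \<and> (\<forall>n. n \<epsilon> omega \<longrightarrow> lle (pre f (ap D n)) B')"
begin

section \<open>Closure properties of \<open>L\<close> and pulling back bounded partitions\<close>

lemma L_pre: "f \<epsilon> F \<Longrightarrow> X \<epsilon> L \<Longrightarrow> pre f X \<epsilon> L"
  unfolding mem_L using pre_cmps[OF F_maps] F_comp by metis

lemma L_lle: "lle X Y \<Longrightarrow> Y \<epsilon> L \<Longrightarrow> X \<epsilon> L"
  unfolding lle_def using L_pre lips_F by blast

text \<open>The two values of the reduction first differ at digit \<open>n\<close>, while points on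
  different sides of \<open>X\<close> differ before \<open>n\<close>; so the reduction is Lipschitz.
  The target depends on \<open>n\<close> alone, which gives the fibres of a finitely determined map
  a common bound.\<close>

lemma fd_lle:
  assumes X: "X \<sqsubseteq> baire" and n: "n \<epsilon> omega"
    and d: "\<And>x y. x \<epsilon> baire \<Longrightarrow> y \<epsilon> baire \<Longrightarrow> agree n x y \<Longrightarrow> x \<epsilon> X \<longleftrightarrow> y \<epsilon> X"
  shows "lle X (zcone (succ n))"
proof -
  define b where "b = upd (cst zero) n one"
  have b: "b \<epsilon> baire" "agree n (cst zero) b" "ap b n = one"
    unfolding b_def by (simp_all add: upd_baire agree_upd n ap_upd)
  define u where "u = Lam baire (\<lambda>x. if x \<epsilon> X then cst zero else b)"
  have dd: "dt (\<lambda>e. if e 0 \<epsilon> X then cst zero else b)" by (intro dfi)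
  have u: "ap u x = (if x \<epsilon> X then cst zero else b)" if "x \<epsilon> baire" for x
    unfolding u_def by (rule ap_Lam[OF dd that])
  have "maps u baire baire" unfolding u_def by (rule Lam_maps[OF dd]) (simp add: b)
  moreover have "agree m (ap u x) (ap u y)" if xy: "x \<epsilon> baire" "y \<epsilon> baire" "m \<epsilon> omega" "agree m x y" for x y m
  proof (cases "x \<epsilon> X \<longleftrightarrow> y \<epsilon> X")
    case True then show ?thesis using u xy by simp
  next
    case False
    then have "\<not> n \<epsilon> m" "n \<noteq> m" using d xy agree_mono by blast+
    then have mn: "m \<epsilon> n" using omega_linear[OF n xy(3)] by blast
    then have "agree m (cst zero) b" using agree_mono[OF b(2) mn n] by blast
    then show ?thesis using u xy by (auto intro: agree_sym)
  qed
  ultimately have "lips u" unfolding lips_def by blast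
  moreover have "X = pre u (zcone (succ n))"
  proof (rule set_ext)
    fix x show "x \<epsilon> X \<longleftrightarrow> x \<epsilon> pre u (zcone (succ n))"
    proof (cases "x \<epsilon> baire")
      case True
      have "\<not> agree (succ n) b (cst zero)" unfolding agree_def using b(3) n by auto
      then show ?thesis using True u[OF True] b by auto
    next
      case False then show ?thesis using X unfolding subs_def by auto
    qed
  qed
  ultimately show ?thesis unfolding lle_def by blast
qed

lemma fd_L:
  assumes "X \<sqsubseteq> baire" "n \<epsilon> omega"
    and "\<And>x y. x \<epsilon> baire \<Longrightarrow> y \<epsilon> baire \<Longrightarrow> agree n x y \<Longrightarrow> x \<epsilon> X \<longleftrightarrow> y \<epsilon> X"
  shows "X \<epsilon> L"
  using L_lle[OF fd_lle[OF assms] zcone_L[OF succ_omega[OF assms(2)]]] .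

lemma L_cpl: "X \<epsilon> L \<Longrightarrow> cpl X \<epsilon> L"
proof -
  assume "X \<epsilon> L"
  then obtain f where f: "f \<epsilon> F" "X = pre f cone0" unfolding mem_L by blast
  have "cpl cone0 \<epsilon> L"
    by (rule fd_L[OF _ one_omega]) (auto simp: mem_cone0 agree_def one_def)
  then show ?thesis unfolding f(2) pre_cpl[OF F_maps[OF f(1)], symmetric] by (rule L_pre[OF f(1)])
qed

text \<open>A partition is given by its index function, with empty fibres permitted; pulling it back
  along a reduction is then composition.\<close>

definition bpart :: "'m \<Rightarrow> bool" where
  "bpart q \<longleftrightarrow> maps q baire omega \<and> (\<exists>B. B \<epsilon> L \<and> (\<forall>n. n \<epsilon> omega \<longrightarrow> lle (fib q n) B))"

lemma df_bpart [dfi]: "dt s \<Longrightarrow> df (\<lambda>e. bpart (s e))"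
  by (rule df1[of bpart], unfold bpart_def, intro dfi)

lemma bpart_fib: "bpart q \<Longrightarrow> n \<epsilon> omega \<Longrightarrow> fib q n \<epsilon> L"
  unfolding bpart_def using L_lle by blast

lemma bpart_maps: "bpart q \<Longrightarrow> maps q baire omega" by (simp add: bpart_def)

text \<open>This is where the \<open>\<sigma>\<close>-boundness condition enters: the preimages of
  the fibres have a common bound again.\<close>

lemma bpart_pre:
  assumes f: "f \<epsilon> F" and q: "bpart q" shows "bpart (cmps q f)"
proof -
  obtain B where B: "B \<epsilon> L" "\<forall>n. n \<epsilon> omega \<longrightarrow> lle (fib q n) B" using q unfolding bpart_def by blast
  define D where "D = Lam omega (\<lambda>n. fib q n)"
  have d: "dt (\<lambda>e. fib q (e 0))" by (intro dfi)
  have D: "ap D n = fib q n" if "n \<epsilon> omega" for n unfolding D_def by (rule ap_Lam[OF d that])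
  have "maps D omega (pow baire)" unfolding D_def by (rule Lam_maps[OF d]) simp
  from sbound[OF f this B(1)] obtain B' where B': "B' \<epsilon> L" "\<forall>n. n \<epsilon> omega \<longrightarrow> lle (pre f (fib q n)) B'"
    using D B(2) by auto
  have "maps (cmps q f) baire omega" unfolding cmps_def
    by (rule Lam_maps) (intro dfi, intro ap_in[OF bpart_maps[OF q]] ap_in[OF F_maps[OF f]])
  then show ?thesis unfolding bpart_def fib_cmps[OF F_maps[OF f]] using B' by blast
qed

lemma fd_bpart:
  assumes q: "maps q baire omega" and n: "n \<epsilon> omega"
    and d: "\<And>x y. x \<epsilon> baire \<Longrightarrow> y \<epsilon> baire \<Longrightarrow> agree n x y \<Longrightarrow> ap q x = ap q y"
  shows "bpart q"
proof -
  have "lle (fib q m) (zcone (succ n))" for m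
  proof (rule fd_lle[OF fib_subs n])
    fix x y assume "x \<epsilon> baire" "y \<epsilon> baire" "agree n x y"
    then show "x \<epsilon> fib q m \<longleftrightarrow> y \<epsilon> fib q m" using d[of x y] by simp
  qed
  then show ?thesis unfolding bpart_def using q zcone_L[OF succ_omega[OF n]] by blast
qed

lemma bpart_two:
  assumes "D \<epsilon> L" shows "\<exists>q. bpart q \<and> fib q zero = D \<and> fib q one = cpl D \<and>
    (\<forall>n. n \<epsilon> omega \<longrightarrow> n \<noteq> zero \<longrightarrow> n \<noteq> one \<longrightarrow> fib q n = emp)"
proof -
  obtain f where f: "f \<epsilon> F" "D = pre f cone0" using assms unfolding mem_L by blast
  define q0 where "q0 = Lam baire (\<lambda>x. if x \<epsilon> cone0 then zero else one)"
  have d: "dt (\<lambda>e. if e 0 \<epsilon> cone0 then zero else one)" by (intro dfi)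
  have q0: "ap q0 x = (if x \<epsilon> cone0 then zero else one)" if "x \<epsilon> baire" for x
    unfolding q0_def by (rule ap_Lam[OF d that])
  have m: "maps q0 baire omega" unfolding q0_def by (rule Lam_maps[OF d]) simp
  have "bpart q0" by (rule fd_bpart[OF m one_omega]) (auto simp: q0 mem_cone0 agree_def one_def)
  from bpart_pre[OF f(1) this] have "bpart (cmps q0 f)" .
  moreover have "fib (cmps q0 f) zero = D" "fib (cmps q0 f) one = cpl D"
    "n \<noteq> zero \<Longrightarrow> n \<noteq> one \<Longrightarrow> fib (cmps q0 f) n = emp" for n
    unfolding fib_cmps[OF F_maps[OF f(1)]] f(2)
    by (rule set_ext; use ap_in[OF F_maps[OF f(1)]] q0 in \<open>auto split: if_splits\<close>)+
  ultimately show ?thesis by blast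
qed

section \<open>Maps whose digits are bounded partitions\<close>

definition Q :: 'm where
  "Q = Sep (funs baire baire) (\<lambda>q. \<forall>i. i \<epsilon> omega \<longrightarrow> bpart (dig q i))"

lemma mem_Q: "q \<epsilon> Q \<longleftrightarrow> maps q baire baire \<and> (\<forall>i. i \<epsilon> omega \<longrightarrow> bpart (dig q i))"
proof -
  have "df (\<lambda>e. \<forall>i. i \<epsilon> omega \<longrightarrow> bpart (dig (e 0) i))" by (intro dfi)
  from mem_Sep[OF this] show ?thesis unfolding Q_def by simp
qed

lemma Q_maps: "q \<epsilon> Q \<Longrightarrow> maps q baire baire" by (simp add: mem_Q)

lemma Q_cmps: "q \<epsilon> Q \<Longrightarrow> f \<epsilon> F \<Longrightarrow> cmps q f \<epsilon> Q"
  unfolding mem_Q by (auto simp: dig_cmps F_maps cmps_maps bpart_pre)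

lemma idb_Q: "idb \<epsilon> Q"
  unfolding mem_Q
proof (intro conjI maps_idb allI impI)
  fix i assume i: "i \<epsilon> omega"
  show "bpart (dig idb i)"
    by (rule fd_bpart[OF dig_maps[OF maps_idb i] succ_omega[OF i]]) (auto simp: ap_dig agree_def)
qed

text \<open>The digits of the identity are finitely determined, and \<open>f\<close> is the identity
  composed with \<open>f\<close>. So the digits of any reduction are themselves bounded
  partitions.\<close>

lemma F_Q: "f \<epsilon> F \<Longrightarrow> f \<epsilon> Q"
proof -
  assume f: "f \<epsilon> F"
  have "cmps idb f = f"
    by (rule maps_ext[OF cmps_maps[OF maps_idb F_maps[OF f]] F_maps[OF f]])
      (simp add: ap_cmps ap_in[OF F_maps[OF f]])
  then show ?thesis using Q_cmps[OF idb_Q f] by simp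
qed

text \<open>A map in \<open>Q\<close> can be recovered from the double sequence of the fibres of its
  digits, and these are elements of the coded set \<open>L\<close>.\<close>

lemma coded_Q: "coded Q"
proof -
  have "coded (funs omega (funs omega L))" by (intro coded_funs coded_L)
  then obtain g where g: "\<forall>z. z \<epsilon> funs omega (funs omega L) \<longrightarrow> (\<exists>x. x \<epsilon> baire \<and> ap g x = z)"
    unfolding coded_def by blast
  define G where "G a = Lam baire (\<lambda>x. Lam omega (\<lambda>i. Uni (Sep omega (\<lambda>n. x \<epsilon> ap (ap a i) n))))" for a
  have Gd: "dt (\<lambda>e. G (s e))" if "dt s" for s
    by (rule dt1[of G, OF _ that]) (unfold G_def, intro dfi)
  show ?thesis
  proof (rule codedI[of "\<lambda>x. G (ap g x)"])
    fix q assume q: "q \<epsilon> Q"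
    define a where "a = Lam omega (\<lambda>i. Lam omega (\<lambda>n. fib (dig q i) n))"
    have d: "dt (\<lambda>e. Lam omega (\<lambda>n. fib (dig q (e 0)) n))" by (intro dfi)
    have d2: "dt (\<lambda>e. fib (dig q i) (e 0))" for i by (intro dfi)
    have a: "ap (ap a i) n = fib (dig q i) n" if "i \<epsilon> omega" "n \<epsilon> omega" for i n
      unfolding a_def using that by (simp add: ap_Lam[OF d] ap_Lam[OF d2])
    have "maps a omega (funs omega L)"
      unfolding a_def
    proof (rule Lam_maps[OF d])
      fix i assume i: "i \<epsilon> omega"
      have "maps (Lam omega (fib (dig q i))) omega L"
        by (rule Lam_maps[OF d2]) (rule bpart_fib, use q i mem_Q in auto)
      then show "Lam omega (fib (dig q i)) \<epsilon> funs omega L" by simp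
    qed
    then obtain x where x: "x \<epsilon> baire" "ap g x = a" using g[rule_format, of a] by auto
    have "G a = q"
    proof (rule maps_ext)
      have d3: "dt (\<lambda>e. Lam omega (\<lambda>i. Uni (Sep omega (\<lambda>n. e 0 \<epsilon> ap (ap a i) n))))" by (intro dfi)
      have d4: "dt (\<lambda>e. Uni (Sep omega (\<lambda>n. x \<epsilon> ap (ap a (e 0)) n)))" for x by (intro dfi)
      have Sm: "n \<epsilon> Sep omega (\<lambda>n. x \<epsilon> ap (ap a i) n) \<longleftrightarrow> n \<epsilon> omega \<and> x \<epsilon> ap (ap a i) n" for x i n
        by (rule mem_Sep) (intro dfi)
      have v: "Uni (Sep omega (\<lambda>n. x \<epsilon> ap (ap a i) n)) = ap (ap q x) i" if xi: "x \<epsilon> baire" "i \<epsilon> omega" for x i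
      proof -
        have o: "ap (ap q x) i \<epsilon> omega" using xi Q_maps[OF q] ap_in baire_ap by blast
        have "n \<epsilon> Sep omega (\<lambda>n. x \<epsilon> ap (ap a i) n) \<longleftrightarrow> n = ap (ap q x) i" for n
          unfolding Sm using xi o by (auto simp: a ap_dig)
        then show ?thesis by (intro set_ext) auto
      qed
      have row: "Lam omega (\<lambda>i. Uni (Sep omega (\<lambda>n. x \<epsilon> ap (ap a i) n))) = ap q x" if xb: "x \<epsilon> baire" for x
      proof (rule maps_ext)
        show "maps (ap q x) omega omega" using ap_in[OF Q_maps[OF q] xb] by (simp add: mem_baire)
        then show "maps (Lam omega (\<lambda>i. Uni (Sep omega (\<lambda>n. x \<epsilon> ap (ap a i) n)))) omega omega"
          by (intro Lam_maps[OF d4]) (simp add: v[OF xb] ap_in)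
      qed (simp add: ap_Lam[OF d4] v[OF xb])
      show "maps q baire baire" using Q_maps[OF q] .
      then show "maps (G a) baire baire" unfolding G_def
        by (intro Lam_maps[OF d3]) (simp add: row ap_in)
      show "ap (G a) x = ap q x" if "x \<epsilon> baire" for x
        unfolding G_def using ap_Lam[OF d3 that] row[OF that] by simp
    qed
    then show "\<exists>x. x \<epsilon> baire \<and> G (ap g x) = q" using x by blast
  qed (intro Gd dfi)
qed

text \<open>Membership in \<open>Q\<close> constrains each digit separately, with its own bound, so
  the digits of countably many maps can be listed as the digits of one map.\<close>

lemma Q_join:
  assumes s: "maps s omega Q"
  shows "\<exists>q. q \<epsilon> Q \<and> (\<forall>j. j \<epsilon> omega \<longrightarrow> finer q (ap s j))"
proof -
  obtain p where p: "maps p omega (prd omega omega)"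
    "\<And>m n. m \<epsilon> omega \<Longrightarrow> n \<epsilon> omega \<Longrightarrow> \<exists>i. i \<epsilon> omega \<and> ap p i = pair m n"
    using omega_prd_enum by blast
  define q where "q = Lam baire (\<lambda>x. Lam omega (\<lambda>m. ap (ap (ap s (pfst (ap p m))) x) (psnd (ap p m))))"
  have d1: "dt (\<lambda>e. Lam omega (\<lambda>m. ap (ap (ap s (pfst (ap p m))) (e 0)) (psnd (ap p m))))" by (intro dfi)
  have d2: "dt (\<lambda>e. ap (ap (ap s (pfst (ap p (e 0)))) x) (psnd (ap p (e 0))))" for x by (intro dfi)
  have pm: "pfst (ap p m) \<epsilon> omega \<and> psnd (ap p m) \<epsilon> omega" if "m \<epsilon> omega" for m
    using ap_in[OF p(1) that] by (rule prdE) simp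
  have sm: "maps (ap s j) baire baire" if "j \<epsilon> omega" for j using ap_in[OF s that] Q_maps by blast
  have qa: "ap (ap q x) m = ap (ap (ap s (pfst (ap p m))) x) (psnd (ap p m))" if "x \<epsilon> baire" "m \<epsilon> omega" for x m
    unfolding q_def using that by (simp add: ap_Lam[OF d1] ap_Lam[OF d2])
  have qm: "maps q baire baire"
    unfolding q_def
  proof (rule Lam_maps[OF d1])
    fix x assume x: "x \<epsilon> baire"
    show "Lam omega (\<lambda>m. ap (ap (ap s (pfst (ap p m))) x) (psnd (ap p m))) \<epsilon> baire"
      unfolding mem_baire by (rule Lam_maps[OF d2]) (use pm sm x ap_in baire_ap in blast)
  qed
  have "bpart (dig q m)" if m: "m \<epsilon> omega" for m
  proof -
    have "dig q m = dig (ap s (pfst (ap p m))) (psnd (ap p m))"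
      by (rule maps_ext[OF dig_maps[OF qm m] dig_maps]) (use pm sm m qa in \<open>auto simp: ap_dig\<close>)
    then show ?thesis using ap_in[OF s] pm[OF m] unfolding mem_Q by simp
  qed
  then have "q \<epsilon> Q" unfolding mem_Q using qm by blast
  moreover have "finer q (ap s j)" if j: "j \<epsilon> omega" for j
  proof -
    have "\<exists>h. maps h omega omega \<and> (\<forall>i. i \<epsilon> omega \<longrightarrow> (\<lambda>i m. ap p m = pair j i) i (ap h i))"
    proof (rule countable_choice[OF _ coded_omega])
      show "df (\<lambda>e. ap p (e (Suc 0)) = pair j (e 0))" by (intro dfi)
      show "\<exists>c. c \<epsilon> omega \<and> ap p c = pair j n" if "n \<epsilon> omega" for n using p(2)[OF j that] .
    qed
    then obtain h where h: "maps h omega omega" "\<forall>i. i \<epsilon> omega \<longrightarrow> ap p (ap h i) = pair j i" by blast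
    have "ap (ap (ap s j) x) i = ap (ap q x) (ap h i)" if "x \<epsilon> baire" "i \<epsilon> omega" for x i
      using qa[OF that(1) ap_in[OF h(1) that(2)]] h(2) that(2) by simp
    then show ?thesis unfolding finer_def using h(1) by blast
  qed
  ultimately show ?thesis by blast
qed

lemma Q_join2: "q1 \<epsilon> Q \<Longrightarrow> q2 \<epsilon> Q \<Longrightarrow> \<exists>q. q \<epsilon> Q \<and> finer q q1 \<and> finer q q2"
proof -
  assume q: "q1 \<epsilon> Q" "q2 \<epsilon> Q"
  obtain q where q: "q \<epsilon> Q" "\<forall>j. j \<epsilon> omega \<longrightarrow> finer q (ap (two_seq q1 q2) j)"
    using Q_join[OF two_seq_maps[OF q]] by blast
  have "finer q q1" using q(2)[rule_format, of zero] ap_two_seq[of zero q1 q2] by simp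
  moreover have "finer q q2" using q(2)[rule_format, of one] ap_two_seq[of one q1 q2] by simp
  ultimately show ?thesis using q(1) by blast
qed

section \<open>Resolutions\<close>

text \<open>Otherwise SLO reduces the complement of \<open>B\<close> to \<open>X\<close>, and the
  closure properties of \<open>C\<close> put \<open>B\<close> into \<open>C\<close>. Thus one set
  outside \<open>C\<close> bounds all of \<open>C\<close>.\<close>

lemma initial:
  assumes C: "alg C" and B: "B \<sqsubseteq> baire" "\<not> B \<epsilon> C" and X: "X \<epsilon> C"
  shows "lle X B"
proof (rule ccontr)
  assume "\<not> lle X B"
  then have "lle (cpl B) X" using SLO[OF algD(1)[OF C X] B(1)] by blast
  then have "cpl B \<epsilon> C" unfolding lle_def using algD(4)[OF C _ X] by auto
  then have "B \<epsilon> C" using algD(2)[OF C] cpl_cpl[OF B(1)] by metis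
  then show False using B(2) by blast
qed

text \<open>The fibres at successors lie in \<open>C\<close>, hence are bounded by any set outside
  \<open>C\<close>. Only the fibre at \<open>zero\<close>, the complement of the union, can cause
  trouble. If it reduces to \<open>B\<close> or to the complement of \<open>B\<close>, that set is a
  common bound; if to neither, SLO reduces both of these to the union.\<close>

lemma part_cases:
  assumes C: "alg C" and B: "B \<epsilon> L" "\<not> B \<epsilon> C" and K: "maps K omega C"
  shows "bpart (part K) \<or> (lle B (union_seq K) \<and> lle (cpl B) (union_seq K))"
proof -
  let ?V = "union_seq K"
  have Bb: "B \<sqsubseteq> baire" using L_subs[OF B(1)] .
  have cB: "cpl B \<epsilon> L" "\<not> cpl B \<epsilon> C"
    using L_cpl[OF B(1)] B(2) algD(2)[OF C, of "cpl B"] cpl_cpl[OF Bb] by auto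
  have V: "?V \<sqsubseteq> baire" by (simp add: subs_def)
  have *: "bpart (part K)" if Y: "Y \<epsilon> L" "\<not> Y \<epsilon> C" "lle (cpl ?V) Y" for Y
    unfolding bpart_def
  proof (intro conjI part(1) exI[of _ Y] Y(1) allI impI)
    fix n assume "n \<epsilon> omega"
    from omega_cases[OF this] show "lle (fib (part K) n) Y"
    proof (elim disjE exE conjE)
      assume "n = zero" then show ?thesis using part(2) Y(3) by simp
    next
      fix m assume m: "m \<epsilon> omega" "n = succ m"
      show ?thesis unfolding m(2) by (rule initial[OF C L_subs[OF Y(1)] Y(2) alg_part[OF C K m(1)]])
    qed
  qed
  show ?thesis
  proof (rule ccontr)
    assume "\<not> ?thesis"
    then have n: "\<not> bpart (part K)" "\<not> lle B ?V \<or> \<not> lle (cpl B) ?V" by auto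
    have "\<not> lle (cpl ?V) B" "\<not> lle (cpl ?V) (cpl B)" using * n(1) B cB by blast+
    then have "lle (cpl B) (cpl ?V)" "lle (cpl (cpl B)) (cpl ?V)"
      using SLO[OF cpl_subs Bb] SLO[OF cpl_subs, of "cpl B"] by (auto simp del: mem_cpl)
    then have "lle B ?V" "lle (cpl B) ?V" using lle_cpl_iff Bb V cpl_subs by blast+
    then show False using n(2) by blast
  qed
qed

text \<open>Partition by the first index at which \<open>K\<close> or \<open>K'\<close> catches a
  point. No point escapes, and on the fibre of \<open>n\<close> membership in \<open>X\<close> is
  membership in \<open>ap K n\<close>. All fibres are in \<open>C\<close>, so \<open>B\<close>
  bounds them.\<close>

lemma part_total:
  assumes C: "alg C" and B: "B \<epsilon> L" "\<not> B \<epsilon> C"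
    and K: "maps K omega C" "X = union_seq K" and K': "maps K' omega C" "cpl X = union_seq K'"
    and X: "X \<sqsubseteq> baire"
  shows "\<exists>q. bpart q \<and> fib q zero = emp \<and> (\<forall>n. n \<epsilon> omega \<longrightarrow> fib q (succ n) \<epsilon> C \<and> cap X (fib q (succ n)) \<epsilon> C)"
proof -
  define J where "J = Lam omega (\<lambda>n. cup (ap K n) (ap K' n))"
  have d: "dt (\<lambda>e. cup (ap K (e 0)) (ap K' (e 0)))" by (intro dfi)
  have J: "ap J n = cup (ap K n) (ap K' n)" if "n \<epsilon> omega" for n unfolding J_def by (rule ap_Lam[OF d that])
  have JC: "maps J omega C" unfolding J_def by (rule Lam_maps[OF d]) (intro alg_cup[OF C] ap_in[OF K(1)] ap_in[OF K'(1)])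
  have XK: "x \<epsilon> X \<longleftrightarrow> x \<epsilon> baire \<and> (\<exists>n. n \<epsilon> omega \<and> x \<epsilon> ap K n)" for x unfolding K(2) by simp
  have XK': "\<not> x \<epsilon> X \<longleftrightarrow> (\<exists>n. n \<epsilon> omega \<and> x \<epsilon> ap K' n)" if "x \<epsilon> baire" for x
    using that K'(2) mem_cpl[of x X] mem_union_seq[of x K'] by simp
  have z: "fib (part J) zero = emp" unfolding part(2)
  proof (rule set_ext)
    fix x show "x \<epsilon> cpl (union_seq J) \<longleftrightarrow> x \<epsilon> emp"
      using J XK[of x] XK'[of x] by (auto simp: mem_cup)
  qed
  have s: "fib (part J) (succ n) \<epsilon> C" if "n \<epsilon> omega" for n by (rule alg_part[OF C JC that])
  have "cap X (fib (part J) (succ n)) \<epsilon> C" if n: "n \<epsilon> omega" for n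
  proof -
    have "cap X (fib (part J) (succ n)) = cap (fib (part J) (succ n)) (ap K n)"
    proof (rule set_ext)
      fix x show "x \<epsilon> cap X (fib (part J) (succ n)) \<longleftrightarrow> x \<epsilon> cap (fib (part J) (succ n)) (ap K n)"
        unfolding mem_cap part(3)[OF n] J[OF n] mem_cup using XK[of x] XK'[of x] n by blast
    qed
    then show ?thesis using algD(3)[OF C s[OF n] ap_in[OF K(1) n]] by simp
  qed
  moreover have "bpart (part J)" unfolding bpart_def
  proof (intro conjI part(1) exI[of _ B] B(1) allI impI)
    fix n assume "n \<epsilon> omega"
    from omega_cases[OF this] have "fib (part J) n \<epsilon> C"
      using z s alg_emp[OF C] by auto
    then show "lle (fib (part J) n) B" by (rule initial[OF C L_subs[OF B(1)] B(2)])
  qed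
  ultimately show ?thesis using z s by blast
qed

text \<open>Stands in for closure under countable unions: the fibre at \<open>n + 1\<close> collects the points that enter the union at
  index \<open>n\<close>, and the fibre at \<open>0\<close> is the complement of the union.\<close>

definition glue :: "'m \<Rightarrow> bool" where
  "glue C \<longleftrightarrow> (\<forall>q X. bpart q \<and> X \<sqsubseteq> baire \<and>
     (\<forall>n. n \<epsilon> omega \<longrightarrow> fib q (succ n) \<epsilon> C \<and> cap X (fib q (succ n)) \<epsilon> C) \<and>
     (cap X (fib q zero) = emp \<or> fib q zero \<sqsubseteq> X) \<longrightarrow> X \<epsilon> C)"

text \<open>Suppose \<open>B\<close> is in \<open>L\<close> but not in \<open>C\<close>. If the
  partition by first index of a union from \<open>C\<close> were unbounded, \<open>B\<close> and its
  complement would both reduce to that union, hence be unions from \<open>C\<close> themselves, and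
  gluing along \<open>part_total\<close> would give \<open>B\<close>. So gluing applies to all
  countable unions, and Luzin separation yields \<open>B\<close> after all.\<close>

lemma L_glue:
  assumes C: "alg C" "glue C" shows "L \<sqsubseteq> C"
proof (rule ccontr)
  assume "\<not> L \<sqsubseteq> C"
  then obtain B where B: "B \<epsilon> L" "\<not> B \<epsilon> C" unfolding subs_def by blast
  note Bb = L_subs[OF B(1)]
  have CL: "C \<sqsubseteq> L" unfolding subs_def using initial[OF C(1) Bb B(2)] L_lle B(1) by blast
  have un: "union_seq K \<epsilon> C" if K: "maps K omega C" for K
  proof -
    let ?V = "union_seq K"
    have V: "?V \<sqsubseteq> baire" by (simp add: subs_def)
    have "\<not> (lle B ?V \<and> lle (cpl B) ?V)"
    proof
      assume "lle B ?V \<and> lle (cpl B) ?V"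
      then obtain u v where u: "lips u" "B = pre u ?V" and v: "lips v" "cpl B = pre v ?V" unfolding lle_def by blast
      have pu: "maps (Lam omega (\<lambda>n. pre w (ap K n))) omega C \<and> pre w ?V = union_seq (Lam omega (\<lambda>n. pre w (ap K n)))"
        if w: "lips w" for w
      proof -
        have d: "dt (\<lambda>e. pre w (ap K (e 0)))" by (intro dfi)
        show ?thesis
          by (intro conjI Lam_maps[OF d] algD(4)[OF C(1) w] ap_in[OF K] set_ext)
            (auto simp: ap_Lam[OF d] intro: ap_in[OF lips_maps[OF w]])
      qed
      have "\<exists>q. bpart q \<and> fib q zero = emp \<and> (\<forall>n. n \<epsilon> omega \<longrightarrow> fib q (succ n) \<epsilon> C \<and> cap B (fib q (succ n)) \<epsilon> C)"
        by (rule part_total[OF C(1) B, of "Lam omega (\<lambda>n. pre u (ap K n))" _ "Lam omega (\<lambda>n. pre v (ap K n))"])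
          (use pu[OF u(1)] pu[OF v(1)] u(2) v(2) Bb in auto)
      then obtain q where q: "bpart q" "fib q zero = emp"
        "\<forall>n. n \<epsilon> omega \<longrightarrow> fib q (succ n) \<epsilon> C \<and> cap B (fib q (succ n)) \<epsilon> C" by blast
      have "emp \<sqsubseteq> B" by (simp add: subs_def)
      then have "B \<epsilon> C" using C(2)[unfolded glue_def, rule_format, of q B] q Bb by simp
      then show False using B(2) by blast
    qed
    then have b: "bpart (part K)" using part_cases[OF C(1) B K] by blast
    have c: "cap ?V (fib (part K) (succ n)) = fib (part K) (succ n)" if n: "n \<epsilon> omega" for n
    proof (rule set_ext)
      fix x show "x \<epsilon> cap ?V (fib (part K) (succ n)) \<longleftrightarrow> x \<epsilon> fib (part K) (succ n)"
        unfolding mem_cap part(3)[OF n] mem_union_seq using n by blast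
    qed
    have "cap ?V (fib (part K) zero) = emp" unfolding part(2) by (rule set_ext) auto
    then show ?thesis
      using C(2)[unfolded glue_def, rule_format, of "part K" ?V] b V c alg_part[OF C(1) K] by simp
  qed
  have "B \<epsilon> C"
    by (rule luzin[OF CL algD(5)[OF C(1)] algD(2)[OF C(1)] algD(3)[OF C(1)] un Bb sig_L[OF B(1)] sig_L[OF L_cpl[OF B(1)]]])
  then show False using B(2) by blast
qed

definition Res :: 'm where "Res = Sep (pow baire) (\<lambda>B. \<exists>q. q \<epsilon> Q \<and> res B q)"

lemma mem_Res: "B \<epsilon> Res \<longleftrightarrow> B \<sqsubseteq> baire \<and> (\<exists>q. q \<epsilon> Q \<and> res B q)"
proof -
  have "df (\<lambda>e. \<exists>q. q \<epsilon> Q \<and> res (e 0) q)" by (intro dfi)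
  from mem_Sep[OF this] show ?thesis unfolding Res_def by simp
qed

lemma Res_two:
  assumes "B \<epsilon> Res" "B' \<epsilon> Res" shows "\<exists>q. q \<epsilon> Q \<and> res B q \<and> res B' q"
proof -
  obtain q1 where q1: "q1 \<epsilon> Q" "res B q1" using assms(1) unfolding mem_Res by blast
  obtain q2 where q2: "q2 \<epsilon> Q" "res B' q2" using assms(2) unfolding mem_Res by blast
  obtain q where q: "q \<epsilon> Q" "finer q q1" "finer q q2" using Q_join2[OF q1(1) q2(1)] by blast
  then show ?thesis using res_finer[OF q(2) Q_maps[OF q(1)] q1(2)] res_finer[OF q(3) Q_maps[OF q(1)] q2(2)] by blast
qed

lemma alg_Res: "alg Res"
  unfolding alg_def
proof (intro conjI allI impI)
  fix X assume X: "X \<epsilon> Res"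
  then show "X \<sqsubseteq> baire" unfolding mem_Res by blast
  show "cpl X \<epsilon> Res" using X res_cpl unfolding mem_Res by auto
next
  fix X Y assume "X \<epsilon> Res \<and> Y \<epsilon> Res"
  then obtain q where "q \<epsilon> Q" "res X q" "res Y q" using Res_two by blast
  then show "cap X Y \<epsilon> Res" using res_cap unfolding mem_Res by auto
next
  fix u X assume uX: "lips u \<and> X \<epsilon> Res"
  then obtain q where q: "q \<epsilon> Q" "res X q" unfolding mem_Res by blast
  note um = lips_maps[OF conjunct1[OF uX]]
  have r: "res (pre u X) (cmps q u)" unfolding res_def
  proof (intro allI impI)
    fix x y assume xy: "x \<epsilon> baire \<and> y \<epsilon> baire"
    obtain k where k: "k \<epsilon> omega" "\<And>x'. x' \<epsilon> baire \<Longrightarrow> agree k x' (ap u x) \<Longrightarrow> agree k (ap q x') y \<Longrightarrow> (x' \<epsilon> X \<longleftrightarrow> ap u x \<epsilon> X)"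
      using resD[OF q(2) ap_in[OF um]] xy by blast
    show "\<exists>k. k \<epsilon> omega \<and> (\<forall>x'. x' \<epsilon> baire \<and> agree k x' x \<and> agree k (ap (cmps q u) x') y \<longrightarrow> (x' \<epsilon> pre u X \<longleftrightarrow> x \<epsilon> pre u X))"
    proof (intro exI[of _ k] conjI k(1) allI impI)
      fix x' assume x': "x' \<epsilon> baire \<and> agree k x' x \<and> agree k (ap (cmps q u) x') y"
      have "agree k (ap u x') (ap u x)" using lips_agree uX x' xy k(1) by blast
      moreover have "agree k (ap q (ap u x')) y" using x' ap_cmps[of x' q u] by simp
      ultimately show "x' \<epsilon> pre u X \<longleftrightarrow> x \<epsilon> pre u X" using k(2)[of "ap u x'"] ap_in[OF um] x' xy by simp
    qed
  qed
  have "cmps q u \<epsilon> Q" by (rule Q_cmps[OF q(1) lips_F[OF conjunct1[OF uX]]])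
  then show "pre u X \<epsilon> Res" unfolding mem_Res by (intro conjI pre_subs exI[of _ "cmps q u"] r)
next
  fix x n assume xn: "x \<epsilon> baire \<and> n \<epsilon> omega"
  have "res (cone_at n x) idb" unfolding res_def
  proof (intro allI impI exI[of _ n] conjI)
    fix z y x' assume "z \<epsilon> baire \<and> y \<epsilon> baire" "x' \<epsilon> baire \<and> agree n x' z \<and> agree n (ap idb x') y"
    then show "x' \<epsilon> cone_at n x \<longleftrightarrow> z \<epsilon> cone_at n x" using agree_trans[of n x x' z] agree_trans[of n x z x'] agree_sym[of n x' z] by auto
  qed (use xn in blast)
  moreover have "cone_at n x \<sqsubseteq> baire" by (simp add: subs_def)
  ultimately show "cone_at n x \<epsilon> Res" unfolding mem_Res using idb_Q by blast
qed

text \<open>The map \<open>q\<close> joins resolutions of all the pieces with \<open>q0\<close>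
  itself. A limit \<open>y\<close> of values of \<open>q\<close> thereby fixes the fibre
  \<open>j\<close> of the nearby points, although the limit \<open>x\<close> may lie in another
  fibre.\<close>

lemma glue_Res: "glue Res"
  unfolding glue_def
proof (intro allI impI, elim conjE)
  fix q0 X
  assume q0: "bpart q0" and X: "X \<sqsubseteq> baire"
    and K: "\<forall>n. n \<epsilon> omega \<longrightarrow> fib q0 (succ n) \<epsilon> Res \<and> cap X (fib q0 (succ n)) \<epsilon> Res"
    and Z: "cap X (fib q0 zero) = emp \<or> fib q0 zero \<sqsubseteq> X"
  have "\<exists>s. maps s omega Q \<and> (\<forall>n. n \<epsilon> omega \<longrightarrow>
      (\<lambda>n q. res (fib q0 (succ n)) q \<and> res (cap X (fib q0 (succ n))) q) n (ap s n))"
    by (rule countable_choice[OF _ coded_Q], intro dfi) (use K Res_two in blast)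
  then obtain s where s: "maps s omega Q"
    "\<And>n. n \<epsilon> omega \<Longrightarrow> res (fib q0 (succ n)) (ap s n) \<and> res (cap X (fib q0 (succ n))) (ap s n)" by blast
  obtain q1 where q1: "q1 \<epsilon> Q" "\<And>j. j \<epsilon> omega \<Longrightarrow> finer q1 (ap s j)" using Q_join[OF s(1)] by blast
  \<comment> \<open>Elements of \<open>Q\<close> have infinitely many digits, so \<open>q0\<close>
    is repeated in all of them.\<close>
  define q0' where "q0' = Lam baire (\<lambda>x. cst (ap q0 x))"
  have d: "dt (\<lambda>e. cst (ap q0 (e 0)))" by (intro dfi)
  have q0'a: "ap q0' x = cst (ap q0 x)" if "x \<epsilon> baire" for x unfolding q0'_def by (rule ap_Lam[OF d that])
  have q0'm: "maps q0' baire baire" unfolding q0'_def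
    by (rule Lam_maps[OF d]) (intro cst_baire ap_in[OF bpart_maps[OF q0]])
  have "dig q0' i = q0" if i: "i \<epsilon> omega" for i
    by (rule maps_ext[OF dig_maps[OF q0'm i] bpart_maps[OF q0]]) (simp add: ap_dig q0'a i)
  then have "q0' \<epsilon> Q" unfolding mem_Q using q0 q0'm by simp
  from Q_join2[OF q1(1) this] obtain q where q: "q \<epsilon> Q" "finer q q1" "finer q q0'" by blast
  note qm = Q_maps[OF q(1)]
  have r: "res (fib q0 (succ n)) q" "res (cap X (fib q0 (succ n))) q" if n: "n \<epsilon> omega" for n
    using res_finer[OF q(2) qm res_finer[OF q1(2)[OF n] Q_maps[OF q1(1)]]] s(2)[OF n] by blast+
  obtain t where t: "maps t omega omega" "\<And>x i. x \<epsilon> baire \<Longrightarrow> i \<epsilon> omega \<Longrightarrow> ap (ap q0' x) i = ap (ap q x) (ap t i)"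
    using q(3) unfolding finer_def by blast
  let ?t = "ap t zero"
  have to: "?t \<epsilon> omega" using ap_in[OF t(1)] by simp
  have q0q: "ap q0 x = ap (ap q x) ?t" if "x \<epsilon> baire" for x using t(2)[OF that zero_omega] q0'a[OF that] by simp
  have "res X q" unfolding res_def
  proof (intro allI impI, elim conjE)
    fix x y assume x: "x \<epsilon> baire" and y: "y \<epsilon> baire"
    define j where "j = ap y ?t"
    have j: "j \<epsilon> omega" unfolding j_def using baire_ap[OF y to] .
    have jx: "ap q0 x \<epsilon> omega" using ap_in[OF bpart_maps[OF q0] x] .
    have fibj: "ap q0 x' = j" if "x' \<epsilon> baire" "agree k (ap q x') y" "?t \<epsilon> k" for x' k
      using that q0q unfolding agree_def j_def by simp
    have key: "\<exists>k. k \<epsilon> omega \<and> (\<forall>x'. x' \<epsilon> baire \<and> agree k x' x \<and> agree k (ap q x') y \<longrightarrow> (x' \<epsilon> X \<longleftrightarrow> x \<epsilon> X))"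
      if r': "res B q" and B: "\<And>x'. x' \<epsilon> baire \<Longrightarrow> ap q0 x' = j \<Longrightarrow> (x' \<epsilon> B \<longleftrightarrow> x \<epsilon> B) \<Longrightarrow> (x' \<epsilon> X \<longleftrightarrow> x \<epsilon> X)" for B
    proof -
      obtain k where k: "k \<epsilon> omega" "\<And>x'. x' \<epsilon> baire \<Longrightarrow> agree k x' x \<Longrightarrow> agree k (ap q x') y \<Longrightarrow> (x' \<epsilon> B \<longleftrightarrow> x \<epsilon> B)"
        using resD[OF r' x y] by blast
      obtain m where m: "m \<epsilon> omega" "k \<epsilon> m" "?t \<epsilon> m" using omega_max[OF k(1) to] by blast
      show ?thesis
      proof (intro exI[of _ m] conjI m(1) allI impI, elim conjE)
        fix x' assume x': "x' \<epsilon> baire" "agree m x' x" "agree m (ap q x') y"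
        show "x' \<epsilon> X \<longleftrightarrow> x \<epsilon> X"
          using B[OF x'(1) fibj[OF x'(1) x'(3) m(3)]] k(2)[OF x'(1)] agree_mono[OF x'(2) m(2,1)] agree_mono[OF x'(3) m(2,1)]
          by blast
      qed
    qed
    \<comment> \<open>In \<open>b\<close> and \<open>d\<close> the limit lies outside the fibre
      \<open>j\<close> of the nearby points, and resolving a fibre shows that no such points remain
      at a large depth. The resolved fibre is that of \<open>j\<close> in \<open>b\<close> and that
      of \<open>x\<close> in \<open>d\<close>, because fibre \<open>zero\<close> comes without a
      resolution. In \<open>c\<close> the set \<open>X\<close> is constant on fibre
      \<open>zero\<close>.\<close>
    consider (a) n where "n \<epsilon> omega" "j = succ n" "ap q0 x = j" | (b) n where "n \<epsilon> omega" "j = succ n" "ap q0 x \<noteq> j"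
      | (c) "j = zero" "ap q0 x = zero" | (d) n where "n \<epsilon> omega" "j = zero" "ap q0 x = succ n"
      using omega_cases[OF j] omega_cases[OF jx] by blast
    then show "\<exists>k. k \<epsilon> omega \<and> (\<forall>x'. x' \<epsilon> baire \<and> agree k x' x \<and> agree k (ap q x') y \<longrightarrow> (x' \<epsilon> X \<longleftrightarrow> x \<epsilon> X))"
    proof cases
      case a
      show ?thesis by (rule key[OF r(2)[OF a(1)]]) (use a x in auto)
    next
      case b
      show ?thesis by (rule key[OF r(1)[OF b(1)]]) (use b x in auto)
    next
      case c
      have "res baire q" unfolding res_def by (intro allI impI exI[of _ zero]) simp
      then show ?thesis
      proof (rule key)
        fix x' assume x': "x' \<epsilon> baire" "ap q0 x' = j"
        have "x \<epsilon> fib q0 zero" "x' \<epsilon> fib q0 zero" using c x x' by simp_all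
        then show "x' \<epsilon> X \<longleftrightarrow> x \<epsilon> X" using Z x x'(1) mem_cap mem_emp unfolding subs_def by metis
      qed
    next
      case d
      show ?thesis by (rule key[OF r(1)[OF d(1)]]) (use d x succ_not_zero[of n] in auto)
    qed
  qed
  then show "X \<epsilon> Res" unfolding mem_Res using X q(1) by blast
qed

lemma L_Res: "L \<sqsubseteq> Res" by (rule L_glue[OF alg_Res glue_Res])

section \<open>The algebra generated by \<open>L\<close>\<close>

definition ba :: "'m \<Rightarrow> bool" where
  "ba C \<longleftrightarrow> (\<forall>X. X \<epsilon> C \<longrightarrow> cpl X \<epsilon> C) \<and> (\<forall>X Y. X \<epsilon> C \<and> Y \<epsilon> C \<longrightarrow> cap X Y \<epsilon> C)"

lemma df_ba [dfi]: "dt s \<Longrightarrow> df (\<lambda>e. ba (s e))"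
  by (rule df1[of ba], unfold ba_def, intro dfi)

lemma alg_ba: "alg C \<Longrightarrow> ba C" unfolding ba_def using algD by blast

definition Lst :: 'm where
  "Lst = Sep (pow baire) (\<lambda>X. \<forall>C. L \<sqsubseteq> C \<and> ba C \<longrightarrow> X \<epsilon> C)"

lemma mem_Lst: "X \<epsilon> Lst \<longleftrightarrow> X \<sqsubseteq> baire \<and> (\<forall>C. L \<sqsubseteq> C \<and> ba C \<longrightarrow> X \<epsilon> C)"
proof -
  have "df (\<lambda>e. \<forall>C. L \<sqsubseteq> C \<and> ba C \<longrightarrow> e 0 \<epsilon> C)" by (intro dfi)
  from mem_Sep[OF this] show ?thesis unfolding Lst_def by simp
qed

lemma L_Lst: "X \<epsilon> L \<Longrightarrow> X \<epsilon> Lst" unfolding mem_Lst using L_subs subsD by blast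
lemma Lst_subs: "X \<epsilon> Lst \<Longrightarrow> X \<sqsubseteq> baire" unfolding mem_Lst by blast
lemma Lst_cap: "X \<epsilon> Lst \<Longrightarrow> Y \<epsilon> Lst \<Longrightarrow> cap X Y \<epsilon> Lst" unfolding mem_Lst ba_def by simp

text \<open>The sets whose preimage lies in a given algebra above \<open>L\<close> form an algebra
  above \<open>L\<close> in turn.\<close>

lemma Lst_pre: assumes f: "f \<epsilon> F" and X: "X \<epsilon> Lst" shows "pre f X \<epsilon> Lst"
  unfolding mem_Lst
proof (intro conjI pre_subs allI impI, elim conjE)
  fix C assume C: "L \<sqsubseteq> C" "ba C"
  define C' where "C' = Sep (pow baire) (\<lambda>Y. pre f Y \<epsilon> C)"
  have C': "Y \<epsilon> C' \<longleftrightarrow> Y \<epsilon> pow baire \<and> pre f Y \<epsilon> C" for Y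
    unfolding C'_def by (rule mem_Sep) (intro dfi)
  have "L \<sqsubseteq> C'" using C(1) L_pre[OF f] L_subs unfolding subs_def[of L] C' by simp
  moreover have "ba C'" using C(2) unfolding ba_def C' by (simp add: pre_cpl[OF F_maps[OF f]] pre_cap[OF F_maps[OF f]])
  ultimately have "X \<epsilon> C'" using X unfolding mem_Lst by blast
  then show "pre f X \<epsilon> C" unfolding C' by blast
qed

lemma Lst_Res: "X \<epsilon> Lst \<Longrightarrow> X \<epsilon> Res" unfolding mem_Lst using L_Res alg_ba[OF alg_Res] by blast

end

section \<open>Large sets\<close>

text \<open>\<open>H\<close> denies the decomposition: some piece is not strictly below
  \<open>A\<close>, that is, if the piece reduces to \<open>A\<close> then \<open>A\<close> reduces
  to the piece.\<close>

locale no_decomposition = breds mem F for mem :: "'m \<Rightarrow> 'm \<Rightarrow> bool" (infix "\<epsilon>" 50) and F +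
  fixes A f
  assumes A_subs: "A \<sqsubseteq> baire" and f_F: "f \<epsilon> F" and A_f: "A = pre f (cpl A)" and A_L: "\<not> A \<epsilon> L"
    and H: "maps D omega L \<Longrightarrow>
      (\<And>n m. n \<epsilon> omega \<Longrightarrow> m \<epsilon> omega \<Longrightarrow> n \<noteq> m \<Longrightarrow> cap (ap D n) (ap D m) = emp) \<Longrightarrow>
      (\<And>x. x \<epsilon> baire \<Longrightarrow> \<exists>n. n \<epsilon> omega \<and> x \<epsilon> ap D n) \<Longrightarrow>
      B \<epsilon> L \<Longrightarrow> (\<And>n. n \<epsilon> omega \<Longrightarrow> lle (ap D n) B) \<Longrightarrow>
      \<exists>n. n \<epsilon> omega \<and> ((\<exists>h. h \<epsilon> F \<and> cap A (ap D n) = pre h A) \<longrightarrow> (\<exists>h. h \<epsilon> F \<and> A = pre h (cap A (ap D n))))"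
begin

definition lg :: "'m \<Rightarrow> bool" where "lg Y \<longleftrightarrow> (\<exists>h. h \<epsilon> F \<and> A = pre h Y)"

lemma df_lg [dfi]: "dt s \<Longrightarrow> df (\<lambda>e. lg (s e))"
  by (rule df1[of lg], unfold lg_def, intro dfi)

lemma lg_A: "lg A"
  unfolding lg_def using lips_F[OF lips_idb] pre_idb[OF A_subs] by metis

lemma lg_pre: "k \<epsilon> F \<Longrightarrow> lg (pre k Y) \<Longrightarrow> lg Y"
  unfolding lg_def using pre_cmps[OF F_maps] F_comp by metis

lemma not_lg_L: "X \<epsilon> L \<Longrightarrow> \<not> lg X"
  unfolding lg_def using L_pre A_L by blast

lemma emp_L: "emp \<epsilon> L" by (rule fd_L[OF emp_subs zero_omega]) simp

lemma lg_nonempty: "lg Y \<Longrightarrow> \<exists>x. x \<epsilon> baire \<and> x \<epsilon> Y"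
proof (rule ccontr)
  assume "lg Y" and n: "\<not> (\<exists>x. x \<epsilon> baire \<and> x \<epsilon> Y)"
  then obtain h where h: "h \<epsilon> F" "A = pre h Y" unfolding lg_def by blast
  have "A = emp" unfolding h(2)
  proof (rule set_ext)
    fix x show "x \<epsilon> pre h Y \<longleftrightarrow> x \<epsilon> emp" using n ap_in[OF F_maps[OF h(1)]] by auto
  qed
  then show False using A_L emp_L by simp
qed

text \<open>If the piece does not reduce to \<open>A\<close> by a Lipschitz map, SLO reduces the
  complement of \<open>A\<close> to the piece, and composition with \<open>f\<close> reduces
  \<open>A\<close> to it. So the implication in \<open>H\<close> always yields a large
  piece.\<close>

lemma lg_piece: "(\<exists>h. h \<epsilon> F \<and> cap A D = pre h A) \<longrightarrow> lg (cap A D) \<Longrightarrow> lg (cap A D)"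
proof (cases "lle (cap A D) A")
  case True
  assume i: "(\<exists>h. h \<epsilon> F \<and> cap A D = pre h A) \<longrightarrow> lg (cap A D)"
  then show ?thesis using True lips_F unfolding lle_def by blast
next
  case False
  then have "lle (cpl A) (cap A D)" using SLO[OF cap_subs A_subs] by blast
  then obtain u where u: "lips u" "cpl A = pre u (cap A D)" unfolding lle_def by blast
  have "A = pre (cmps u f) (cap A D)"
    unfolding pre_cmps[OF F_maps[OF f_F]] u(2)[symmetric] by (rule A_f)
  then show ?thesis unfolding lg_def using F_comp[OF lips_F[OF u(1)] f_F] by blast
qed

text \<open>The partition is pulled back along a reduction of \<open>A\<close> to \<open>Y\<close>;
  a large piece of \<open>A\<close> is then the preimage of a piece of \<open>Y\<close>.\<close>

lemma lg_part:
  assumes Y: "lg Y" and q: "bpart q"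
  shows "\<exists>n. n \<epsilon> omega \<and> lg (cap Y (fib q n))"
proof -
  obtain k where k: "k \<epsilon> F" "A = pre k Y" using Y unfolding lg_def by blast
  let ?q = "cmps q k"
  have b: "bpart ?q" by (rule bpart_pre[OF k(1) q])
  define D where "D = Lam omega (\<lambda>n. fib ?q n)"
  have d: "dt (\<lambda>e. fib ?q (e 0))" by (intro dfi)
  have D: "ap D n = fib ?q n" if "n \<epsilon> omega" for n unfolding D_def by (rule ap_Lam[OF d that])
  obtain B where B: "B \<epsilon> L" "\<forall>n. n \<epsilon> omega \<longrightarrow> lle (fib ?q n) B" using b unfolding bpart_def by blast
  have "\<exists>n. n \<epsilon> omega \<and> ((\<exists>h. h \<epsilon> F \<and> cap A (ap D n) = pre h A) \<longrightarrow> (\<exists>h. h \<epsilon> F \<and> A = pre h (cap A (ap D n))))"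
  proof (rule H)
    show "maps D omega L" unfolding D_def by (rule Lam_maps[OF d bpart_fib[OF b]])
    show "cap (ap D n) (ap D m) = emp" if "n \<epsilon> omega" "m \<epsilon> omega" "n \<noteq> m" for n m
      by (rule set_ext) (use that D in auto)
    show "\<exists>n. n \<epsilon> omega \<and> x \<epsilon> ap D n" if "x \<epsilon> baire" for x
      using ap_in[OF bpart_maps[OF b] that] D that by (intro exI[of _ "ap ?q x"]) simp
    show "B \<epsilon> L" "n \<epsilon> omega \<Longrightarrow> lle (ap D n) B" for n using B D by simp_all
  qed
  then obtain n where n: "n \<epsilon> omega" "lg (cap A (fib ?q n))"
    using D lg_piece unfolding lg_def by metis
  have "cap A (fib ?q n) = pre k (cap Y (fib q n))"
    unfolding pre_cap[OF F_maps[OF k(1)]] fib_cmps[OF F_maps[OF k(1)]] k(2)[symmetric] ..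
  then have "lg (cap Y (fib q n))" using n(2) lg_pre[OF k(1)] by simp
  then show ?thesis using n(1) by blast
qed

lemma lg_two:
  assumes "lg Y" "D \<epsilon> L" shows "lg (cap Y D) \<or> lg (cap Y (cpl D))"
proof -
  obtain q where q: "bpart q" "fib q zero = D" "fib q one = cpl D"
    "\<And>n. n \<epsilon> omega \<Longrightarrow> n \<noteq> zero \<Longrightarrow> n \<noteq> one \<Longrightarrow> fib q n = emp" using bpart_two[OF assms(2)] by blast
  obtain n where n: "n \<epsilon> omega" "lg (cap Y (fib q n))" using lg_part[OF assms(1) q(1)] by blast
  have "fib q n \<noteq> emp" using lg_nonempty[OF n(2)] unfolding mem_cap by (metis mem_emp)
  then have "n = zero \<or> n = one" using q(4)[OF n(1)] by blast
  then show ?thesis using n(2) q(2,3) by auto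
qed

section \<open>Keeping \<open>A\<close> outside the algebra generated by \<open>L\<close>\<close>

definition sgm :: "'m \<Rightarrow> 'm \<Rightarrow> bool" where
  "sgm C V \<longleftrightarrow> (\<exists>K. maps K omega C \<and> V = union_seq K)"

lemma df_sgm [dfi]: "dt s \<Longrightarrow> dt t \<Longrightarrow> df (\<lambda>e. sgm (s e) (t e))"
  by (rule df2[of sgm], unfold sgm_def, intro dfi)

lemma sgm_self: "X \<epsilon> C \<Longrightarrow> X \<sqsubseteq> baire \<Longrightarrow> sgm C X"
proof -
  assume X: "X \<epsilon> C" "X \<sqsubseteq> baire"
  have "X = union_seq (cst X)"
    by (rule set_ext) (use X(2) zero_omega in \<open>auto simp: subs_def simp del: zero_omega\<close>)
  then show ?thesis unfolding sgm_def using cst_maps[OF X(1)] by blast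
qed

lemma sgm_pre: "alg C \<Longrightarrow> lips w \<Longrightarrow> sgm C V \<Longrightarrow> sgm C (pre w V)"
proof -
  assume C: "alg C" and w: "lips w" and "sgm C V"
  then obtain K where K: "maps K omega C" "V = union_seq K" unfolding sgm_def by blast
  have d: "dt (\<lambda>e. pre w (ap K (e 0)))" by (intro dfi)
  have "maps (Lam omega (\<lambda>n. pre w (ap K n))) omega C"
    by (intro Lam_maps[OF d] algD(4)[OF C w] ap_in[OF K(1)])
  moreover have "pre w V = union_seq (Lam omega (\<lambda>n. pre w (ap K n)))"
    unfolding K(2) by (rule set_ext) (auto simp: ap_Lam[OF d] intro: ap_in[OF lips_maps[OF w]])
  ultimately show ?thesis unfolding sgm_def by blast
qed

lemma sgm_cup: "alg C \<Longrightarrow> sgm C V \<Longrightarrow> sgm C W \<Longrightarrow> sgm C (cup V W)"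
proof -
  assume C: "alg C" and "sgm C V" "sgm C W"
  then obtain K K' where K: "maps K omega C" "V = union_seq K" and K': "maps K' omega C" "W = union_seq K'"
    unfolding sgm_def by blast
  have d: "dt (\<lambda>e. cup (ap K (e 0)) (ap K' (e 0)))" by (intro dfi)
  have "maps (Lam omega (\<lambda>n. cup (ap K n) (ap K' n))) omega C"
    by (intro Lam_maps[OF d] alg_cup[OF C] ap_in[OF K(1)] ap_in[OF K'(1)])
  moreover have "cup V W = union_seq (Lam omega (\<lambda>n. cup (ap K n) (ap K' n)))"
    unfolding K(2) K'(2) by (rule set_ext) (auto simp: ap_Lam[OF d] mem_cup)
  ultimately show ?thesis unfolding sgm_def by blast
qed

text \<open>The largest Lipschitz-closed algebra inside \<open>L\<close>. By SLO, the algebras of this kind form a chain.\<close>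

definition M :: 'm where "M = Sep L (\<lambda>D. \<exists>C. alg C \<and> C \<sqsubseteq> L \<and> D \<epsilon> C)"

lemma mem_M: "D \<epsilon> M \<longleftrightarrow> (\<exists>C. alg C \<and> C \<sqsubseteq> L \<and> D \<epsilon> C)"
proof -
  have "df (\<lambda>e. \<exists>C. alg C \<and> C \<sqsubseteq> L \<and> e 0 \<epsilon> C)" by (intro dfi)
  from mem_Sep[OF this] show ?thesis unfolding M_def subs_def by auto
qed

lemma M_L: "M \<sqsubseteq> L" unfolding subs_def mem_M by blast

lemma alg_M: "alg M"
proof -
  \<comment> \<open>The finitely determined sets are an algebra inside \<open>L\<close>; this puts
    the cones into \<open>M\<close>.\<close>
  define FD where "FD = Sep (pow baire) (\<lambda>X. \<exists>n. n \<epsilon> omega \<and>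
    (\<forall>x y. x \<epsilon> baire \<and> y \<epsilon> baire \<and> agree n x y \<longrightarrow> (x \<epsilon> X \<longleftrightarrow> y \<epsilon> X)))"
  have FD: "X \<epsilon> FD \<longleftrightarrow> X \<epsilon> pow baire \<and> (\<exists>n. n \<epsilon> omega \<and>
    (\<forall>x y. x \<epsilon> baire \<and> y \<epsilon> baire \<and> agree n x y \<longrightarrow> (x \<epsilon> X \<longleftrightarrow> y \<epsilon> X)))" for X
    unfolding FD_def by (rule mem_Sep) (intro dfi)
  have aFD: "alg FD" unfolding alg_def
  proof (intro conjI allI impI)
    fix X assume X: "X \<epsilon> FD"
    then show "X \<sqsubseteq> baire" unfolding FD by simp
    show "cpl X \<epsilon> FD" using X unfolding FD by auto
  next
    fix X Y assume "X \<epsilon> FD \<and> Y \<epsilon> FD"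
    then obtain n m where n: "n \<epsilon> omega" "\<forall>x y. x \<epsilon> baire \<and> y \<epsilon> baire \<and> agree n x y \<longrightarrow> (x \<epsilon> X \<longleftrightarrow> y \<epsilon> X)"
      and m: "m \<epsilon> omega" "\<forall>x y. x \<epsilon> baire \<and> y \<epsilon> baire \<and> agree m x y \<longrightarrow> (x \<epsilon> Y \<longleftrightarrow> y \<epsilon> Y)" unfolding FD by blast
    obtain k where k: "k \<epsilon> omega" "n \<epsilon> k" "m \<epsilon> k" using omega_max[OF n(1) m(1)] by blast
    have "x \<epsilon> cap X Y \<longleftrightarrow> y \<epsilon> cap X Y" if "x \<epsilon> baire" "y \<epsilon> baire" "agree k x y" for x y
      using n(2)[rule_format, of x y] m(2)[rule_format, of x y] that agree_mono[OF that(3) k(2,1)] agree_mono[OF that(3) k(3,1)] by simp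
    then show "cap X Y \<epsilon> FD" unfolding FD mem_pow using k(1) cap_subs by blast
  next
    fix u X assume uX: "lips u \<and> X \<epsilon> FD"
    then obtain n where n: "n \<epsilon> omega" "\<forall>x y. x \<epsilon> baire \<and> y \<epsilon> baire \<and> agree n x y \<longrightarrow> (x \<epsilon> X \<longleftrightarrow> y \<epsilon> X)" unfolding FD by blast
    note u = conjunct1[OF uX]
    have "x \<epsilon> pre u X \<longleftrightarrow> y \<epsilon> pre u X" if "x \<epsilon> baire" "y \<epsilon> baire" "agree n x y" for x y
      using n(2)[rule_format, of "ap u x" "ap u y"] lips_agree[OF u that(1,2) n(1) that(3)] that ap_in[OF lips_maps[OF u]] by simp
    then show "pre u X \<epsilon> FD" unfolding FD mem_pow using n(1) pre_subs by blast
  next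
    fix x n assume xn: "x \<epsilon> baire \<and> n \<epsilon> omega"
    have "y \<epsilon> cone_at n x \<longleftrightarrow> z \<epsilon> cone_at n x" if "y \<epsilon> baire" "z \<epsilon> baire" "agree n y z" for y z
      using that agree_trans[of n x y z] agree_trans[of n x z y] agree_sym[of n y z] by auto
    moreover have "cone_at n x \<sqsubseteq> baire" by (simp add: subs_def)
    ultimately show "cone_at n x \<epsilon> FD" unfolding FD mem_pow using xn by blast
  qed
  have FDL: "FD \<sqsubseteq> L"
  proof (rule subsI)
    fix X assume "X \<epsilon> FD"
    then obtain n where "X \<sqsubseteq> baire" "n \<epsilon> omega"
      "\<forall>x y. x \<epsilon> baire \<and> y \<epsilon> baire \<and> agree n x y \<longrightarrow> (x \<epsilon> X \<longleftrightarrow> y \<epsilon> X)" unfolding FD mem_pow by blast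
    then show "X \<epsilon> L" using fd_L by blast
  qed
  show ?thesis unfolding alg_def
  proof (intro conjI allI impI)
    fix X assume "X \<epsilon> M"
    then obtain C where C: "alg C" "C \<sqsubseteq> L" "X \<epsilon> C" unfolding mem_M by blast
    show "X \<sqsubseteq> baire" using algD(1)[OF C(1,3)] .
    show "cpl X \<epsilon> M" unfolding mem_M using algD(2)[OF C(1,3)] C by blast
  next
    fix X Y assume "X \<epsilon> M \<and> Y \<epsilon> M"
    then obtain C C' where C: "alg C" "C \<sqsubseteq> L" "X \<epsilon> C" and C': "alg C'" "C' \<sqsubseteq> L" "Y \<epsilon> C'" unfolding mem_M by blast
    show "cap X Y \<epsilon> M"
    proof (cases "X \<epsilon> C'")
      case True
      then show ?thesis unfolding mem_M using algD(3)[OF C'(1) True C'(3)] C' by blast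
    next
      case False
      \<comment> \<open>Two algebras are compared through \<open>initial\<close>: as
        \<open>X\<close> is outside the second, every member of the second reduces to
        \<open>X\<close> and so belongs to the first.\<close>
      have "lle Y X" by (rule initial[OF C'(1) algD(1)[OF C(1,3)] False C'(3)])
      then have "Y \<epsilon> C" unfolding lle_def using algD(4)[OF C(1) _ C(3)] by blast
      then show ?thesis unfolding mem_M using algD(3)[OF C(1,3)] C by blast
    qed
  next
    fix u X assume uX: "lips u \<and> X \<epsilon> M"
    then obtain C where C: "alg C" "C \<sqsubseteq> L" "X \<epsilon> C" unfolding mem_M by blast
    show "pre u X \<epsilon> M" unfolding mem_M using algD(4)[OF C(1) conjunct1[OF uX] C(3)] C by blast
  next
    fix x n assume "x \<epsilon> baire \<and> n \<epsilon> omega"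
    then show "cone_at n x \<epsilon> M" unfolding mem_M using algD(5)[OF aFD] aFD FDL by blast
  qed
qed

lemma cap_cap: "cap (cap X Y) Z = cap X (cap Y Z)" by (rule set_ext) auto
lemma cap_eqI: "X \<sqsubseteq> Y \<Longrightarrow> X \<sqsubseteq> baire \<Longrightarrow> cap Y X = X" by (rule set_ext) (auto simp: subs_def)
lemma cap_emp: "cap X emp = emp" by (rule set_ext) auto
lemma cap_comm: "cap X Y = cap Y X" by (rule set_ext) auto

definition dcd :: "'m \<Rightarrow> 'm \<Rightarrow> bool" where
  "dcd P X \<longleftrightarrow> P \<sqsubseteq> X \<or> cap P X = emp"

lemma df_dcd [dfi]: "dt s \<Longrightarrow> dt t \<Longrightarrow> df (\<lambda>e. dcd (s e) (t e))"
  by (rule df2[of dcd], unfold dcd_def, intro dfi)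

lemma dcd_cpl: "P \<sqsubseteq> baire \<Longrightarrow> dcd P X \<Longrightarrow> dcd P (cpl X)"
proof -
  assume P: "P \<sqsubseteq> baire" and "dcd P X"
  then consider "P \<sqsubseteq> X" | "cap P X = emp" unfolding dcd_def by blast
  then show ?thesis
  proof cases
    case 1
    then have "cap P (cpl X) = emp" by (intro set_ext) (auto simp: subs_def)
    then show ?thesis unfolding dcd_def by blast
  next
    case 2
    have "P \<sqsubseteq> cpl X"
    proof (rule subsI)
      fix x assume x: "x \<epsilon> P"
      then have "x \<epsilon> baire" using P unfolding subs_def by blast
      then show "x \<epsilon> cpl X" using x 2 mem_cap[of x P X] by auto
    qed
    then show ?thesis unfolding dcd_def by blast
  qed
qed

lemma dcd_cap: "dcd P X \<Longrightarrow> dcd P' X' \<Longrightarrow> dcd (cap P P') (cap X X')"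
proof -
  assume "dcd P X" "dcd P' X'"
  then consider "P \<sqsubseteq> X" "P' \<sqsubseteq> X'" | "cap P X = emp \<or> cap P' X' = emp" unfolding dcd_def by blast
  then show ?thesis
  proof cases
    case 1
    then have "cap P P' \<sqsubseteq> cap X X'" unfolding subs_def by auto
    then show ?thesis unfolding dcd_def by blast
  next
    case 2
    have "x \<epsilon> cap (cap P P') (cap X X') \<Longrightarrow> x \<epsilon> cap P X \<and> x \<epsilon> cap P' X'" for x by simp
    with 2 have "cap (cap P P') (cap X X') = emp" by (intro set_ext) (metis mem_emp)
    then show ?thesis unfolding dcd_def by blast
  qed
qed

text \<open>A set in \<open>L\<close> that decides \<open>A\<close> meets it in all of itself or in
  nothing. Either way the trace is in \<open>L\<close>, and no set in \<open>L\<close> is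
  large.\<close>

lemma dcd_A: "dcd P A \<Longrightarrow> P \<epsilon> L \<Longrightarrow> \<not> lg (cap A P)"
proof -
  assume "dcd P A" and P: "P \<epsilon> L"
  then consider "P \<sqsubseteq> A" | "cap P A = emp" unfolding dcd_def by blast
  then show ?thesis
  proof cases
    case 1
    then have "cap A P = P" using cap_eqI L_subs[OF P] by blast
    then show ?thesis using not_lg_L[OF P] by simp
  next
    case 2
    then have "cap A P = emp" using cap_comm by metis
    then show ?thesis using not_lg_L[OF emp_L] by simp
  qed
qed

text \<open>The separating algebra consists of the sets that can be decided on a large part of every
  large set by a set from a fixed family inside \<open>L\<close>. It is Boolean when the family is
  closed under intersection, because large parts can be taken twice, and \<open>dcd_A\<close>
  excludes \<open>A\<close>. The family depends on how far \<open>L\<close> extends beyond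
  \<open>M\<close>.\<close>

theorem A_Lst: "\<not> A \<epsilon> Lst"
proof -
  have "\<exists>C. L \<sqsubseteq> C \<and> ba C \<and> \<not> A \<epsilon> C"
  proof (cases "L \<sqsubseteq> M")
    case True
    then show ?thesis using alg_ba[OF alg_M] A_L M_L unfolding subs_def by blast
  next
    case False
    then obtain B1 where B1: "B1 \<epsilon> L" "\<not> B1 \<epsilon> M" unfolding subs_def by blast
    \<comment> \<open>If each set in \<open>L\<close> and its complement are countable unions from
      \<open>M\<close>, then sets in \<open>M\<close> suffice to decide. Otherwise a counterexample
      makes the partition of every countable union from \<open>M\<close> bounded, and the
      complements of such unions decide.\<close>
    show ?thesis
    proof (cases "\<forall>B. B \<epsilon> L \<longrightarrow> sgm M B \<and> sgm M (cpl B)")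
      case True
      define X1 where "X1 = Sep (pow baire) (\<lambda>X. \<forall>Y. lg Y \<longrightarrow> (\<exists>K. K \<epsilon> M \<and> dcd K X \<and> lg (cap Y K)))"
      have X1: "X \<epsilon> X1 \<longleftrightarrow> X \<epsilon> pow baire \<and> (\<forall>Y. lg Y \<longrightarrow> (\<exists>K. K \<epsilon> M \<and> dcd K X \<and> lg (cap Y K)))" for X
        unfolding X1_def by (rule mem_Sep) (intro dfi)
      have "ba X1" unfolding ba_def
      proof (intro conjI allI impI)
        fix X assume X: "X \<epsilon> X1"
        show "cpl X \<epsilon> X1" unfolding X1 mem_pow
          using X[unfolded X1] dcd_cpl algD(1)[OF alg_M] cpl_subs by blast
      next
        fix X X' assume XX: "X \<epsilon> X1 \<and> X' \<epsilon> X1"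
        have "\<exists>K. K \<epsilon> M \<and> dcd K (cap X X') \<and> lg (cap Y K)" if Y: "lg Y" for Y
        proof -
          obtain K where K: "K \<epsilon> M" "dcd K X" "lg (cap Y K)" using XX Y unfolding X1 by blast
          obtain K' where K': "K' \<epsilon> M" "dcd K' X'" "lg (cap (cap Y K) K')" using XX K(3) unfolding X1 by blast
          show ?thesis using algD(3)[OF alg_M K(1) K'(1)] dcd_cap[OF K(2) K'(2)] K'(3)[unfolded cap_cap] by blast
        qed
        then show "cap X X' \<epsilon> X1" unfolding X1 mem_pow using cap_subs by blast
      qed
      moreover have "L \<sqsubseteq> X1"
      proof (rule subsI)
        fix B assume B: "B \<epsilon> L"
        note Bb = L_subs[OF B]
        obtain K where K: "maps K omega M" "B = union_seq K" using True B unfolding sgm_def by blast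
        obtain K' where K': "maps K' omega M" "cpl B = union_seq K'" using True B unfolding sgm_def by blast
        obtain q where q: "bpart q" "fib q zero = emp"
          "\<And>n. n \<epsilon> omega \<Longrightarrow> fib q (succ n) \<epsilon> M \<and> cap B (fib q (succ n)) \<epsilon> M"
          using part_total[OF alg_M B1 K K' Bb] by blast
        have "\<exists>K. K \<epsilon> M \<and> dcd K B \<and> lg (cap Y K)" if Y: "lg Y" for Y
        proof -
          obtain n where n: "n \<epsilon> omega" "lg (cap Y (fib q n))" using lg_part[OF Y q(1)] by blast
          have "n \<noteq> zero" using n(2) q(2) not_lg_L[OF emp_L] cap_emp by auto
          then obtain m where m: "m \<epsilon> omega" "n = succ m" using omega_cases[OF n(1)] by blast
          \<comment> \<open>The trace \<open>V\<close> of \<open>B\<close> on the large fibre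
            \<open>W\<close> is in \<open>M\<close>, so one more cut, along \<open>V\<close>,
            decides \<open>B\<close>.\<close>
          define W where "W = fib q (succ m)"
          define V where "V = cap B W"
          have WV: "W \<epsilon> M" "V \<epsilon> M" using q(3)[OF m(1)] unfolding W_def V_def by auto
          have "V \<epsilon> L" using WV M_L unfolding subs_def by blast
          from lg_two[OF n(2)[unfolded m(2) W_def[symmetric]] this]
          show ?thesis
          proof
            assume l: "lg (cap (cap Y W) V)"
            have "dcd (cap W V) B" unfolding dcd_def V_def by (auto simp: subs_def)
            then show ?thesis using l algD(3)[OF alg_M WV] unfolding cap_cap by blast
          next
            assume l: "lg (cap (cap Y W) (cpl V))"
            have "cap (cap W (cpl V)) B = emp" unfolding V_def by (rule set_ext) auto
            then have "dcd (cap W (cpl V)) B" unfolding dcd_def by blast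
            then show ?thesis using l algD(3)[OF alg_M WV(1) algD(2)[OF alg_M WV(2)]] unfolding cap_cap by blast
          qed
        qed
        then show "B \<epsilon> X1" unfolding X1 mem_pow using Bb by blast
      qed
      moreover have "\<not> A \<epsilon> X1"
      proof
        assume "A \<epsilon> X1"
        then obtain K where K: "K \<epsilon> M" "dcd K A" "lg (cap A K)" using lg_A unfolding X1 by blast
        then show False using dcd_A[OF K(2)] M_L unfolding subs_def by blast
      qed
      ultimately show ?thesis by blast
    next
      case False
      then obtain B where B: "B \<epsilon> L" "\<not> (sgm M B \<and> sgm M (cpl B))" by blast
      note Bb = L_subs[OF B(1)]
      have BM: "\<not> B \<epsilon> M" using B(2) sgm_self Bb cpl_subs algD(2)[OF alg_M] by blast
      \<comment> \<open>In the other alternative of \<open>part_cases\<close>, \<open>B\<close> and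
        its complement would be preimages of a countable union from \<open>M\<close>, hence such
        unions themselves.\<close>
      have bp: "bpart (part K)" if K: "maps K omega M" for K
      proof (rule ccontr)
        assume "\<not> ?thesis"
        then have "lle B (union_seq K)" "lle (cpl B) (union_seq K)"
          using part_cases[OF alg_M B(1) BM K] by blast+
        moreover have "sgm M (union_seq K)" unfolding sgm_def using K by blast
        ultimately have "sgm M B" "sgm M (cpl B)"
          unfolding lle_def by (metis sgm_pre[OF alg_M])+
        then show False using B(2) by blast
      qed
      \<comment> \<open>These sets are closed under intersection, and each of them is the fibre at
        \<open>zero\<close> of a partition bounded by \<open>bp\<close>, hence in
        \<open>L\<close>.\<close>
      define Pi where "Pi P \<longleftrightarrow> P \<sqsubseteq> baire \<and> sgm M (cpl P)" for P
      have Pi_df: "df (\<lambda>e. Pi (s e))" if "dt s" for s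
        by (rule df1[of Pi, OF _ that]) (unfold Pi_def, intro dfi)
      have PiL: "P \<epsilon> L" if P: "Pi P" for P
      proof -
        obtain K where K: "maps K omega M" "cpl P = union_seq K" using P unfolding Pi_def sgm_def by blast
        have "P = fib (part K) zero" unfolding part(2) K(2)[symmetric] using cpl_cpl P Pi_def by simp
        then show ?thesis using bpart_fib[OF bp[OF K(1)] zero_omega] by simp
      qed
      have PiM: "Pi D" if "D \<epsilon> M" for D
        unfolding Pi_def using algD(1,2)[OF alg_M that] sgm_self cpl_subs by blast
      have Picap: "Pi (cap P P')" if "Pi P" "Pi P'" for P P'
      proof -
        have "cpl (cap P P') = cup (cpl P) (cpl P')" by (rule set_ext) (auto simp: mem_cup)
        then show ?thesis using that sgm_cup[OF alg_M] unfolding Pi_def by simp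
      qed
      \<comment> \<open>Quantifying over \<open>u\<close> closes \<open>X2\<close> under Lipschitz
        preimages, so that \<open>initial\<close> applies to it.\<close>
      define X2 where "X2 = Sep (pow baire) (\<lambda>X. \<forall>u. lips u \<longrightarrow> (\<forall>Y. lg Y \<longrightarrow> (\<exists>P. Pi P \<and> dcd P (pre u X) \<and> lg (cap Y P))))"
      have X2: "X \<epsilon> X2 \<longleftrightarrow> X \<epsilon> pow baire \<and> (\<forall>u. lips u \<longrightarrow> (\<forall>Y. lg Y \<longrightarrow> (\<exists>P. Pi P \<and> dcd P (pre u X) \<and> lg (cap Y P))))" for X
        unfolding X2_def by (rule mem_Sep) (intro dfi Pi_df)
      have sX2: "V \<epsilon> X2" if V: "sgm M V" for V
      proof -
        have Vb: "V \<sqsubseteq> baire" using V unfolding sgm_def by (auto simp: subs_def)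
        have "\<exists>P. Pi P \<and> dcd P (pre u V) \<and> lg (cap Y P)" if u: "lips u" and Y: "lg Y" for u Y
        proof -
          obtain K where K: "maps K omega M" "pre u V = union_seq K"
            using sgm_pre[OF alg_M u V] unfolding sgm_def by blast
          obtain n where n: "n \<epsilon> omega" "lg (cap Y (fib (part K) n))" using lg_part[OF Y bp[OF K(1)]] by blast
          from omega_cases[OF n(1)] show ?thesis
          proof (elim disjE exE conjE)
            assume z: "n = zero"
            have e: "fib (part K) n = cpl (pre u V)" unfolding z part(2) K(2) ..
            have "cpl (cpl (pre u V)) = union_seq K" unfolding cpl_cpl[OF pre_subs] by (rule K(2))
            then have "Pi (cpl (pre u V))" unfolding Pi_def sgm_def using K(1) cpl_subs by blast
            moreover have "cap (cpl (pre u V)) (pre u V) = emp" by (rule set_ext) auto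
            ultimately show ?thesis using n(2) unfolding e dcd_def by blast
          next
            fix m assume m: "m \<epsilon> omega" "n = succ m"
            have "fib (part K) n \<sqsubseteq> pre u V" unfolding m(2) K(2) subs_def part(3)[OF m(1)] mem_union_seq using m(1) by blast
            then show ?thesis using PiM[OF alg_part[OF alg_M K(1) m(1)]] n(2) unfolding m(2) dcd_def by blast
          qed
        qed
        then show ?thesis unfolding X2 mem_pow using Vb by blast
      qed
      have aX2: "alg X2" unfolding alg_def
      proof (intro conjI allI impI)
        fix X assume X: "X \<epsilon> X2"
        then show Xb: "X \<sqsubseteq> baire" unfolding X2 by simp
        have "\<exists>P. Pi P \<and> dcd P (pre u (cpl X)) \<and> lg (cap Y P)" if u: "lips u" and Y: "lg Y" for u Y
        proof -
          obtain P where P: "Pi P" "dcd P (pre u X)" "lg (cap Y P)" using X u Y unfolding X2 by blast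
          then show ?thesis unfolding pre_cpl[OF lips_maps[OF u]] using dcd_cpl Pi_def by blast
        qed
        then show "cpl X \<epsilon> X2" unfolding X2 mem_pow using cpl_subs by blast
      next
        fix X X' assume XX: "X \<epsilon> X2 \<and> X' \<epsilon> X2"
        have "\<exists>P. Pi P \<and> dcd P (pre u (cap X X')) \<and> lg (cap Y P)" if u: "lips u" and Y: "lg Y" for u Y
        proof -
          obtain P where P: "Pi P" "dcd P (pre u X)" "lg (cap Y P)" using XX u Y unfolding X2 by blast
          obtain P' where P': "Pi P'" "dcd P' (pre u X')" "lg (cap (cap Y P) P')" using XX u P(3) unfolding X2 by blast
          show ?thesis unfolding pre_cap[OF lips_maps[OF u]]
            using Picap[OF P(1) P'(1)] dcd_cap[OF P(2) P'(2)] P'(3)[unfolded cap_cap] by blast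
        qed
        then show "cap X X' \<epsilon> X2" unfolding X2 mem_pow using cap_subs by blast
      next
        fix v X assume vX: "lips v \<and> X \<epsilon> X2"
        have "\<exists>P. Pi P \<and> dcd P (pre u (pre v X)) \<and> lg (cap Y P)" if u: "lips u" and Y: "lg Y" for u Y
          using vX u Y lips_cmps[OF conjunct1[OF vX] u] pre_cmps[OF lips_maps[OF u], of v X] unfolding X2 by metis
        then show "pre v X \<epsilon> X2" unfolding X2 mem_pow using pre_subs by blast
      next
        fix x n assume "x \<epsilon> baire \<and> n \<epsilon> omega"
        then show "cone_at n x \<epsilon> X2" using sX2 sgm_self algD(1,5)[OF alg_M] by blast
      qed
      \<comment> \<open>Otherwise \<open>X2\<close> is an algebra inside \<open>L\<close> and so
        inside the largest one, \<open>M\<close>. As it contains the countable unions from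
        \<open>M\<close>, Luzin separation would put \<open>B\<close> into \<open>M\<close>.\<close>
      have "L \<sqsubseteq> X2"
      proof (rule ccontr)
        assume "\<not> L \<sqsubseteq> X2"
        then obtain B' where B': "B' \<epsilon> L" "\<not> B' \<epsilon> X2" unfolding subs_def by blast
        have "X2 \<sqsubseteq> L" unfolding subs_def using initial[OF aX2 L_subs[OF B'(1)] B'(2)] L_lle[OF _ B'(1)] by blast
        then have sub: "X \<epsilon> X2 \<Longrightarrow> X \<epsilon> M" for X unfolding mem_M using aX2 by blast
        have un: "union_seq K \<epsilon> M" if "maps K omega M" for K
          using sub sX2 that unfolding sgm_def by blast
        have "B \<epsilon> M"
          by (rule luzin[OF M_L algD(5)[OF alg_M] algD(2)[OF alg_M] algD(3)[OF alg_M] un Bb sig_L[OF B(1)] sig_L[OF L_cpl[OF B(1)]]])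
        then show False using BM by blast
      qed
      moreover have "\<not> A \<epsilon> X2"
      proof
        assume A2: "A \<epsilon> X2"
        obtain P where P: "Pi P" "dcd P (pre idb A)" "lg (cap A P)" using A2 lg_A lips_idb unfolding X2 by blast
        then show False using dcd_A[OF _ PiL[OF P(1)]] pre_idb[OF A_subs] by auto
      qed
      ultimately show ?thesis using alg_ba[OF aX2] by blast
    qed
  qed
  then show ?thesis unfolding mem_Lst by blast
qed

end

section \<open>The Martin--Monk construction\<close>

context ZF_model
begin

definition rf :: "'m \<Rightarrow> 'm \<Rightarrow> bool" where
  "rf g q \<longleftrightarrow> (\<forall>i n. i \<epsilon> omega \<and> n \<epsilon> omega \<longrightarrow> res (fib (dig g i) n) q)"

lemma df_rf [dfi]: "dt s \<Longrightarrow> dt t \<Longrightarrow> df (\<lambda>e. rf (s e) (t e))"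
  by (rule df2[of rf], unfold rf_def, intro dfi)

text \<open>Each digit of \<open>g\<close> at the limit has a resolved fibre, so nearby points
  eventually share that digit. The limit \<open>y\<close> of the values of \<open>q\<close> is
  arbitrary here as well.\<close>

lemma rf_lim:
  assumes r: "rf g q" and g: "maps g baire baire" and x: "x \<epsilon> baire" and y: "y \<epsilon> baire" and j: "j \<epsilon> omega"
  shows "\<exists>k. k \<epsilon> omega \<and> (\<forall>x'. x' \<epsilon> baire \<and> agree k x' x \<and> agree k (ap q x') y \<longrightarrow> agree j (ap g x') (ap g x))"
  using j
proof (induction j rule: omega_induct)
  case df show ?case by (intro dfi)
next
  case zero show ?case by (intro exI[of _ zero]) simp
next
  case (succ j)
  then obtain k where k: "k \<epsilon> omega"
    "\<And>x'. x' \<epsilon> baire \<Longrightarrow> agree k x' x \<Longrightarrow> agree k (ap q x') y \<Longrightarrow> agree j (ap g x') (ap g x)" by blast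
  have "ap (ap g x) j \<epsilon> omega" using baire_ap[OF ap_in[OF g x] succ(1)] .
  then have "res (fib (dig g j) (ap (ap g x) j)) q" using r succ(1) unfolding rf_def by blast
  from resD[OF this x y] obtain l where l: "l \<epsilon> omega"
    "\<And>x'. x' \<epsilon> baire \<Longrightarrow> agree l x' x \<Longrightarrow> agree l (ap q x') y \<Longrightarrow>
      (x' \<epsilon> fib (dig g j) (ap (ap g x) j) \<longleftrightarrow> x \<epsilon> fib (dig g j) (ap (ap g x) j))" by blast
  obtain m where m: "m \<epsilon> omega" "k \<epsilon> m" "l \<epsilon> m" using omega_max[OF k(1) l(1)] by blast
  show ?case
  proof (intro exI[of _ m] conjI m(1) allI impI, elim conjE)
    fix x' assume x': "x' \<epsilon> baire" "agree m x' x" "agree m (ap q x') y"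
    have "agree j (ap g x') (ap g x)"
      by (rule k(2)[OF x'(1) agree_mono[OF x'(2) m(2,1)] agree_mono[OF x'(3) m(2,1)]])
    moreover have "ap (ap g x') j = ap (ap g x) j"
      using l(2)[OF x'(1) agree_mono[OF x'(2) m(3,1)] agree_mono[OF x'(3) m(3,1)]] x x'(1) by (simp add: ap_dig)
    ultimately show "agree (succ j) (ap g x') (ap g x)" unfolding agree_def by auto
  qed
qed

lemma mem_two: "x \<epsilon> two \<longleftrightarrow> x = zero \<or> x = succ zero" by (auto simp: two_def)

text \<open>\<open>g i n\<close> is the \<open>n\<close>-th map of the construction, preserving \<open>A\<close> for \<open>i = 0\<close> and flipping it otherwise.  A sequence
  \<open>z\<close> in \<open>{0, 1}\<close> determines reals with \<open>x\<^sub>n = g (z n) n x\<^sub>n\<^sub>+\<^sub>1\<close>.  As \<open>x\<^sub>n\<close> depends only on \<open>z\<close> from \<open>n\<close> on,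
  \<open>x\<^sub>0 \<in> A\<close> is a flip-set condition on \<open>z\<close>.\<close>

lemma martin_monk:
  assumes gd: "dt (\<lambda>e. g (e 0) (e (Suc 0)))"
    and g: "\<And>i n. n \<epsilon> omega \<Longrightarrow> maps (g i n) baire baire"
    and q: "\<And>n. n \<epsilon> omega \<Longrightarrow> maps (q n) baire baire"
    and base: "\<And>i n a b. n \<epsilon> omega \<Longrightarrow> a \<epsilon> baire \<Longrightarrow> b \<epsilon> baire \<Longrightarrow> pair (ap (g i n) a) (ap (g i n) b) \<epsilon> ap (E n) n"
    and step: "\<And>i n k a b. n \<epsilon> omega \<Longrightarrow> k \<epsilon> omega \<Longrightarrow> pair a b \<epsilon> ap (E (succ n)) k \<Longrightarrow>
      pair (ap (g i n) a) (ap (g i n) b) \<epsilon> ap (E n) k \<and> agree k (ap (q n) a) (ap (q n) b)"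
    and Ed: "dt (\<lambda>e. E (e 0))"
    and ag: "\<And>n k a b. n \<epsilon> omega \<Longrightarrow> k \<epsilon> omega \<Longrightarrow> pair a b \<epsilon> ap (E n) k \<Longrightarrow> agree k a b"
    and rf: "\<And>i n. n \<epsilon> omega \<Longrightarrow> rf (g i n) (q n)"
    and A: "\<And>i n x. n \<epsilon> omega \<Longrightarrow> x \<epsilon> baire \<Longrightarrow> ap (g i n) x \<epsilon> A \<longleftrightarrow> (x \<epsilon> A \<longleftrightarrow> i = zero)"
  shows "\<exists>Z. flip_set Z"
proof -
  note gd' = dt2[OF gd]
  \<comment> \<open>An approximation of length \<open>N\<close>: its entry at \<open>N\<close> is
    free, and the entries below are computed from it.\<close>
  define Ap where "Ap z N v \<longleftrightarrow> maps v omega baire \<and> (\<forall>m. m \<epsilon> N \<longrightarrow> ap v m = ap (g (ap z m) m) (ap v (succ m)))" for z N v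
  have Ap_df: "df (\<lambda>e. Ap (r e) (s e) (t e))" if "dt r" "dt s" "dt t" for r s t
    by (rule df3[of Ap, OF _ that]) (unfold Ap_def, intro dfi gd')
  have Ap_ex: "\<forall>b. b \<epsilon> baire \<longrightarrow> (\<exists>v. Ap z N v \<and> ap v N = b)" if N: "N \<epsilon> omega" for z N
    using N
  proof (induction N rule: omega_induct)
    case df show ?case by (intro dfi Ap_df)
  next
    case zero
    have "Ap z zero (cst b) \<and> ap (cst b) zero = b" if "b \<epsilon> baire" for b
      unfolding Ap_def using cst_maps[OF that] by simp
    then show ?case by blast
  next
    case (succ N)
    show ?case
    proof (intro allI impI)
      fix b assume b: "b \<epsilon> baire"
      have "ap (g (ap z N) N) b \<epsilon> baire" using ap_in[OF g[OF succ(1)] b] .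
      then obtain v where v: "Ap z N v" "ap v N = ap (g (ap z N) N) b" using succ(2) by blast
      have vm: "maps v omega baire" using v(1) unfolding Ap_def by blast
      define v' where "v' = upd v (succ N) b"
      have v': "ap v' i = (if i = succ N then b else ap v i)" if "i \<epsilon> omega" for i
        unfolding v'_def by (rule ap_upd[OF that])
      have ne: "m \<noteq> succ N" if "m \<epsilon> succ N" for m using that not_mem_self by blast
      have "ap v' m = ap (g (ap z m) m) (ap v' (succ m))" if m: "m \<epsilon> succ N" for m
      proof -
        have mo: "m \<epsilon> omega" using mem_omegaD[OF m succ_omega[OF succ(1)]] .
        have l: "ap v' m = ap v m" using v'[OF mo] ne[OF m] by simp
        show ?thesis
        proof (cases "m = N")
          case True
          then show ?thesis using l v(2) v'[OF succ_omega[OF succ(1)]] by simp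
        next
          case False
          then have mN: "m \<epsilon> N" using m by simp
          have "succ m \<noteq> succ N" using False succ_inj by blast
          then have "ap v' (succ m) = ap v (succ m)" using v'[OF succ_omega[OF mo]] by simp
          then show ?thesis using l v(1) mN unfolding Ap_def by simp
        qed
      qed
      moreover have "maps v' omega baire" unfolding v'_def by (rule upd_maps[OF vm b])
      moreover have "ap v' (succ N) = b" using v'[OF succ_omega[OF succ(1)]] by simp
      ultimately show "\<exists>v. Ap z (succ N) v \<and> ap v (succ N) = b" unfolding Ap_def by blast
    qed
  qed
  have Ap_in: "ap v m \<epsilon> baire" if "Ap z N v" "m \<epsilon> omega" for z N v m
    using that ap_in unfolding Ap_def by blast
  \<comment> \<open>At level \<open>n\<close> both entries are values of one and the same map, which
    \<open>base\<close> relates at precision \<open>n\<close> whatever the arguments are. Then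
    \<open>step\<close> carries the relation down without loss of precision.\<close>
  have close: "pair (ap v m) (ap v' m) \<epsilon> ap (E m) n"
    if v: "Ap z N v" "Ap z N' v'" and N: "N \<epsilon> omega" and N': "N' \<epsilon> omega" and n: "n \<epsilon> N" "n \<epsilon> N'" and m: "m \<epsilon> succ n" for z N v N' v' n m
  proof -
    have no: "n \<epsilon> omega" using mem_omegaD[OF n(1) N] .
    have st: "ap w i = ap (g (ap z i) i) (ap w (succ i))" if "Ap z K w" "i \<epsilon> K" for K w i
      using that unfolding Ap_def by blast
    have b: "pair (ap v n) (ap v' n) \<epsilon> ap (E n) n"
      unfolding st[OF v(1) n(1)] st[OF v(2) n(2)]
      by (rule base[OF no Ap_in[OF v(1) succ_omega[OF no]] Ap_in[OF v(2) succ_omega[OF no]]])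
    show ?thesis
    proof (cases "m = n")
      case True then show ?thesis using b by simp
    next
      case False
      then have mn: "m \<epsilon> n" using m by simp
      show ?thesis
      proof (rule down_induct[where P = "\<lambda>m. pair (ap v m) (ap v' m) \<epsilon> ap (E m) n", OF _ no b _ mn])
        show "df (\<lambda>e. pair (ap v (e 0)) (ap v' (e 0)) \<epsilon> ap (E (e 0)) n)" by (intro dfi dt1[OF Ed])
      next
        fix i assume i: "i \<epsilon> n" "pair (ap v (succ i)) (ap v' (succ i)) \<epsilon> ap (E (succ i)) n"
        have io: "i \<epsilon> omega" using mem_omegaD[OF i(1) no] .
        have iN: "i \<epsilon> N" using omega_trans[OF i(1) n(1) N] .
        have e: "ap v i = ap (g (ap z i) i) (ap v (succ i))" by (rule st[OF v(1) iN])
        have "i \<epsilon> N'" using omega_trans[OF i(1) n(2) N'] .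
        then have e': "ap v' i = ap (g (ap z i) i) (ap v' (succ i))" by (rule st[OF v(2)])
        show "pair (ap v i) (ap v' i) \<epsilon> ap (E i) n"
          unfolding e e' using step[OF io no i(2)] by blast
      qed
    qed
  qed
  \<comment> \<open>Stated for a general \<open>T\<close> because two kinds of limits are needed: of
    the entries at \<open>m\<close>, and of the images of the entries at \<open>succ m\<close> under
    \<open>q m\<close>.\<close>
  have lim_ex: "\<exists>x. x \<epsilon> baire \<and> (\<forall>N v n. N \<epsilon> omega \<and> Ap z N v \<and> n \<epsilon> N \<and> m \<epsilon> succ n \<longrightarrow> agree n (T v) x)"
    if m: "m \<epsilon> omega" and Td: "dt (\<lambda>e. T (e 0))" and Tb: "\<And>N v. N \<epsilon> omega \<Longrightarrow> Ap z N v \<Longrightarrow> T v \<epsilon> baire"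
      and Ta: "\<And>N v N' v' n. Ap z N v \<Longrightarrow> Ap z N' v' \<Longrightarrow> N \<epsilon> omega \<Longrightarrow> N' \<epsilon> omega \<Longrightarrow> n \<epsilon> N \<Longrightarrow> n \<epsilon> N' \<Longrightarrow>
        m \<epsilon> succ n \<Longrightarrow> agree n (T v) (T v')" for z m T
  proof -
    note Td' = dt1[OF Td]
    define S where "S k = Sep omega (\<lambda>j. \<exists>N v. N \<epsilon> omega \<and> Ap z N v \<and> m \<epsilon> N \<and> succ k \<epsilon> N \<and> ap (T v) k = j)" for k
    have S: "j \<epsilon> S k \<longleftrightarrow> j \<epsilon> omega \<and> (\<exists>N v. N \<epsilon> omega \<and> Ap z N v \<and> m \<epsilon> N \<and> succ k \<epsilon> N \<and> ap (T v) k = j)" for j k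
      unfolding S_def by (rule mem_Sep) (intro dfi Ap_df Td')
    have Sd: "dt (\<lambda>e. Uni (S (e 0)))" unfolding S_def by (intro dfi Ap_df Td')
    define x where "x = Lam omega (\<lambda>k. Uni (S k))"
    have x: "ap x k = Uni (S k)" if "k \<epsilon> omega" for k unfolding x_def by (rule ap_Lam[OF Sd that])
    have val: "Uni (S k) = ap (T v) k"
      if k: "k \<epsilon> omega" and N: "N \<epsilon> omega" "Ap z N v" "m \<epsilon> N" "succ k \<epsilon> N" for k N v
    proof -
      have u: "ap (T v') k = ap (T v) k" if N': "N' \<epsilon> omega" "Ap z N' v'" "m \<epsilon> N'" "succ k \<epsilon> N'" for N' v'
      proof -
        consider "m \<epsilon> succ (succ k)" | "succ k \<epsilon> m"
          using omega_linear[OF m succ_omega[OF k]] by auto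
        then show ?thesis
        proof cases
          case 1
          have "agree (succ k) (T v') (T v)" using Ta[OF N'(2) N(2) N'(1) N(1) N'(4) N(4) 1] .
          then show ?thesis by (simp add: agree_def)
        next
          case 2
          have "agree m (T v') (T v)" using Ta[OF N'(2) N(2) N'(1) N(1) N'(3) N(3)] by simp
          moreover have "k \<epsilon> m" by (rule omega_trans[OF _ 2 m]) simp
          ultimately show ?thesis by (simp add: agree_def)
        qed
      qed
      have "ap (T v) k \<epsilon> omega" using baire_ap[OF Tb[OF N(1,2)] k] .
      then have "j \<epsilon> S k \<longleftrightarrow> j = ap (T v) k" for j unfolding S using u N by blast
      then show ?thesis by (intro set_ext) (metis mem_Uni)
    qed
    have ex: "\<exists>N v. N \<epsilon> omega \<and> Ap z N v \<and> m \<epsilon> N \<and> succ k \<epsilon> N" if k: "k \<epsilon> omega" for k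
    proof -
      obtain N where N: "N \<epsilon> omega" "m \<epsilon> N" "succ k \<epsilon> N" using omega_max[OF m succ_omega[OF k]] by blast
      then show ?thesis using Ap_ex[OF N(1)] cst_baire[OF zero_omega] by blast
    qed
    have xb: "x \<epsilon> baire" unfolding mem_baire x_def
    proof (rule Lam_maps[OF Sd])
      fix k assume k: "k \<epsilon> omega"
      from ex[OF k] obtain N v where N: "N \<epsilon> omega" "Ap z N v" "m \<epsilon> N" "succ k \<epsilon> N" by blast
      show "Uni (S k) \<epsilon> omega" unfolding val[OF k N] using baire_ap[OF Tb[OF N(1,2)] k] .
    qed
    have "agree n (T v) x" if N: "N \<epsilon> omega" "Ap z N v" "n \<epsilon> N" "m \<epsilon> succ n" for N v n
      unfolding agree_def
    proof (intro allI impI)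
      fix k assume k: "k \<epsilon> n"
      have no: "n \<epsilon> omega" using mem_omegaD[OF N(3,1)] .
      have ko: "k \<epsilon> omega" using mem_omegaD[OF k no] .
      have "m \<epsilon> N" using N(4) N(3) omega_trans[OF _ N(3,1)] by auto
      moreover have "succ k \<epsilon> N"
      proof -
        have "succ k \<epsilon> succ n" by (rule succ_mem_succ[OF no k])
        then show ?thesis using N(3) omega_trans[OF _ N(3,1)] by auto
      qed
      ultimately show "ap (T v) k = ap x k" unfolding x[OF ko] using val[OF ko N(1,2)] by simp
    qed
    then show ?thesis using xb by blast
  qed
  define Lim where "Lim z m x \<longleftrightarrow> x \<epsilon> baire \<and>
    (\<forall>N v n. N \<epsilon> omega \<and> Ap z N v \<and> n \<epsilon> N \<and> m \<epsilon> succ n \<longrightarrow> agree n (ap v m) x)" for z m x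
  have Lim_df: "df (\<lambda>e. Lim (r e) (s e) (t e))" if "dt r" "dt s" "dt t" for r s t
    by (rule df3[of Lim, OF _ that]) (unfold Lim_def, intro dfi Ap_df)
  have Lim_ex: "\<exists>x. Lim z m x" if m: "m \<epsilon> omega" for z m
    unfolding Lim_def
  proof (rule lim_ex[OF m])
    show "dt (\<lambda>e. ap (e 0) m)" by (intro dfi)
    show "ap v m \<epsilon> baire" if "Ap z N v" for N v using Ap_in[OF that m] .
    show "agree n (ap v m) (ap v' m)" if "Ap z N v" "Ap z N' v'" "N \<epsilon> omega" "N' \<epsilon> omega" "n \<epsilon> N" "n \<epsilon> N'" "m \<epsilon> succ n"
      for N v N' v' n
      by (rule ag[OF m mem_omegaD[OF that(5,3)] close[OF that]])
  qed
  have big: "\<exists>N v. N \<epsilon> omega \<and> Ap z N v \<and> k \<epsilon> N" if k: "k \<epsilon> omega" for z k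
    using Ap_ex[OF succ_omega[OF k]] cst_baire[OF zero_omega] succ_omega[OF k] mem_succ[of k k] by blast
  have Lim_step: "x = ap (g (ap z m) m) y" if m: "m \<epsilon> omega" and x: "Lim z m x" and y: "Lim z (succ m) y" for z m x y
  proof (rule agree_all)
    let ?g = "g (ap z m) m"
    have xb: "x \<epsilon> baire" and yb: "y \<epsilon> baire" using x y unfolding Lim_def by auto
    show "x \<epsilon> baire" "ap ?g y \<epsilon> baire" using xb ap_in[OF g[OF m] yb] by auto
    note sm = succ_omega[OF m]
    \<comment> \<open>The images under \<open>q m\<close> converge to some \<open>w\<close>, which
      may differ from the image of the limit \<open>y\<close>. This is what the independent second
      limit in \<open>res\<close> is for.\<close>
    have "\<exists>w. w \<epsilon> baire \<and> (\<forall>N v n. N \<epsilon> omega \<and> Ap z N v \<and> n \<epsilon> N \<and> succ m \<epsilon> succ n \<longrightarrow> agree n (ap (q m) (ap v (succ m))) w)"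
    proof (rule lim_ex[OF sm])
      show "dt (\<lambda>e. ap (q m) (ap (e 0) (succ m)))" by (intro dfi)
      show "ap (q m) (ap v (succ m)) \<epsilon> baire" if "Ap z N v" for N v using ap_in[OF q[OF m] Ap_in[OF that sm]] .
      show "agree n (ap (q m) (ap v (succ m))) (ap (q m) (ap v' (succ m)))"
        if "Ap z N v" "Ap z N' v'" "N \<epsilon> omega" "N' \<epsilon> omega" "n \<epsilon> N" "n \<epsilon> N'" "succ m \<epsilon> succ n" for N v N' v' n
        using step[OF m mem_omegaD[OF that(5,3)] close[OF that]] by blast
    qed
    then obtain w where w: "w \<epsilon> baire" "\<And>N v n. N \<epsilon> omega \<Longrightarrow> Ap z N v \<Longrightarrow> n \<epsilon> N \<Longrightarrow> succ m \<epsilon> succ n \<Longrightarrow>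
        agree n (ap (q m) (ap v (succ m))) w" by blast
    fix j assume j: "j \<epsilon> omega"
    obtain k where k: "k \<epsilon> omega" "\<And>x'. x' \<epsilon> baire \<Longrightarrow> agree k x' y \<Longrightarrow> agree k (ap (q m) x') w \<Longrightarrow> agree j (ap ?g x') (ap ?g y)"
      using rf_lim[OF rf[OF m] g[OF m] yb w(1) j] by blast
    obtain n where n: "n \<epsilon> omega" "k \<epsilon> n" "j \<epsilon> n" "succ m \<epsilon> n" using omega_max3[OF k(1) j sm] by blast
    have mn: "m \<epsilon> n" by (rule omega_trans[OF _ n(4,1)]) simp
    obtain N v where N: "N \<epsilon> omega" "Ap z N v" "n \<epsilon> N" using big[OF n(1)] by blast
    have mN: "m \<epsilon> N" by (rule omega_trans[OF mn N(3,1)])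
    have v1: "agree n (ap v m) x" using x N mn unfolding Lim_def by simp
    have v2: "agree n (ap v (succ m)) y" using y N n(4) unfolding Lim_def by simp
    have v3: "agree n (ap (q m) (ap v (succ m))) w" using w(2)[OF N] n(4) by simp
    have "agree j (ap ?g (ap v (succ m))) (ap ?g y)"
      by (rule k(2)[OF Ap_in[OF N(2) sm] agree_mono[OF v2 n(2,1)] agree_mono[OF v3 n(2,1)]])
    moreover have "ap v m = ap ?g (ap v (succ m))" using N(2) mN unfolding Ap_def by blast
    moreover have "agree j (ap v m) x" by (rule agree_mono[OF v1 n(3,1)])
    ultimately show "agree j x (ap ?g y)" using agree_trans agree_sym by metis
  qed
  have Lim_uniq: "x = x'" if m: "m \<epsilon> omega" and x: "Lim z m x" "Lim z m x'" for z m x x'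
  proof -
    obtain y where "Lim z (succ m) y" using Lim_ex[OF succ_omega[OF m]] by blast
    then show ?thesis using Lim_step[OF m x(1)] Lim_step[OF m x(2)] by simp
  qed
  have Lim_tail: "Lim z' m x" if m: "m \<epsilon> omega" and x: "Lim z m x"
      and zz: "\<And>i. i \<epsilon> omega \<Longrightarrow> \<not> i \<epsilon> m \<Longrightarrow> ap z i = ap z' i" for z z' m x
    unfolding Lim_def
  proof (intro conjI allI impI)
    show "x \<epsilon> baire" using x unfolding Lim_def by blast
    fix N v' n assume "N \<epsilon> omega \<and> Ap z' N v' \<and> n \<epsilon> N \<and> m \<epsilon> succ n"
    then have N: "N \<epsilon> omega" and v': "Ap z' N v'" and n: "n \<epsilon> N" and mn: "m \<epsilon> succ n" by blast+
    \<comment> \<open>The approximation for \<open>z\<close> is restarted from the free entry of the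
      one for \<open>z'\<close>. From \<open>m\<close> on the same maps are applied, so both agree
      down to \<open>m\<close>.\<close>
    obtain v where v: "Ap z N v" "ap v N = ap v' N" using Ap_ex[OF N] Ap_in[OF v' N] by blast
    have mN: "m \<epsilon> N" using mn n omega_trans[OF _ n N] by auto
    \<comment> \<open>The first disjunct makes the downward induction trivial below
      \<open>m\<close>; at \<open>m\<close> itself it is refuted.\<close>
    have "m \<epsilon> m \<or> ap v m = ap v' m"
    proof (rule down_induct[where P = "\<lambda>i. i \<epsilon> m \<or> ap v i = ap v' i", OF _ N _ _ mN])
      show "df (\<lambda>e. e 0 \<epsilon> m \<or> ap v (e 0) = ap v' (e 0))" by (intro dfi)
      show "N \<epsilon> m \<or> ap v N = ap v' N" using v(2) by blast
      fix i assume i: "i \<epsilon> N" "succ i \<epsilon> m \<or> ap v (succ i) = ap v' (succ i)"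
      have io: "i \<epsilon> omega" using mem_omegaD[OF i(1) N] .
      show "i \<epsilon> m \<or> ap v i = ap v' i"
      proof (cases "i \<epsilon> m")
        case False
        have "\<not> succ i \<epsilon> m" using False omega_trans[of i "succ i" m] m by auto
        then have "ap v (succ i) = ap v' (succ i)" using i(2) by blast
        moreover have "ap v i = ap (g (ap z i) i) (ap v (succ i))" using v(1) i(1) unfolding Ap_def by blast
        moreover have "ap v' i = ap (g (ap z' i) i) (ap v' (succ i))" using v' i(1) unfolding Ap_def by blast
        ultimately show ?thesis using zz[OF io False] by simp
      qed simp
    qed
    then have "ap v m = ap v' m" using not_mem_self by blast
    then show "agree n (ap v' m) x" using x N v(1) n mn unfolding Lim_def by metis
  qed
  define Z where "Z = Sep (funs omega two) (\<lambda>z. \<exists>x. x \<epsilon> A \<and> Lim z zero x)"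
  have Z: "z \<epsilon> Z \<longleftrightarrow> z \<epsilon> funs omega two \<and> (\<exists>x. x \<epsilon> A \<and> Lim z zero x)" for z
    unfolding Z_def by (rule mem_Sep) (intro dfi Lim_df)
  have "flip_set Z" unfolding flip_set_def
  proof (intro conjI allI impI)
    show "Z \<sqsubseteq> funs omega two" unfolding subs_def Z by blast
    fix z w assume zw: "z \<epsilon> funs omega two \<and> w \<epsilon> funs omega two \<and> (\<exists>!n. n \<epsilon> omega \<and> z \<cdot> n \<noteq> w \<cdot> n)"
    then have zm: "maps z omega two" and wm: "maps w omega two" by simp_all
    obtain n where n: "n \<epsilon> omega" "ap z n \<noteq> ap w n" "\<And>i. i \<epsilon> omega \<Longrightarrow> i \<noteq> n \<Longrightarrow> ap z i = ap w i"
    proof -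
      obtain n where n: "n \<epsilon> omega \<and> z \<cdot> n \<noteq> w \<cdot> n" "\<And>i. i \<epsilon> omega \<and> z \<cdot> i \<noteq> w \<cdot> i \<Longrightarrow> i = n"
        using zw by (elim conjE ex1E) blast
      show thesis
      proof (rule that[of n])
        show "n \<epsilon> omega" "ap z n \<noteq> ap w n" using n(1) app_ap[OF zm] app_ap[OF wm] by auto
        show "ap z i = ap w i" if "i \<epsilon> omega" "i \<noteq> n" for i
          using n(2)[of i] that app_ap[OF zm] app_ap[OF wm] by auto
      qed
    qed
    define P where "P m \<longleftrightarrow> (\<forall>x x'. Lim z m x \<and> Lim w m x' \<longrightarrow> (x \<epsilon> A \<longleftrightarrow> \<not> x' \<epsilon> A))" for m
    have Pn: "P n" unfolding P_def
    proof (intro allI impI, elim conjE)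
      fix x x' assume x: "Lim z n x" "Lim w n x'"
      \<comment> \<open>Beyond \<open>n\<close> the two sequences coincide, so one limit
        \<open>y\<close> serves both, and exactly one of the two maps applied to it flips membership
        in \<open>A\<close>.\<close>
      obtain y where y: "Lim z (succ n) y" using Lim_ex[OF succ_omega[OF n(1)]] by blast
      have yw: "Lim w (succ n) y"
        by (rule Lim_tail[OF succ_omega[OF n(1)] y]) (use n(3) in auto)
      have yb: "y \<epsilon> baire" using y unfolding Lim_def by blast
      have "ap z n \<epsilon> two" "ap w n \<epsilon> two" using ap_in zm wm n(1) by blast+
      then have "ap z n = zero \<longleftrightarrow> ap w n \<noteq> zero" using n(2) succ_not_zero[of zero] unfolding mem_two by metis
      then show "x \<epsilon> A \<longleftrightarrow> \<not> x' \<epsilon> A"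
        unfolding Lim_step[OF n(1) x(1) y] Lim_step[OF n(1) x(2) yw] A[OF n(1) yb] by blast
    qed
    have "P zero"
    proof (cases "zero = n")
      case False
      then have z0: "zero \<epsilon> n" using zero_mem[OF n(1)] by blast
      show ?thesis
      proof (rule down_induct[where P = P, OF _ n(1) Pn _ z0])
        show "df (\<lambda>e. P (e 0))" unfolding P_def by (intro dfi Lim_df)
        fix m assume m: "m \<epsilon> n" "P (succ m)"
        have mo: "m \<epsilon> omega" using mem_omegaD[OF m(1) n(1)] .
        show "P m" unfolding P_def
        proof (intro allI impI, elim conjE)
          fix x x' assume x: "Lim z m x" "Lim w m x'"
          obtain y where y: "Lim z (succ m) y" using Lim_ex[OF succ_omega[OF mo]] by blast
          obtain y' where y': "Lim w (succ m) y'" using Lim_ex[OF succ_omega[OF mo]] by blast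
          have yb: "y \<epsilon> baire" "y' \<epsilon> baire" using y y' unfolding Lim_def by blast+
          have "m \<noteq> n" using m(1) not_mem_self by blast
          then have e: "ap z m = ap w m" using n(3)[OF mo] by blast
          have "y \<epsilon> A \<longleftrightarrow> \<not> y' \<epsilon> A" using m(2) y y' unfolding P_def by blast
          then show "x \<epsilon> A \<longleftrightarrow> \<not> x' \<epsilon> A"
            unfolding Lim_step[OF mo x(1) y] Lim_step[OF mo x(2) y'] A[OF mo yb(1)] A[OF mo yb(2)] e by blast
        qed
      qed
    qed (use Pn in simp)
    moreover obtain x x' where "Lim z zero x" "Lim w zero x'" using Lim_ex[OF zero_omega] by blast
    ultimately show "z \<epsilon> Z \<longleftrightarrow> \<not> w \<epsilon> Z"
      unfolding Z P_def using zw Lim_uniq[OF zero_omega] by metis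
  qed
  then show ?thesis by blast
qed

end

context no_decomposition
begin

section \<open>Good equivalence relations\<close>

definition cls :: "'m \<Rightarrow> 'm \<Rightarrow> 'm" where "cls e x = Sep baire (\<lambda>y. pair x y \<epsilon> e)"

lemma mem_cls [simp]: "y \<epsilon> cls e x \<longleftrightarrow> y \<epsilon> baire \<and> pair x y \<epsilon> e"
  unfolding cls_def by (rule mem_Sep) (intro dfi)
lemma dt_cls [dfi]: "dt s \<Longrightarrow> dt t \<Longrightarrow> dt (\<lambda>e. cls (s e) (t e))"
  by (rule dt2[of cls], unfold cls_def, intro dfi)

text \<open>Any large set, pulled back along any reduction, has a large part in a single class of \<open>e\<close>. The large sets are
  arbitrary here, which makes the condition stable under intersection of equivalence relations.\<close>

definition gd :: "'m \<Rightarrow> bool" where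
  "gd e \<longleftrightarrow> (\<forall>x. x \<epsilon> baire \<longrightarrow> pair x x \<epsilon> e \<and> cls e x \<epsilon> Lst) \<and>
    (\<forall>x y. x \<epsilon> baire \<and> y \<epsilon> baire \<and> pair x y \<epsilon> e \<longrightarrow> pair y x \<epsilon> e) \<and>
    (\<forall>x y z. x \<epsilon> baire \<and> y \<epsilon> baire \<and> z \<epsilon> baire \<and> pair x y \<epsilon> e \<and> pair y z \<epsilon> e \<longrightarrow> pair x z \<epsilon> e) \<and>
    (\<forall>w Y. w \<epsilon> F \<and> lg Y \<longrightarrow> (\<exists>x. x \<epsilon> baire \<and> lg (cap Y (pre w (cls e x)))))"

lemma df_gd [dfi]: "dt s \<Longrightarrow> df (\<lambda>e. gd (s e))"
  by (rule df1[of gd], unfold gd_def, intro dfi)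

lemma gd_refl: "gd e \<Longrightarrow> x \<epsilon> baire \<Longrightarrow> pair x x \<epsilon> e"
  and gd_cls: "gd e \<Longrightarrow> x \<epsilon> baire \<Longrightarrow> cls e x \<epsilon> Lst"
  and gd_sym: "gd e \<Longrightarrow> x \<epsilon> baire \<Longrightarrow> y \<epsilon> baire \<Longrightarrow> pair x y \<epsilon> e \<Longrightarrow> pair y x \<epsilon> e"
  and gd_trans: "gd e \<Longrightarrow> x \<epsilon> baire \<Longrightarrow> y \<epsilon> baire \<Longrightarrow> z \<epsilon> baire \<Longrightarrow> pair x y \<epsilon> e \<Longrightarrow> pair y z \<epsilon> e \<Longrightarrow> pair x z \<epsilon> e"
  and gd_lg: "gd e \<Longrightarrow> w \<epsilon> F \<Longrightarrow> lg Y \<Longrightarrow> \<exists>x. x \<epsilon> baire \<and> lg (cap Y (pre w (cls e x)))"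
  unfolding gd_def by blast+

lemma gd_cls_eq: "gd e \<Longrightarrow> x \<epsilon> baire \<Longrightarrow> y \<epsilon> cls e x \<Longrightarrow> cls e y = cls e x"
proof (rule set_ext)
  fix z assume e: "gd e" and x: "x \<epsilon> baire" and "y \<epsilon> cls e x"
  then have y: "y \<epsilon> baire" and xy: "pair x y \<epsilon> e" by simp_all
  note yx = gd_sym[OF e x y xy]
  show "z \<epsilon> cls e y \<longleftrightarrow> z \<epsilon> cls e x"
    unfolding mem_cls using gd_trans[OF e x y _ xy, of z] gd_trans[OF e y x _ yx, of z] by blast
qed

text \<open>The large part is nonempty, so its class can be represented by the image of one of its
  points. Such representatives make classes of different relations match.\<close>

lemma gd_lg_point:
  assumes e: "gd e" and w: "w \<epsilon> F" and Y: "lg Y"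
  shows "\<exists>z. z \<epsilon> baire \<and> z \<epsilon> Y \<and> lg (cap Y (pre w (cls e (ap w z))))"
proof -
  obtain x where x: "x \<epsilon> baire" "lg (cap Y (pre w (cls e x)))" using gd_lg[OF e w Y] by blast
  obtain z where z: "z \<epsilon> baire" "z \<epsilon> cap Y (pre w (cls e x))" using lg_nonempty[OF x(2)] by blast
  then have "ap w z \<epsilon> cls e x" by simp
  from gd_cls_eq[OF e x(1) this] show ?thesis using x(2) z by auto
qed

lemma gdI:
  assumes "\<And>x. x \<epsilon> baire \<Longrightarrow> pair x x \<epsilon> e" "\<And>x. x \<epsilon> baire \<Longrightarrow> cls e x \<epsilon> Lst"
    "\<And>x y. x \<epsilon> baire \<Longrightarrow> y \<epsilon> baire \<Longrightarrow> pair x y \<epsilon> e \<Longrightarrow> pair y x \<epsilon> e"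
    "\<And>x y z. x \<epsilon> baire \<Longrightarrow> y \<epsilon> baire \<Longrightarrow> z \<epsilon> baire \<Longrightarrow> pair x y \<epsilon> e \<Longrightarrow> pair y z \<epsilon> e \<Longrightarrow> pair x z \<epsilon> e"
    "\<And>w Y. w \<epsilon> F \<Longrightarrow> lg Y \<Longrightarrow> \<exists>x. x \<epsilon> baire \<and> lg (cap Y (pre w (cls e x)))"
  shows "gd e"
  unfolding gd_def using assms by blast

definition kerr :: "'m \<Rightarrow> 'm" where
  "kerr q = Sep (prd baire baire) (\<lambda>p. ap q (pfst p) = ap q (psnd p))"

lemma mem_kerr: "pair x y \<epsilon> kerr q \<longleftrightarrow> x \<epsilon> baire \<and> y \<epsilon> baire \<and> ap q x = ap q y"
proof -
  have "df (\<lambda>e. ap q (pfst (e 0)) = ap q (psnd (e 0)))" by (intro dfi)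
  from mem_Sep[OF this] show ?thesis unfolding kerr_def by simp
qed

lemma gd_kerr: assumes q: "bpart q" shows "gd (kerr q)"
proof -
  have c: "cls (kerr q) x = fib q (ap q x)" if "x \<epsilon> baire" for x
    by (rule set_ext) (use that in \<open>auto simp: mem_kerr\<close>)
  show ?thesis
  proof (rule gdI)
    show "cls (kerr q) x \<epsilon> Lst" if "x \<epsilon> baire" for x
      unfolding c[OF that] by (rule L_Lst[OF bpart_fib[OF q ap_in[OF bpart_maps[OF q] that]]])
    fix w Y assume w: "w \<epsilon> F" and Y: "lg Y"
    obtain n where n: "n \<epsilon> omega" "lg (cap Y (fib (cmps q w) n))" using lg_part[OF Y bpart_pre[OF w q]] by blast
    obtain z where z: "z \<epsilon> baire" "z \<epsilon> cap Y (fib (cmps q w) n)" using lg_nonempty[OF n(2)] by blast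
    have "ap q (ap w z) = n" using z ap_cmps[of z q w] by simp
    moreover have "ap w z \<epsilon> baire" using ap_in[OF F_maps[OF w] z(1)] .
    ultimately show "\<exists>x. x \<epsilon> baire \<and> lg (cap Y (pre w (cls (kerr q) x)))"
      using c n(2) unfolding fib_cmps[OF F_maps[OF w]] by metis
  qed (simp_all add: mem_kerr)
qed

definition inte :: "'m \<Rightarrow> 'm \<Rightarrow> 'm" where "inte d e = Sep d (\<lambda>p. p \<epsilon> e)"

lemma mem_inte: "p \<epsilon> inte d e \<longleftrightarrow> p \<epsilon> d \<and> p \<epsilon> e"
  unfolding inte_def by (rule mem_Sep) (intro dfi)
lemma dt_inte [dfi]: "dt s \<Longrightarrow> dt t \<Longrightarrow> dt (\<lambda>e. inte (s e) (t e))"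
  by (rule dt2[of inte], unfold inte_def, intro dfi)

text \<open>The large part inside a class of \<open>d\<close> is again a large set, to which the
  condition for \<open>e\<close> applies; a point of the resulting part represents both
  classes.\<close>

lemma gd_inte: assumes d: "gd d" and e: "gd e" shows "gd (inte d e)"
proof -
  have c: "cls (inte d e) x = cap (cls d x) (cls e x)" for x
    by (rule set_ext) (auto simp: mem_inte)
  show ?thesis
  proof (rule gdI)
    fix w Y assume w: "w \<epsilon> F" and Y: "lg Y"
    obtain x where x: "x \<epsilon> baire" "lg (cap Y (pre w (cls d x)))" using gd_lg[OF d w Y] by blast
    obtain z where z: "z \<epsilon> baire" "z \<epsilon> cap Y (pre w (cls d x))"
      "lg (cap (cap Y (pre w (cls d x))) (pre w (cls e (ap w z))))" using gd_lg_point[OF e w x(2)] by blast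
    have "ap w z \<epsilon> cls d x" using z by simp
    from gd_cls_eq[OF d x(1) this] have "lg (cap Y (pre w (cls (inte d e) (ap w z))))"
      using z(3) unfolding c pre_cap[OF F_maps[OF w]] cap_cap by simp
    then show "\<exists>x. x \<epsilon> baire \<and> lg (cap Y (pre w (cls (inte d e) x)))" using ap_in[OF F_maps[OF w] z(1)] by blast
  next
    show "cls (inte d e) x \<epsilon> Lst" if "x \<epsilon> baire" for x
      unfolding c by (rule Lst_cap[OF gd_cls[OF d that] gd_cls[OF e that]])
  next
    show "pair x x \<epsilon> inte d e" if "x \<epsilon> baire" for x
      unfolding mem_inte using gd_refl[OF d that] gd_refl[OF e that] by blast
    show "pair y x \<epsilon> inte d e" if "x \<epsilon> baire" "y \<epsilon> baire" "pair x y \<epsilon> inte d e" for x y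
      using that(3) gd_sym[OF d that(1,2)] gd_sym[OF e that(1,2)] unfolding mem_inte by blast
    show "pair x z \<epsilon> inte d e" if "x \<epsilon> baire" "y \<epsilon> baire" "z \<epsilon> baire" "pair x y \<epsilon> inte d e" "pair y z \<epsilon> inte d e" for x y z
      using that(4,5) gd_trans[OF d that(1-3)] gd_trans[OF e that(1-3)] unfolding mem_inte by blast
  qed
qed

definition pree :: "'m \<Rightarrow> 'm \<Rightarrow> 'm" where
  "pree g e = Sep (prd baire baire) (\<lambda>p. pair (ap g (pfst p)) (ap g (psnd p)) \<epsilon> e)"

lemma mem_pree: "pair x y \<epsilon> pree g e \<longleftrightarrow> x \<epsilon> baire \<and> y \<epsilon> baire \<and> pair (ap g x) (ap g y) \<epsilon> e"
proof -
  have "df (\<lambda>e'. pair (ap g (pfst (e' 0))) (ap g (psnd (e' 0))) \<epsilon> e)" by (intro dfi)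
  from mem_Sep[OF this] show ?thesis unfolding pree_def by simp
qed
lemma dt_pree [dfi]: "dt s \<Longrightarrow> dt t \<Longrightarrow> dt (\<lambda>e. pree (s e) (t e))"
  by (rule dt2[of pree], unfold pree_def, intro dfi)

text \<open>The condition for the pullback along \<open>g\<close> at \<open>w\<close> is the
  condition for \<open>e\<close> at \<open>cmps g w\<close>; this is why \<open>w\<close> ranges
  over all reductions.\<close>

lemma gd_pree: assumes g: "g \<epsilon> F" and e: "gd e" shows "gd (pree g e)"
proof -
  note gm = F_maps[OF g]
  have c: "cls (pree g e) x = pre g (cls e (ap g x))" if "x \<epsilon> baire" for x
    by (rule set_ext) (use that ap_in[OF gm] in \<open>auto simp: mem_pree\<close>)
  show ?thesis
  proof (rule gdI)
    show "cls (pree g e) x \<epsilon> Lst" if "x \<epsilon> baire" for x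
      unfolding c[OF that] by (rule Lst_pre[OF g gd_cls[OF e ap_in[OF gm that]]])
    fix w Y assume w: "w \<epsilon> F" and Y: "lg Y"
    obtain z where z: "z \<epsilon> baire" "lg (cap Y (pre (cmps g w) (cls e (ap (cmps g w) z))))"
      using gd_lg_point[OF e F_comp[OF g w] Y] by blast
    have wz: "ap w z \<epsilon> baire" by (rule ap_in[OF F_maps[OF w] z(1)])
    show "\<exists>x. x \<epsilon> baire \<and> lg (cap Y (pre w (cls (pree g e) x)))"
      using z(2) wz unfolding pre_cmps[OF F_maps[OF w]] ap_cmps[OF z(1)] c[OF wz, symmetric] by blast
  next
    show "pair x x \<epsilon> pree g e" if "x \<epsilon> baire" for x
      unfolding mem_pree using gd_refl[OF e ap_in[OF gm that]] that by blast
    show "pair y x \<epsilon> pree g e" if "x \<epsilon> baire" "y \<epsilon> baire" "pair x y \<epsilon> pree g e" for x y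
      using that(3) gd_sym[OF e ap_in[OF gm that(1)] ap_in[OF gm that(2)]] unfolding mem_pree by blast
    show "pair x z \<epsilon> pree g e" if "x \<epsilon> baire" "y \<epsilon> baire" "z \<epsilon> baire" "pair x y \<epsilon> pree g e" "pair y z \<epsilon> pree g e" for x y z
      using that(4,5) gd_trans[OF e ap_in[OF gm that(1)] ap_in[OF gm that(2)] ap_in[OF gm that(3)]]
      unfolding mem_pree by blast
  qed
qed

definition rr :: "'m \<Rightarrow> 'm \<Rightarrow> 'm \<Rightarrow> 'm" where "rr D y x = (if x \<epsilon> D then x else y)"

lemma dt_rr [dfi]: "dt r \<Longrightarrow> dt s \<Longrightarrow> dt t \<Longrightarrow> dt (\<lambda>e. rr (r e) (s e) (t e))"
  unfolding rr_def by (intro dfi)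

definition rete :: "'m \<Rightarrow> 'm \<Rightarrow> 'm \<Rightarrow> 'm \<Rightarrow> 'm" where
  "rete d D y e = Sep d (\<lambda>p. pair (rr D y (pfst p)) (rr D y (psnd p)) \<epsilon> e)"

lemma mem_rete: "pair a b \<epsilon> rete d D y e \<longleftrightarrow> pair a b \<epsilon> d \<and> pair (rr D y a) (rr D y b) \<epsilon> e"
proof -
  have "df (\<lambda>e'. pair (rr D y (pfst (e' 0))) (rr D y (psnd (e' 0))) \<epsilon> e)" by (intro dfi)
  from mem_Sep[OF this] show ?thesis unfolding rete_def by simp
qed

lemma dt_rete [dfi]: "dt s \<Longrightarrow> dt t \<Longrightarrow> dt u \<Longrightarrow> dt v \<Longrightarrow> dt (\<lambda>e. rete (s e) (t e) (u e) (v e))"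
proof -
  assume a: "dt s" "dt t" "dt u" "dt v"
  show ?thesis unfolding rete_def
    by (intro dfi a dt_ren[OF a(2)] dt_ren[OF a(3)] dt_ren[OF a(4)])
qed

text \<open>The retraction onto \<open>D\<close> need not be in \<open>F\<close>, so this is not a
  case of \<open>gd_pree\<close>. Outside \<open>D\<close> everything is retracted to
  \<open>y\<close> and the classes are those of \<open>d\<close>; inside \<open>D\<close> they are
  the traces on \<open>D\<close> of classes of \<open>e\<close>.\<close>

lemma gd_rete:
  assumes d: "gd d" and e: "gd e" and x0: "x0 \<epsilon> baire" and D: "D = cls d x0" and y: "y \<epsilon> baire"
  shows "gd (rete d D y e)"
proof -
  have rb: "rr D y x \<epsilon> baire" if "x \<epsilon> baire" for x using that y by (simp add: rr_def)
  have dD: "a \<epsilon> D \<longleftrightarrow> b \<epsilon> D" if "a \<epsilon> baire" "b \<epsilon> baire" "pair a b \<epsilon> d" for a b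
    unfolding D mem_cls using that gd_trans[OF d x0 that(1,2)] gd_trans[OF d x0 that(2,1)] gd_sym[OF d that(1,2)] by blast
  have c1: "cls (rete d D y e) x = cap D (cls e x)" if x: "x \<epsilon> baire" "x \<epsilon> D" for x
  proof (rule set_ext)
    fix z
    have "pair x z \<epsilon> d \<longleftrightarrow> z \<epsilon> D" if z: "z \<epsilon> baire"
    proof
      show "pair x z \<epsilon> d \<Longrightarrow> z \<epsilon> D" using dD[OF x(1) z] x(2) by blast
      assume "z \<epsilon> D"
      then have "pair x0 z \<epsilon> d" "pair x0 x \<epsilon> d" using x(2) unfolding D by auto
      then show "pair x z \<epsilon> d" using gd_trans[OF d x(1) x0 z] gd_sym[OF d x0 x(1)] by blast
    qed
    then show "z \<epsilon> cls (rete d D y e) x \<longleftrightarrow> z \<epsilon> cap D (cls e x)"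
      unfolding mem_cls mem_cap mem_rete using x(2) by (auto simp: rr_def)
  qed
  have c2: "cls (rete d D y e) x = cls d x" if x: "x \<epsilon> baire" "\<not> x \<epsilon> D" for x
  proof (rule set_ext)
    fix z show "z \<epsilon> cls (rete d D y e) x \<longleftrightarrow> z \<epsilon> cls d x"
      unfolding mem_cls mem_rete using dD[OF x(1), of z] x(2) gd_refl[OF e y] by (auto simp: rr_def)
  qed
  have DL: "D \<epsilon> Lst" unfolding D by (rule gd_cls[OF d x0])
  show ?thesis
  proof (rule gdI)
    show "cls (rete d D y e) x \<epsilon> Lst" if x: "x \<epsilon> baire" for x
      using c1[OF x] c2[OF x] Lst_cap[OF DL gd_cls[OF e x]] gd_cls[OF d x] by metis
    fix w Y assume w: "w \<epsilon> F" and Y: "lg Y"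
    note wm = F_maps[OF w]
    obtain z where z: "z \<epsilon> baire" "lg (cap Y (pre w (cls d (ap w z))))" using gd_lg_point[OF d w Y] by blast
    have wz: "ap w z \<epsilon> baire" by (rule ap_in[OF wm z(1)])
    show "\<exists>x. x \<epsilon> baire \<and> lg (cap Y (pre w (cls (rete d D y e) x)))"
    proof (cases "ap w z \<epsilon> D")
      case False
      then show ?thesis using c2[OF wz False] z(2) wz by metis
    next
      case True
      then have De: "cls d (ap w z) = D" unfolding D by (rule gd_cls_eq[OF d x0])
      obtain v where v: "v \<epsilon> baire" "v \<epsilon> cap Y (pre w D)" "lg (cap (cap Y (pre w D)) (pre w (cls e (ap w v))))"
        using gd_lg_point[OF e w z(2)[unfolded De]] by blast
      have vD: "ap w v \<epsilon> D" using v(2) by simp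
      have wv: "ap w v \<epsilon> baire" by (rule ap_in[OF wm v(1)])
      have "lg (cap Y (pre w (cls (rete d D y e) (ap w v))))"
        using v(3) unfolding c1[OF wv vD] pre_cap[OF wm] cap_cap .
      then show ?thesis using wv by blast
    qed
  next
    show "pair x x \<epsilon> rete d D y e" if "x \<epsilon> baire" for x
      unfolding mem_rete using gd_refl[OF d that] gd_refl[OF e rb[OF that]] by blast
    show "pair b a \<epsilon> rete d D y e" if "a \<epsilon> baire" "b \<epsilon> baire" "pair a b \<epsilon> rete d D y e" for a b
      using that(3) gd_sym[OF d that(1,2)] gd_sym[OF e rb[OF that(1)] rb[OF that(2)]] unfolding mem_rete by blast
    show "pair a c \<epsilon> rete d D y e" if "a \<epsilon> baire" "b \<epsilon> baire" "c \<epsilon> baire" "pair a b \<epsilon> rete d D y e" "pair b c \<epsilon> rete d D y e" for a b c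
      using that(4,5) gd_trans[OF d that(1-3)] gd_trans[OF e rb[OF that(1)] rb[OF that(2)] rb[OF that(3)]] unfolding mem_rete by blast
  qed
qed

definition agk :: "'m \<Rightarrow> 'm \<Rightarrow> 'm" where
  "agk q k = Sep (prd baire baire) (\<lambda>p. agree k (ap q (pfst p)) (ap q (psnd p)))"

lemma mem_agk: "pair x y \<epsilon> agk q k \<longleftrightarrow> x \<epsilon> baire \<and> y \<epsilon> baire \<and> agree k (ap q x) (ap q y)"
proof -
  have "df (\<lambda>e. agree k (ap q (pfst (e 0))) (ap q (psnd (e 0))))" by (intro dfi)
  from mem_Sep[OF this] show ?thesis unfolding agk_def by simp
qed
lemma dt_agk [dfi]: "dt s \<Longrightarrow> dt t \<Longrightarrow> dt (\<lambda>e. agk (s e) (t e))"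
  by (rule dt2[of agk], unfold agk_def, intro dfi)

lemma agk_prd: "agk q k \<sqsubseteq> prd baire baire"
proof -
  have "df (\<lambda>e. agree k (ap q (pfst (e 0))) (ap q (psnd (e 0))))" by (intro dfi)
  from mem_Sep[OF this] show ?thesis unfolding agk_def subs_def by simp
qed

text \<open>One more digit of agreement amounts to intersecting with the kernel of one more bounded
  partition.\<close>

lemma gd_agk: assumes q: "q \<epsilon> Q" and k: "k \<epsilon> omega" shows "gd (agk q k)"
  using k
proof (induction k rule: omega_induct)
  case df show ?case by (intro dfi)
next
  case zero
  have c: "cls (agk q zero) x = baire" if "x \<epsilon> baire" for x
    by (rule set_ext) (use that in \<open>auto simp: mem_agk\<close>)
  have b: "baire \<epsilon> L" by (rule fd_L[OF baire_subs zero_omega]) simp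
  show ?case
  proof (rule gdI)
    fix w Y assume w: "w \<epsilon> F" and Y: "lg Y"
    obtain h where h: "h \<epsilon> F" "A = pre h Y" using Y unfolding lg_def by blast
    have "A = pre h (cap Y (pre w baire))" unfolding h(2)
      by (rule set_ext) (use ap_in[OF F_maps[OF h(1)]] ap_in[OF F_maps[OF w]] in auto)
    then have "lg (cap Y (pre w baire))" unfolding lg_def using h(1) by blast
    then show "\<exists>x. x \<epsilon> baire \<and> lg (cap Y (pre w (cls (agk q zero) x)))"
      using c cst_baire[OF zero_omega] by metis
  qed (use c L_Lst[OF b] in \<open>simp_all add: mem_agk\<close>)
next
  case (succ k)
  have "bpart (dig q k)" using q succ(1) unfolding mem_Q by blast
  from gd_inte[OF succ(2) gd_kerr[OF this]] have g: "gd (inte (agk q k) (kerr (dig q k)))" .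
  have "agk q (succ k) = inte (agk q k) (kerr (dig q k))"
  proof (rule set_ext)
    fix p
    have "pair x y \<epsilon> agk q (succ k) \<longleftrightarrow> pair x y \<epsilon> inte (agk q k) (kerr (dig q k))" for x y
      unfolding mem_inte mem_agk mem_kerr agree_def by (auto simp: ap_dig)
    moreover have "p \<epsilon> agk q (succ k) \<Longrightarrow> p \<epsilon> prd baire baire" "p \<epsilon> inte (agk q k) (kerr (dig q k)) \<Longrightarrow> p \<epsilon> prd baire baire"
      using agk_prd unfolding subs_def mem_inte by blast+
    ultimately show "p \<epsilon> agk q (succ k) \<longleftrightarrow> p \<epsilon> inte (agk q k) (kerr (dig q k))"
      unfolding mem_prd by blast
  qed
  then show ?case using g by simp
qed

text \<open>The fibres of all digits of a reduction are in \<open>L\<close>, hence resolvable, and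
  these countably many resolutions are joined along an enumeration of the pairs of digit and
  value.\<close>

lemma rf_F: assumes k: "k \<epsilon> F" shows "\<exists>q. q \<epsilon> Q \<and> rf k q"
proof -
  obtain p where p: "maps p omega (prd omega omega)"
    "\<And>m n. m \<epsilon> omega \<Longrightarrow> n \<epsilon> omega \<Longrightarrow> \<exists>i. i \<epsilon> omega \<and> ap p i = pair m n"
    using omega_prd_enum by blast
  have "\<exists>s. maps s omega Q \<and> (\<forall>m. m \<epsilon> omega \<longrightarrow>
      (\<lambda>m q. res (fib (dig k (pfst (ap p m))) (psnd (ap p m))) q) m (ap s m))"
  proof (rule countable_choice[OF _ coded_Q])
    show "df (\<lambda>e. res (fib (dig k (pfst (ap p (e 0)))) (psnd (ap p (e 0)))) (e (Suc 0)))" by (intro dfi)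
    fix m assume m: "m \<epsilon> omega"
    obtain i n where i: "i \<epsilon> omega" "n \<epsilon> omega" "ap p m = pair i n" using ap_in[OF p(1) m] by (rule prdE)
    have "fib (dig k i) n \<epsilon> L" using F_Q[OF k] i unfolding mem_Q using bpart_fib by blast
    then have "fib (dig k i) n \<epsilon> Res" using L_Res unfolding subs_def by blast
    then show "\<exists>c. c \<epsilon> Q \<and> res (fib (dig k (pfst (ap p m))) (psnd (ap p m))) c"
      unfolding mem_Res i(3) by simp
  qed
  then obtain s where s: "maps s omega Q"
    "\<And>m. m \<epsilon> omega \<Longrightarrow> res (fib (dig k (pfst (ap p m))) (psnd (ap p m))) (ap s m)" by blast
  obtain q where q: "q \<epsilon> Q" "\<And>j. j \<epsilon> omega \<Longrightarrow> finer q (ap s j)" using Q_join[OF s(1)] by blast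
  have "res (fib (dig k i) n) q" if i: "i \<epsilon> omega" and n: "n \<epsilon> omega" for i n
  proof -
    obtain m where m: "m \<epsilon> omega" "ap p m = pair i n" using p(2)[OF i n] by blast
    then show ?thesis using res_finer[OF q(2)[OF m(1)] Q_maps[OF q(1)] s(2)[OF m(1)]] by simp
  qed
  then show ?thesis unfolding rf_def using q(1) by blast
qed

lemma rf_finer: "finer q q' \<Longrightarrow> maps q baire baire \<Longrightarrow> rf g q' \<Longrightarrow> rf g q"
  unfolding rf_def using res_finer by blast

definition retr :: "'m \<Rightarrow> 'm \<Rightarrow> 'm \<Rightarrow> 'm" where
  "retr D y h = Lam baire (\<lambda>x. rr D y (ap h x))"

lemma ap_retr: "x \<epsilon> baire \<Longrightarrow> ap (retr D y h) x = rr D y (ap h x)"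
  unfolding retr_def by (rule ap_Lam) (intro dfi)
lemma retr_maps: "maps h baire baire \<Longrightarrow> y \<epsilon> baire \<Longrightarrow> maps (retr D y h) baire baire"
  unfolding retr_def by (rule Lam_maps) (intro dfi, auto simp: rr_def intro: ap_in)
lemma dt_retr [dfi]: "dt s \<Longrightarrow> dt t \<Longrightarrow> dt u \<Longrightarrow> dt (\<lambda>e. retr (s e) (t e) (u e))"
proof -
  assume a: "dt s" "dt t" "dt u"
  show ?thesis unfolding retr_def
    by (intro dfi dt_ren[OF a(1)] dt_ren[OF a(2)] dt_ren[OF a(3)])
qed

text \<open>The retraction changes a fibre of a digit only by sets built from the preimage of
  \<open>D\<close>, and these are resolvable because \<open>D\<close> is in the generated
  algebra.\<close>

lemma rf_retr:
  assumes k: "k \<epsilon> F" and D: "D \<epsilon> Lst" and y: "y \<epsilon> baire"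
  shows "\<exists>q. q \<epsilon> Q \<and> rf (retr D y k) q"
proof -
  note km = F_maps[OF k]
  obtain q1 where q1: "q1 \<epsilon> Q" "rf k q1" using rf_F[OF k] by blast
  obtain q2 where q2: "q2 \<epsilon> Q" "res (pre k D) q2" using Lst_Res[OF Lst_pre[OF k D]] unfolding mem_Res by blast
  obtain q where q: "q \<epsilon> Q" "finer q q1" "finer q q2" using Q_join2[OF q1(1) q2(1)] by blast
  have r1: "rf k q" by (rule rf_finer[OF q(2) Q_maps[OF q(1)] q1(2)])
  have r2: "res (pre k D) q" by (rule res_finer[OF q(3) Q_maps[OF q(1)] q2(2)])
  have re: "res emp q" unfolding res_def by (intro allI impI exI[of _ zero]) simp
  have "res (fib (dig (retr D y k) i) n) q" if i: "i \<epsilon> omega" "n \<epsilon> omega" for i n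
  proof -
    \<comment> \<open>The points mapped outside \<open>D\<close> all take the value
      \<open>y\<close>, so they fall into this fibre together or not at all.\<close>
    define T where "T = (if ap y i = n then cpl (pre k D) else emp)"
    have "res (cap (pre k D) (fib (dig k i) n)) q" using res_cap[OF r2] r1 i unfolding rf_def by blast
    moreover have "res T q" unfolding T_def using res_cpl[OF r2] re by simp
    ultimately have "res (cup (cap (pre k D) (fib (dig k i) n)) T) q"
      unfolding cup_def using res_cpl[OF res_cap[OF res_cpl res_cpl]] by blast
    moreover have "fib (dig (retr D y k) i) n = cup (cap (pre k D) (fib (dig k i) n)) T"
    proof (rule set_ext)
      fix x show "x \<epsilon> fib (dig (retr D y k) i) n \<longleftrightarrow> x \<epsilon> cup (cap (pre k D) (fib (dig k i) n)) T"
        unfolding mem_cup mem_fib mem_cap T_def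
        using ap_in[OF km, of x] by (cases "ap k x \<epsilon> D"; cases "ap y i = n") (auto simp: ap_dig ap_retr rr_def)
    qed
    ultimately show ?thesis by simp
  qed
  then show ?thesis unfolding rf_def using q(1) by blast
qed

text \<open>A stage is coded as \<open>(n, E, x, h, y, q)\<close>: \<open>x\<close> chooses the class \<open>D\<close> of \<open>E n\<close>, \<open>h\<close> reduces \<open>A\<close> to \<open>A \<inter> D\<close>, the
  point \<open>y \<in> D \<setminus> A\<close> is the value outside \<open>D\<close> of the retraction onto \<open>D\<close>, and \<open>q\<close> resolves both maps \<open>phi\<close>.\<close>

definition sn :: "'m \<Rightarrow> 'm" where "sn p = pfst p"
definition sE :: "'m \<Rightarrow> 'm" where "sE p = pfst (psnd p)"
definition sx :: "'m \<Rightarrow> 'm" where "sx p = pfst (psnd (psnd p))"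
definition sh :: "'m \<Rightarrow> 'm" where "sh p = pfst (psnd (psnd (psnd p)))"
definition sy :: "'m \<Rightarrow> 'm" where "sy p = pfst (psnd (psnd (psnd (psnd p))))"
definition sq :: "'m \<Rightarrow> 'm" where "sq p = psnd (psnd (psnd (psnd (psnd p))))"
definition sD :: "'m \<Rightarrow> 'm" where "sD p = cls (ap (sE p) (sn p)) (sx p)"
definition phi :: "'m \<Rightarrow> 'm \<Rightarrow> 'm" where
  "phi i p = retr (sD p) (sy p) (if i = zero then sh p else cmps (sh p) f)"
text \<open>Collects what \<open>martin_monk\<close> requires of related points at the next level:
  agreement, agreement under \<open>q\<close>, and related images under both maps
  \<open>phi\<close>. Since the maps involve the retraction, their pullbacks go through
  \<open>rete\<close>.\<close>

definition nxt :: "'m \<Rightarrow> 'm" where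
  "nxt p = Lam omega (\<lambda>k. inte (inte (agk idb k) (agk (sq p) k))
    (inte (pree (sh p) (rete (ap (sE p) (sn p)) (sD p) (sy p) (ap (sE p) k)))
       (pree (cmps (sh p) f) (rete (ap (sE p) (sn p)) (sD p) (sy p) (ap (sE p) k)))))"

lemma dt_sel [dfi]:
  "dt s \<Longrightarrow> dt (\<lambda>e. sn (s e))" "dt s \<Longrightarrow> dt (\<lambda>e. sE (s e))" "dt s \<Longrightarrow> dt (\<lambda>e. sx (s e))"
  "dt s \<Longrightarrow> dt (\<lambda>e. sh (s e))" "dt s \<Longrightarrow> dt (\<lambda>e. sy (s e))" "dt s \<Longrightarrow> dt (\<lambda>e. sq (s e))"
  unfolding sn_def sE_def sx_def sh_def sy_def sq_def by (intro dfi; assumption)+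

lemma dt_sD [dfi]: "dt s \<Longrightarrow> dt (\<lambda>e. sD (s e))"
  by (rule dt1[of sD], unfold sD_def, intro dfi)
lemma dt_phi [dfi]: "dt s \<Longrightarrow> dt t \<Longrightarrow> dt (\<lambda>e. phi (s e) (t e))"
  by (rule dt2[of phi], unfold phi_def, intro dfi)
lemma dt_nxt [dfi]: "dt s \<Longrightarrow> dt (\<lambda>e. nxt (s e))"
  by (rule dt1[of nxt], unfold nxt_def, intro dfi)

lemma sel_simps [simp]:
  "sn (pair n (pair E (pair x (pair h (pair y q))))) = n"
  "sE (pair n (pair E c)) = E"
  "sx (pair n (pair E (pair x (pair h (pair y q))))) = x"
  "sh (pair n (pair E (pair x (pair h (pair y q))))) = h"
  "sy (pair n (pair E (pair x (pair h (pair y q))))) = y"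
  "sq (pair n (pair E (pair x (pair h (pair y q))))) = q"
  by (simp_all add: sn_def sE_def sx_def sh_def sy_def sq_def)

definition stage :: "'m \<Rightarrow> bool" where
  "stage p \<longleftrightarrow> sn p \<epsilon> omega \<and> (\<forall>k. k \<epsilon> omega \<longrightarrow> gd (ap (sE p) k)) \<and> sx p \<epsilon> baire \<and> sh p \<epsilon> F \<and> sy p \<epsilon> baire \<and> sq p \<epsilon> Q \<and>
    A = pre (sh p) (cap A (sD p)) \<and> sy p \<epsilon> sD p \<and> \<not> sy p \<epsilon> A \<and> rf (phi zero p) (sq p) \<and> rf (phi one p) (sq p)"

lemma df_stage [dfi]: "dt s \<Longrightarrow> df (\<lambda>e. stage (s e))"
  by (rule df1[of stage], unfold stage_def, intro dfi)

text \<open>Goodness of \<open>ap E n\<close>, applied to the identity and to \<open>A\<close>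
  itself, yields a class with a large part of \<open>A\<close>; everything else in the stage depends
  on this class.\<close>

lemma stage_ex:
  assumes n: "n \<epsilon> omega" and E: "\<And>k. k \<epsilon> omega \<Longrightarrow> gd (ap E k)"
  shows "\<exists>c. c \<epsilon> prd baire (prd F (prd baire Q)) \<and> stage (pair n (pair E c))"
proof -
  let ?e = "ap E n"
  note e = E[OF n]
  obtain x where x: "x \<epsilon> baire" "lg (cap A (pre idb (cls ?e x)))"
    using gd_lg[OF e lips_F[OF lips_idb] lg_A] by blast
  define D where "D = cls ?e x"
  have DL: "D \<epsilon> Lst" unfolding D_def by (rule gd_cls[OF e x(1)])
  have "lg (cap A D)" using x(2) pre_idb[OF Lst_subs[OF DL]] unfolding D_def by simp
  then obtain h where h: "h \<epsilon> F" "A = pre h (cap A D)" unfolding lg_def by blast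
  \<comment> \<open>If \<open>D\<close> were contained in \<open>A\<close>, then \<open>A\<close>
    would be the preimage of \<open>D\<close> under \<open>h\<close> and thus lie in the generated
    algebra, against \<open>A_Lst\<close>.\<close>
  have "\<exists>y. y \<epsilon> D \<and> \<not> y \<epsilon> A"
  proof (rule ccontr)
    assume "\<not> ?thesis"
    then have "cap A D = D" using Lst_subs[OF DL] cap_eqI unfolding subs_def by blast
    then have "A = pre h D" using h(2) by simp
    then show False using Lst_pre[OF h(1) DL] A_Lst by simp
  qed
  then obtain y where y: "y \<epsilon> D" "\<not> y \<epsilon> A" by blast
  have yb: "y \<epsilon> baire" using y(1) subsD[OF Lst_subs[OF DL]] by blast
  obtain q1 where q1: "q1 \<epsilon> Q" "rf (retr D y h) q1" using rf_retr[OF h(1) DL yb] by blast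
  obtain q2 where q2: "q2 \<epsilon> Q" "rf (retr D y (cmps h f)) q2" using rf_retr[OF F_comp[OF h(1) f_F] DL yb] by blast
  obtain q where q: "q \<epsilon> Q" "finer q q1" "finer q q2" using Q_join2[OF q1(1) q2(1)] by blast
  let ?p = "pair n (pair E (pair x (pair h (pair y q))))"
  have sD: "sD ?p = D" unfolding sD_def D_def by simp
  have "rf (phi zero ?p) q" "rf (phi one ?p) q"
    unfolding phi_def sD
    using rf_finer[OF q(2) Q_maps[OF q(1)] q1(2)] rf_finer[OF q(3) Q_maps[OF q(1)] q2(2)] by simp_all
  moreover have "pair x (pair h (pair y q)) \<epsilon> prd baire (prd F (prd baire Q))"
    using x h(1) yb q(1) by simp
  ultimately show ?thesis
    unfolding stage_def using n E x h y yb q(1) by (intro exI[of _ "pair x (pair h (pair y q))"]) (simp add: sD h(2)[symmetric])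
qed

lemma stage_nxt:
  assumes p: "stage p" and k: "k \<epsilon> omega"
  shows "gd (ap (nxt p) k)"
    and "pair a b \<epsilon> ap (nxt p) k \<Longrightarrow> agree k a b \<and> agree k (ap (sq p) a) (ap (sq p) b) \<and>
      pair (ap (phi i p) a) (ap (phi i p) b) \<epsilon> ap (sE p) k"
proof -
  have s: "sn p \<epsilon> omega" "\<And>k. k \<epsilon> omega \<Longrightarrow> gd (ap (sE p) k)" "sx p \<epsilon> baire" "sh p \<epsilon> F" "sy p \<epsilon> baire" "sq p \<epsilon> Q"
    using p unfolding stage_def by auto
  have d: "dt (\<lambda>e. inte (inte (agk idb (e 0)) (agk (sq p) (e 0)))
    (inte (pree (sh p) (rete (ap (sE p) (sn p)) (sD p) (sy p) (ap (sE p) (e 0))))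
       (pree (cmps (sh p) f) (rete (ap (sE p) (sn p)) (sD p) (sy p) (ap (sE p) (e 0))))))" by (intro dfi)
  note nx = ap_Lam[OF d k, folded nxt_def]
  have r: "gd (rete (ap (sE p) (sn p)) (sD p) (sy p) (ap (sE p) k))"
    by (rule gd_rete[OF s(2)[OF s(1)] s(2)[OF k] s(3) sD_def s(5)])
  show "gd (ap (nxt p) k)" unfolding nx
    by (intro gd_inte gd_agk[OF idb_Q k] gd_agk[OF s(6) k] gd_pree[OF s(4) r] gd_pree[OF F_comp[OF s(4) f_F] r])
  assume "pair a b \<epsilon> ap (nxt p) k"
  then show "agree k a b \<and> agree k (ap (sq p) a) (ap (sq p) b) \<and> pair (ap (phi i p) a) (ap (phi i p) b) \<epsilon> ap (sE p) k"
    unfolding nx mem_inte mem_agk mem_pree mem_rete phi_def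
    using ap_idb[of a] ap_idb[of b] by (auto simp: ap_retr)
qed

lemma nxt_maps: "stage p \<Longrightarrow> maps (nxt p) omega (pow (prd baire baire))"
  unfolding nxt_def
  by (rule Lam_maps) (intro dfi, use agk_prd in \<open>auto simp: subs_def mem_inte\<close>)

text \<open>A point is in \<open>A\<close> exactly if \<open>h\<close> sends it into
  \<open>A\<close> and \<open>D\<close>. Where \<open>h\<close> leaves \<open>D\<close> the
  retraction substitutes \<open>y\<close>, which is outside \<open>A\<close> too, so membership is
  undisturbed. Composing with \<open>f\<close> first flips it.\<close>

lemma phi_props:
  assumes p: "stage p"
  shows "maps (phi i p) baire baire"
    and "x \<epsilon> baire \<Longrightarrow> ap (phi i p) x \<epsilon> sD p"
    and "x \<epsilon> baire \<Longrightarrow> ap (phi i p) x \<epsilon> A \<longleftrightarrow> (x \<epsilon> A \<longleftrightarrow> i = zero)"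
    and "rf (phi i p) (sq p)"
proof -
  have s: "sh p \<epsilon> F" "sy p \<epsilon> baire" "A = pre (sh p) (cap A (sD p))" "sy p \<epsilon> sD p" "\<not> sy p \<epsilon> A"
    "rf (phi zero p) (sq p)" "rf (phi one p) (sq p)"
    using p unfolding stage_def by auto
  let ?k = "if i = zero then sh p else cmps (sh p) f"
  have hm: "maps (sh p) baire baire" "maps f baire baire" using F_maps s(1) f_F by auto
  have km: "maps ?k baire baire" using hm cmps_maps by simp
  show "maps (phi i p) baire baire" unfolding phi_def by (rule retr_maps[OF km s(2)])
  show "ap (phi i p) x \<epsilon> sD p" if "x \<epsilon> baire"
    unfolding phi_def ap_retr[OF that] using s(4) by (simp add: rr_def)
  show "rf (phi i p) (sq p)"
  proof (cases "i = zero")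
    case False
    then have "phi i p = phi one p" unfolding phi_def by simp
    then show ?thesis using s(7) by simp
  qed (use s(6) in simp)
  have h: "z \<epsilon> A \<longleftrightarrow> ap (sh p) z \<epsilon> A \<and> ap (sh p) z \<epsilon> sD p" if z: "z \<epsilon> baire" for z
    using arg_cong[OF s(3), of "\<lambda>B. z \<epsilon> B"] z ap_in[OF hm(1) z] by simp
  have fA: "z \<epsilon> A \<longleftrightarrow> \<not> ap f z \<epsilon> A" if z: "z \<epsilon> baire" for z
    using arg_cong[OF A_f, of "\<lambda>B. z \<epsilon> B"] z ap_in[OF hm(2) z] by simp
  show "ap (phi i p) x \<epsilon> A \<longleftrightarrow> (x \<epsilon> A \<longleftrightarrow> i = zero)" if x: "x \<epsilon> baire"
  proof -
    have "ap (phi i p) x \<epsilon> A \<longleftrightarrow> ap ?k x \<epsilon> A \<and> ap ?k x \<epsilon> sD p"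
      unfolding phi_def ap_retr[OF x] using s(5) by (simp add: rr_def)
    also have "\<dots> \<longleftrightarrow> (x \<epsilon> A \<longleftrightarrow> i = zero)"
      using h[OF x] h[OF ap_in[OF hm(2) x]] fA[OF x] ap_cmps[OF x] by auto
    finally show ?thesis .
  qed
qed

text \<open>Only the class, the reduction, the point and the resolution are chosen at a stage, and
  these come from a coded set. The sequence of relations is computed by \<open>nxt\<close>, so the
  choice principle \<open>dep_choice\<close> applies although the stages themselves are not shown to
  be coded.\<close>

theorem ex_flip_set: "\<exists>Z. flip_set Z"
proof -
  define K where "K = prd baire (prd F (prd baire Q))"
  define SE where "SE = funs omega (pow (prd baire baire))"
  define X where "X = Sep (prd omega (prd SE K)) stage"
  have X: "p \<epsilon> X \<longleftrightarrow> p \<epsilon> prd omega (prd SE K) \<and> stage p" for p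
    unfolding X_def by (rule mem_Sep) (intro dfi)
  define t where "t p c = pair (succ (sn p)) (pair (nxt p) c)" for p c
  define E0 where "E0 = Lam omega (agk idb)"
  have d0: "dt (\<lambda>e. agk idb (e 0))" by (intro dfi)
  have E0: "ap E0 k = agk idb k" if "k \<epsilon> omega" for k unfolding E0_def by (rule ap_Lam[OF d0 that])
  have E0S: "E0 \<epsilon> SE" unfolding SE_def E0_def mem_funs by (rule Lam_maps[OF d0]) (simp add: agk_prd)
  obtain c0 where c0: "c0 \<epsilon> K" "stage (pair zero (pair E0 c0))"
    using stage_ex[OF zero_omega, of E0] E0 gd_agk[OF idb_Q] unfolding K_def by auto
  have "\<exists>h. maps h omega X \<and> ap h zero = pair zero (pair E0 c0) \<and>
    (\<forall>n. n \<epsilon> omega \<longrightarrow> (\<lambda>p p'. \<exists>c. c \<epsilon> K \<and> p' = t p c) (ap h n) (ap h (succ n)))"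
  proof (rule dep_choice[of t])
    show "dt (\<lambda>e. t (e 0) (e (Suc 0)))" unfolding t_def by (intro dfi)
    show "df (\<lambda>e. \<exists>c. c \<epsilon> K \<and> e (Suc 0) = t (e 0) c)" unfolding t_def by (intro dfi)
    show "pair zero (pair E0 c0) \<epsilon> X" unfolding X using c0 E0S by simp
    show "coded K" unfolding K_def by (intro coded_prd coded_baire coded_F coded_Q)
    fix p assume "p \<epsilon> X"
    then have p: "stage p" unfolding X by blast
    then have n: "succ (sn p) \<epsilon> omega" unfolding stage_def using succ_omega by blast
    obtain c where c: "c \<epsilon> K" "stage (t p c)"
      using stage_ex[OF n, of "nxt p"] stage_nxt(1)[OF p] unfolding K_def t_def by blast
    have "t p c \<epsilon> X" unfolding X using c n nxt_maps[OF p] by (simp add: t_def SE_def)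
    then show "\<exists>c. c \<epsilon> K \<and> t p c \<epsilon> X \<and> (\<exists>c'. c' \<epsilon> K \<and> t p c = t p c')" using c(1) by blast
  qed
  then obtain h where h: "maps h omega X" "ap h zero = pair zero (pair E0 c0)"
    "\<And>n. n \<epsilon> omega \<Longrightarrow> \<exists>c. c \<epsilon> K \<and> ap h (succ n) = t (ap h n) c" by blast
  have st: "stage (ap h n)" if "n \<epsilon> omega" for n using ap_in[OF h(1) that] unfolding X by blast
  have next_sel: "sn (t p c) = succ (sn p)" "sE (t p c) = nxt p" for p c
    unfolding t_def sn_def sE_def by simp_all
  have sn: "sn (ap h n) = n" if "n \<epsilon> omega" for n using that
  proof (induction n rule: omega_induct)
    case df show ?case by (intro dfi)
  next
    case zero show ?case unfolding h(2) sn_def by simp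
  next
    case (succ n)
    obtain c where "ap h (succ n) = t (ap h n) c" using h(3)[OF succ(1)] by blast
    then show ?case using next_sel succ(2) by simp
  qed
  have nx: "sE (ap h (succ n)) = nxt (ap h n)" if n: "n \<epsilon> omega" for n
  proof -
    obtain c where "ap h (succ n) = t (ap h n) c" using h(3)[OF n] by blast
    then show ?thesis using next_sel by simp
  qed
  show ?thesis
  proof (rule martin_monk[where g = "\<lambda>i n. phi i (ap h n)" and q = "\<lambda>n. sq (ap h n)" and E = "\<lambda>n. sE (ap h n)" and A = A])
    show "dt (\<lambda>e. phi (e 0) (ap h (e (Suc 0))))" "dt (\<lambda>e. sE (ap h (e 0)))" by (intro dfi)+
    fix n assume n: "n \<epsilon> omega"
    note sn' = sn[OF n] and s = st[OF n]
    show "maps (phi i (ap h n)) baire baire" "rf (phi i (ap h n)) (sq (ap h n))" for i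
      using phi_props[OF s] by blast+
    show "ap (phi i (ap h n)) x \<epsilon> A \<longleftrightarrow> (x \<epsilon> A \<longleftrightarrow> i = zero)" if "x \<epsilon> baire" for i x
      by (rule phi_props(3)[OF s that])
    show "maps (sq (ap h n)) baire baire" using s Q_maps unfolding stage_def by blast
    have e: "gd (ap (sE (ap h n)) n)" and x: "sx (ap h n) \<epsilon> baire" using s n unfolding stage_def by blast+
    show "pair (ap (phi i (ap h n)) a) (ap (phi i (ap h n)) b) \<epsilon> ap (sE (ap h n)) n"
      if ab: "a \<epsilon> baire" "b \<epsilon> baire" for i a b
    proof -
      have "ap (phi i (ap h n)) a \<epsilon> cls (ap (sE (ap h n)) n) (sx (ap h n))"
        "ap (phi i (ap h n)) b \<epsilon> cls (ap (sE (ap h n)) n) (sx (ap h n))"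
        using phi_props(2)[OF s ab(1), of i] phi_props(2)[OF s ab(2), of i] unfolding sD_def sn' .
      then show ?thesis unfolding mem_cls using gd_trans[OF e _ x] gd_sym[OF e x] by blast
    qed
    fix k a b assume k: "k \<epsilon> omega"
    show "pair (ap (phi i (ap h n)) a) (ap (phi i (ap h n)) b) \<epsilon> ap (sE (ap h n)) k \<and>
        agree k (ap (sq (ap h n)) a) (ap (sq (ap h n)) b)"
      if "pair a b \<epsilon> ap (sE (ap h (succ n))) k" for i
      using stage_nxt(2)[OF s k that[unfolded nx[OF n]], of i] by blast
    show "agree k a b" if ab: "pair a b \<epsilon> ap (sE (ap h n)) k"
    proof -
      from omega_cases[OF n] show ?thesis
      proof (elim disjE exE conjE)
        assume z: "n = zero"
        have "pair a b \<epsilon> agk idb k" using ab E0[OF k] unfolding z h(2) by simp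
        then show ?thesis unfolding mem_agk by (metis ap_idb)
      next
        fix m assume m: "m \<epsilon> omega" "n = succ m"
        show ?thesis using stage_nxt(2)[OF st[OF m(1)] k, of a b] ab unfolding m(2) nx[OF m(1)] by blast
      qed
    qed
  qed
qed

end

section \<open>Translation to the given definitions\<close>

context ZF_model
begin

lemma baire_app: "x \<epsilon> baire \<Longrightarrow> n \<epsilon> omega \<Longrightarrow> x \<cdot> n = ap x n"
  unfolding mem_baire by (rule app_ap)

lemma first_diff:
  assumes x: "x \<epsilon> baire" and y: "y \<epsilon> baire" and ne: "x \<noteq> y"
  shows "first_diff x y \<epsilon> omega" and "k \<epsilon> omega \<Longrightarrow> agree k x y \<longleftrightarrow> k \<sqsubseteq> first_diff x y"
proof -
  let ?P = "\<lambda>n. n \<epsilon> omega \<and> x \<cdot> n \<noteq> y \<cdot> n \<and> (\<forall>m. m \<epsilon> n \<longrightarrow> x \<cdot> m = y \<cdot> m)"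
  have P: "?P n \<longleftrightarrow> n \<epsilon> omega \<and> ap x n \<noteq> ap y n \<and> agree n x y" for n
    unfolding agree_def using baire_app[OF x] baire_app[OF y] mem_omegaD by metis
  obtain n0 where "n0 \<epsilon> omega" "ap x n0 \<noteq> ap y n0" using baire_ext[OF x y] ne by blast
  then obtain n where n: "n \<epsilon> omega" "ap x n \<noteq> ap y n" "agree n x y"
    using omega_least_ex[of "\<lambda>n. ap x n \<noteq> ap y n" n0] unfolding agree_def by (auto simp: dfi)
  have u: "m = n" if "m \<epsilon> omega" "ap x m \<noteq> ap y m" "agree m x y" for m
    using omega_linear[OF that(1) n(1)] that n unfolding agree_def by blast
  have e: "first_diff x y = n" unfolding first_diff_def P
    by (rule the_equality) (use n u in blast)+
  show "first_diff x y \<epsilon> omega" unfolding e by (rule n(1))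
  show "agree k x y \<longleftrightarrow> k \<sqsubseteq> first_diff x y" if k: "k \<epsilon> omega"
    unfolding e omega_subset[OF k n(1)]
  proof
    assume "agree k x y"
    then have "\<not> n \<epsilon> k" using n(2) unfolding agree_def by blast
    then show "k \<epsilon> n \<or> k = n" using omega_linear[OF k n(1)] by blast
  next
    assume "k \<epsilon> n \<or> k = n"
    then show "agree k x y" using n(3) agree_mono n(1) by blast
  qed
qed

text \<open>For distinct reals, the depths of agreement are those up to the first difference, so
  comparing distances means inheriting depths. If \<open>x = y\<close>, all depths are inherited,
  which forces \<open>a = b\<close>.\<close>

lemma dist_le_agree:
  assumes a: "a \<epsilon> baire" "b \<epsilon> baire" and x: "x \<epsilon> baire" "y \<epsilon> baire"
  shows "dist_le a b x y \<longleftrightarrow> (\<forall>k. k \<epsilon> omega \<and> agree k x y \<longrightarrow> agree k a b)"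
proof (cases "a = b")
  case True then show ?thesis by (simp add: dist_le_def)
next
  case ab: False
  note fa = first_diff[OF a ab]
  show ?thesis
  proof (cases "x = y")
    case True
    then show ?thesis using ab agree_all[OF a] by (auto simp: dist_le_def)
  next
    case xy: False
    note fx = first_diff[OF x xy]
    have "first_diff x y \<sqsubseteq> first_diff a b \<longleftrightarrow> (\<forall>k. k \<epsilon> omega \<and> agree k x y \<longrightarrow> agree k a b)"
    proof
      assume "first_diff x y \<sqsubseteq> first_diff a b"
      then show "\<forall>k. k \<epsilon> omega \<and> agree k x y \<longrightarrow> agree k a b" using fa(2) fx(2) unfolding subs_def by blast
    next
      assume r: "\<forall>k. k \<epsilon> omega \<and> agree k x y \<longrightarrow> agree k a b"
      have "agree (first_diff x y) x y" using fx(2)[OF fx(1)] by (simp add: subs_def)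
      then show "first_diff x y \<sqsubseteq> first_diff a b" using r fx(1) fa(2)[OF fx(1)] by blast
    qed
    then show ?thesis using ab xy by (simp add: dist_le_def)
  qed
qed

lemma mem_Lip [simp]: "u \<epsilon> Lip \<longleftrightarrow> lips u"
proof -
  have "(u \<epsilon> funs baire baire \<and> (\<forall>x y. x \<epsilon> baire \<and> y \<epsilon> baire \<longrightarrow> dist_le (u \<cdot> x) (u \<cdot> y) x y)) \<longleftrightarrow>
      u \<epsilon> funs baire baire \<and> lips u" for u
  proof (cases "maps u baire baire")
    case True
    then show ?thesis
      unfolding lips_def using app_ap[OF True] ap_in[OF True] dist_le_agree by (simp, blast)
  qed simp
  then have e: "Lip = Sep (funs baire baire) lips" unfolding Lip_def Sep_def by simp
  have "df (\<lambda>e. lips (e 0))" by (intro dfi)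
  from mem_Sep[OF this] show ?thesis unfolding e using lips_maps by auto
qed

lemma compl_cpl: "compl A = cpl A" unfolding compl_def cpl_def Sep_def ..

lemma preimage_pre: "maps f baire baire \<Longrightarrow> preimage f B = pre f B"
  unfolding preimage_def pre_def Sep_def by (rule arg_cong[of _ _ Coll]) (auto simp: app_ap)

lemma inter_cap: "A \<sqsubseteq> baire \<Longrightarrow> inter A B = cap A B"
proof -
  assume "A \<sqsubseteq> baire"
  then have "(x \<epsilon> A \<and> x \<epsilon> B) = (x \<epsilon> baire \<and> x \<epsilon> A \<and> x \<epsilon> B)" for x unfolding subs_def by blast
  then show ?thesis unfolding inter_def cap_def Sep_def by simp
qed

lemma comp_cmps: "maps f baire baire \<Longrightarrow> maps g baire baire \<Longrightarrow> comp f g = cmps f g"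
proof -
  assume f: "maps f baire baire" and g: "maps g baire baire"
  have "(\<exists>x. x \<epsilon> baire \<and> p = pair x (f \<cdot> (g \<cdot> x))) = (\<exists>x. x \<epsilon> baire \<and> p = pair x (ap f (ap g x)))" for p
    using app_ap[OF g] app_ap[OF f] ap_in[OF g] by (intro ex_cong1 conj_cong) auto
  then show ?thesis unfolding comp_def cmps_def Lam_def Repl_def by simp
qed

lemma reducible_Lip: "reducible Lip A B \<longleftrightarrow> lle A B"
  unfolding reducible_def lle_def mem_Lip
  by (intro ex_cong1 conj_cong) (auto simp: preimage_pre lips_maps)

lemma reducible_pre: "F \<sqsubseteq> funs baire baire \<Longrightarrow> reducible F A B \<longleftrightarrow> (\<exists>f. f \<epsilon> F \<and> A = pre f B)"
  unfolding reducible_def subs_def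
  by (intro ex_cong1 conj_cong) (auto simp: preimage_pre)

lemma mem_cone: "x \<epsilon> cone s \<longleftrightarrow> x \<epsilon> baire \<and> s \<sqsubseteq> x"
  unfolding cone_def by (subst Coll_Sep[of _ baire]) (simp_all add: mem_Sep dfi)

lemma zcone_cone: "n \<epsilon> omega \<Longrightarrow> \<exists>s. fin_seq s \<and> zcone n = cone s"
proof (intro exI conjI)
  assume n: "n \<epsilon> omega"
  define s where "s = Lam n (\<lambda>_. zero)"
  have d: "dt (\<lambda>e. zero)" by (intro dfi)
  have "maps s n omega" unfolding s_def by (rule Lam_maps[OF d]) simp
  then show "fin_seq s" unfolding fin_seq_def using n by blast
  show "zcone n = cone s"
  proof (rule set_ext)
    fix x
    have "s \<sqsubseteq> x \<longleftrightarrow> agree n x (cst zero)" if x: "x \<epsilon> baire"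
    proof -
      have "s \<sqsubseteq> x \<longleftrightarrow> (\<forall>m. m \<epsilon> n \<longrightarrow> pair m zero \<epsilon> x)" unfolding s_def subs_def pair_Lam[OF d] by blast
      also have "\<dots> \<longleftrightarrow> (\<forall>m. m \<epsilon> n \<longrightarrow> ap x m = ap (cst zero) m)"
        using maps_pair[OF x[unfolded mem_baire]] mem_omegaD[OF _ n] ap_cst by metis
      finally show ?thesis unfolding agree_def .
    qed
    then show "x \<epsilon> zcone n \<longleftrightarrow> x \<epsilon> cone s" unfolding mem_cone by auto
  qed
qed

text \<open>A depth beyond the lengths of both finite sequences confines the neighbourhoods to the
  two cones that witness closedness.\<close>

lemma Sigma11_sig: "Sigma11 X \<Longrightarrow> sig X"
proof -
  assume "Sigma11 X"
  then obtain C where C: "closed_rel C" "X = Coll (\<lambda>x. \<exists>y. pair x y \<epsilon> C)" unfolding Sigma11_def by blast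
  have Cb: "x \<epsilon> baire \<and> y \<epsilon> baire" if "pair x y \<epsilon> C" for x y
  proof -
    have "\<exists>x' y'. x' \<epsilon> baire \<and> y' \<epsilon> baire \<and> pair x y = pair x' y'" using C(1) that unfolding closed_rel_def by blast
    then show ?thesis by auto
  qed
  have "X = Sep baire (\<lambda>x. \<exists>y. pair x y \<epsilon> C)" unfolding C(2) by (rule Coll_Sep) (use Cb in blast)
  moreover have "df (\<lambda>e. \<exists>y. pair (e 0) y \<epsilon> C)" by (intro dfi)
  ultimately have X: "x \<epsilon> X \<longleftrightarrow> x \<epsilon> baire \<and> (\<exists>y. y \<epsilon> baire \<and> pair x y \<epsilon> C)" for x
    using mem_Sep[of "\<lambda>x. \<exists>y. pair x y \<epsilon> C"] Cb by blast
  have sub: "s \<sqsubseteq> x'" if s: "maps s n omega" "s \<sqsubseteq> x" "n \<epsilon> k" and k: "k \<epsilon> omega" and x: "x \<epsilon> baire" "x' \<epsilon> baire" "agree k x x'"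
    for s n k x x'
  proof (rule subsI)
    fix p assume p: "p \<epsilon> s"
    then obtain i j where ij: "i \<epsilon> n" "p = pair i j" using s(1) unfolding maps_def by blast
    have "pair i j \<epsilon> x" using p s(2) ij(2) unfolding subs_def by blast
    then have i: "i \<epsilon> omega" "j = ap x i" using maps_pair[OF x(1)[unfolded mem_baire]] by auto
    have "i \<epsilon> k" by (rule omega_trans[OF ij(1) s(3) k])
    then have "j = ap x' i" using x(3) i(2) unfolding agree_def by simp
    then show "p \<epsilon> x'" unfolding ij(2) using maps_pair[OF x(2)[unfolded mem_baire]] i(1) by simp
  qed
  have "\<exists>k. k \<epsilon> omega \<and> (\<forall>x' y'. x' \<epsilon> baire \<and> y' \<epsilon> baire \<and> agree k x x' \<and> agree k y y' \<longrightarrow> \<not> pair x' y' \<epsilon> C)"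
    if xy: "x \<epsilon> baire" "y \<epsilon> baire" "\<not> pair x y \<epsilon> C" for x y
  proof -
    obtain s t where st: "fin_seq s" "fin_seq t" "x \<epsilon> cone s" "y \<epsilon> cone t"
      "\<forall>x' y'. x' \<epsilon> cone s \<and> y' \<epsilon> cone t \<longrightarrow> \<not> pair x' y' \<epsilon> C"
      using C(1) xy unfolding closed_rel_def by metis
    obtain n where n: "n \<epsilon> omega" "maps s n omega" using st(1) unfolding fin_seq_def by blast
    obtain m where m: "m \<epsilon> omega" "maps t m omega" using st(2) unfolding fin_seq_def by blast
    obtain k where k: "k \<epsilon> omega" "n \<epsilon> k" "m \<epsilon> k" using omega_max[OF n(1) m(1)] by blast
    show ?thesis
    proof (intro exI[of _ k] conjI k(1) allI impI)
      fix x' y' assume a: "x' \<epsilon> baire \<and> y' \<epsilon> baire \<and> agree k x x' \<and> agree k y y'"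
      have "s \<sqsubseteq> x'" by (rule sub[OF n(2) _ k(2,1) xy(1)]) (use st(3) a in \<open>simp_all add: mem_cone\<close>)
      moreover have "t \<sqsubseteq> y'" by (rule sub[OF m(2) _ k(3,1) xy(2)]) (use st(4) a in \<open>simp_all add: mem_cone\<close>)
      ultimately show "\<not> pair x' y' \<epsilon> C" using st(5) a unfolding mem_cone by blast
    qed
  qed
  then show ?thesis unfolding sig_def using X by blast
qed

lemma mem_range: "maps D omega Z \<Longrightarrow> B \<epsilon> range D \<longleftrightarrow> (\<exists>n. n \<epsilon> omega \<and> B = ap D n)"
proof -
  assume D: "maps D omega Z"
  have "(\<exists>n. n \<epsilon> omega \<and> A = D \<cdot> n) = (\<exists>n. n \<epsilon> omega \<and> A = ap D n)" for A
    using app_ap[OF D] by (intro ex_cong1 conj_cong) auto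
  then have "range D = Repl omega (ap D)" unfolding range_def Repl_def by simp
  moreover have "dt (\<lambda>e. ap D (e 0))" by (intro dfi)
  ultimately show ?thesis using mem_Repl by simp
qed

lemma mem_preimages:
  assumes f: "maps f baire baire" and D: "maps D omega Z"
  shows "B \<epsilon> Coll (\<lambda>B. \<exists>n. n \<epsilon> omega \<and> B = preimage f (D \<cdot> n)) \<longleftrightarrow> (\<exists>n. n \<epsilon> omega \<and> B = pre f (ap D n))"
proof -
  have "(\<exists>n. n \<epsilon> omega \<and> A = preimage f (D \<cdot> n)) = (\<exists>n. n \<epsilon> omega \<and> A = pre f (ap D n))" for A
    using app_ap[OF D] preimage_pre[OF f] by (intro ex_cong1 conj_cong) auto
  then have "Coll (\<lambda>B. \<exists>n. n \<epsilon> omega \<and> B = preimage f (D \<cdot> n)) = Repl omega (\<lambda>n. pre f (ap D n))" unfolding Repl_def by simp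
  moreover have "dt (\<lambda>e. pre f (ap D (e 0)))" by (intro dfi)
  ultimately show ?thesis using mem_Repl[of "\<lambda>n. pre f (ap D n)"] by simp
qed

lemma reds_locale:
  assumes "DC_reals" "SLO_Lip" and sr: "set_of_reductions F"
  shows "reds mem F"
proof
  have Fm: "maps f baire baire" if "f \<epsilon> F" for f
    using sr that unfolding set_of_reductions_def subs_def by simp
  show "maps f baire baire" if "f \<epsilon> F" for f using Fm[OF that] .
  show "cmps f g \<epsilon> F" if "f \<epsilon> F" "g \<epsilon> F" for f g
    using sr that comp_cmps[OF Fm[OF that(1)] Fm[OF that(2)]] unfolding set_of_reductions_def by metis
  show "u \<epsilon> F" if "lips u" for u using sr that unfolding set_of_reductions_def subs_def by simp
  obtain s where s: "maps s baire F" "\<And>f. f \<epsilon> F \<Longrightarrow> \<exists>x. x \<epsilon> baire \<and> s \<cdot> x = f"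
    using sr unfolding set_of_reductions_def by auto
  show "\<exists>s. maps s baire F \<and> (\<forall>f. f \<epsilon> F \<longrightarrow> (\<exists>x. x \<epsilon> baire \<and> ap s x = f))"
    using s app_ap[OF s(1)] by metis
  show "\<exists>h. maps h omega baire \<and> (\<forall>n. n \<epsilon> omega \<longrightarrow> pair (ap h n) (ap h (succ n)) \<epsilon> S)"
    if tot: "\<And>x. x \<epsilon> baire \<Longrightarrow> \<exists>y. y \<epsilon> baire \<and> pair x y \<epsilon> S" for S
  proof -
    obtain h where h: "maps h omega baire" "\<And>n. n \<epsilon> omega \<Longrightarrow> pair (h \<cdot> n) (h \<cdot> succ n) \<epsilon> S"
      using assms(1)[unfolded DC_reals_def, rule_format, of S] tot by auto
    then show ?thesis using app_ap[OF h(1)] succ_omega by (intro exI[of _ h]) auto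
  qed
  show "lle A B \<or> lle (cpl B) A" if "A \<sqsubseteq> baire" "B \<sqsubseteq> baire" for A B
    using assms(2) that unfolding SLO_Lip_def reducible_Lip compl_cpl by blast
qed

theorem decomposition:
  assumes "DC_reals" "SLO_Lip" and fs: "\<not> (\<exists>Z. flip_set Z)" and sr: "set_of_reductions F"
    and br: "Borel_reductions F" and sb: "sigma_boundedness_condition F"
  shows "strong_decomposition_property F"
proof -
  interpret reds mem F by (rule reds_locale[OF assms(1,2) sr])
  have FF: "F \<sqsubseteq> funs baire baire" using sr unfolding set_of_reductions_def by blast
  have DL: "Delta F = L" unfolding Delta_def L_def Sep_def reducible_pre[OF FF] by simp
  interpret breds mem F
  proof
    show "zcone n \<epsilon> L" if "n \<epsilon> omega" for n
      using zcone_cone[OF that] br DL unfolding Borel_reductions_def by auto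
    show "sig X" if "X \<epsilon> L" for X
      using br that DL Sigma11_sig unfolding Borel_reductions_def Delta11_def by auto
    show "\<exists>B'. B' \<epsilon> L \<and> (\<forall>n. n \<epsilon> omega \<longrightarrow> lle (pre f (ap D n)) B')"
      if f: "f \<epsilon> F" and D: "maps D omega (pow baire)" and B: "B \<epsilon> L" "\<And>n. n \<epsilon> omega \<Longrightarrow> lle (ap D n) B" for f D B
    proof -
      have "bounded_in (range D) L"
        unfolding bounded_in_def reducible_Lip mem_range[OF D] using B by blast
      then have "bounded_in (Coll (\<lambda>B. \<exists>n. n \<epsilon> omega \<and> B = preimage f (D \<cdot> n))) L"
        using sb f D unfolding sigma_boundedness_condition_def sigma_bounded_def DL by simp
      then show ?thesis
        unfolding bounded_in_def reducible_Lip mem_preimages[OF F_maps[OF f] D] by blast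
    qed
  qed
  show ?thesis unfolding strong_decomposition_property_def DL
  proof (intro allI impI, elim conjE)
    fix A assume A: "A \<sqsubseteq> baire" and Af: "reducible F A (compl A)" and AL: "\<not> A \<epsilon> L"
    obtain f where f: "f \<epsilon> F" "A = pre f (cpl A)" using Af unfolding reducible_pre[OF FF] compl_cpl by blast
    show "\<exists>D. bounded_partition L D \<and> (\<forall>n. n \<epsilon> omega \<longrightarrow> strictly_reducible F (inter A (D \<cdot> n)) A)"
    proof (rule ccontr)
      assume no: "\<not> ?thesis"
      interpret no_decomposition mem F A f
      proof
        show "A \<sqsubseteq> baire" "f \<epsilon> F" "A = pre f (cpl A)" "\<not> A \<epsilon> L" using A f AL by auto
        fix D B
        assume D: "maps D omega L"
          and disj: "\<And>n m. n \<epsilon> omega \<Longrightarrow> m \<epsilon> omega \<Longrightarrow> n \<noteq> m \<Longrightarrow> cap (ap D n) (ap D m) = emp"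
          and cov: "\<And>x. x \<epsilon> baire \<Longrightarrow> \<exists>n. n \<epsilon> omega \<and> x \<epsilon> ap D n"
          and B: "B \<epsilon> L" "\<And>n. n \<epsilon> omega \<Longrightarrow> lle (ap D n) B"
        have ez: "emp = zero" by (rule set_ext) simp
        have Ds: "ap D n \<sqsubseteq> baire" if "n \<epsilon> omega" for n using L_subs[OF ap_in[OF D that]] .
        have "bounded_partition L D" unfolding bounded_partition_def
        proof (intro conjI allI impI)
          show "D \<epsilon> funs omega L" using D by simp
          show "inter (D \<cdot> n) (D \<cdot> m) = zero" if "n \<epsilon> omega \<and> m \<epsilon> omega \<and> n \<noteq> m" for n m
            using that disj[of n m] app_ap[OF D] inter_cap[OF Ds] ez by simp
          show "x \<epsilon> baire \<longleftrightarrow> (\<exists>n. n \<epsilon> omega \<and> x \<epsilon> D \<cdot> n)" for x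
            using cov[of x] app_ap[OF D] Ds unfolding subs_def by metis
          show "bounded_in (range D) L"
            unfolding bounded_in_def reducible_Lip mem_range[OF D] using B by blast
        qed
        then obtain n where n: "n \<epsilon> omega" "\<not> strictly_reducible F (inter A (D \<cdot> n)) A" using no by blast
        then show "\<exists>n. n \<epsilon> omega \<and> ((\<exists>h. h \<epsilon> F \<and> cap A (ap D n) = pre h A) \<longrightarrow> (\<exists>h. h \<epsilon> F \<and> A = pre h (cap A (ap D n))))"
          unfolding strictly_reducible_def reducible_pre[OF FF] inter_cap[OF A] app_ap[OF D n(1)] by blast
      qed
      show False using ex_flip_set fs by blast
    qed
  qed
qed

end

theorem theorem4p7:
  fixes E :: "'m \<Rightarrow> 'm \<Rightarrow> bool" and F :: 'm
  assumes "ZF_model E"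
    and "ZF_model.DC_reals E"
    and "ZF_model.SLO_Lip E"
    and "\<not> (\<exists>Z. ZF_model.flip_set E Z)"
    and "ZF_model.set_of_reductions E F"
    and "ZF_model.Borel_reductions E F"
    and "ZF_model.sigma_boundedness_condition E F"
  shows "ZF_model.strong_decomposition_property E F"
  using assms by (rule ZF_model.decomposition)

end
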